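(* Let $q\ge1$. (1) If $q=o(d/\log d)$ and $dq=\tilde\omega(n^3)$, then $\mathsf{TV}\big(\mathsf{RGG}(n,\mathbb{T}^d,\mathsf{Unif},\sigma^q_{1/2},1/2),\ \mathsf{G}(n,1/2)\big)=o(1)$. (2) If $q=\Omega(d/\log d)$ and $d^2=\tilde\omega(n^3)$, then $\mathsf{TV}\big(\mathsf{RGG}(n,\mathbb{T}^d,\mathsf{Unif},\sigma^q_{1/2},1/2),\ \mathsf{G}(n,1/2)\big)=o(1)$.
   Context: Torus $\mathbb{T}^d=\mathbb{R}^d/2\mathbb{Z}^d$ (product of $d$ circles of circumference 2) with uniform measure; $|x-y|_C\in[0,1]$ is circular distance; $\|\mathbf{x}-\mathbf{y}\|_q=(\sum_{i=1}^d|x_i-y_i|_C^q)^{1/q}$. $\tau^q_{1/2}$ satisfies $\mathbf{P}[\|\mathbf{x}-\mathbf{y}\|_q\le\tau^q_{1/2}]=1/2$ for iid uniform $\mathbf{x},\mathbf{y}$. $\mathsf{RGG}(n,\mathbb{T}^d,\mathsf{Unif},\sigma^q_{1/2},1/2)$: iid uniform latent points $\mathbf{x}^1,\dots,\mathbf{x}^n$ on $\mathbb{T}^d$; edge $ij$ iff $\|\mathbf{x}^i-\mathbf{x}^j\|_q\le\tau^q_{1/2}$. $\mathsf{G}(n,1/2)$ is Erdős–Rényi. Asymptotics are as $n\to\infty$; $\tilde\omega$ hides polylogarithmic factors. *)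

theory Defs
  imports "HOL-Probability.Probability" "HOL-Library.Landau_Symbols"
begin

text \<open>Circle of circumference 2, represented by [0,2), with circular distance in [0,1].\<close>
definition circ_dist :: "real \<Rightarrow> real \<Rightarrow> real" where
  "circ_dist a b = (let t = 2 * frac ((a - b) / 2) in min t (2 - t))"

text \<open>Uniform measure on the torus T^d = (R/2Z)^d; points are functions on {..<d}.\<close>
definition unif_torus :: "nat \<Rightarrow> (nat \<Rightarrow> real) measure" where
  "unif_torus d = PiM {..<d} (\<lambda>_. uniform_measure lborel {0..<2::real})"

definition qdist :: "real \<Rightarrow> nat \<Rightarrow> (nat \<Rightarrow> real) \<Rightarrow> (nat \<Rightarrow> real) \<Rightarrow> real" where
  "qdist q d x y = (\<Sum>i<d. circ_dist (x i) (y i) powr q) powr (1 / q)"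

definition tau_half :: "real \<Rightarrow> nat \<Rightarrow> real" where
  "tau_half q d = (SOME \<tau>. measure (unif_torus d \<Otimes>\<^sub>M unif_torus d)
      {p \<in> space (unif_torus d \<Otimes>\<^sub>M unif_torus d). qdist q d (fst p) (snd p) \<le> \<tau>} = 1 / 2)"

text \<open>Graphs on vertex set {0..<n}: sets of pairs (i,j) with i<j<n.\<close>
definition vpairs :: "nat \<Rightarrow> (nat \<times> nat) set" where
  "vpairs n = {(i, j). i < j \<and> j < n}"

definition latent :: "nat \<Rightarrow> nat \<Rightarrow> (nat \<Rightarrow> nat \<Rightarrow> real) measure" where
  "latent n d = PiM {..<n} (\<lambda>_. unif_torus d)"

definition rgg_edges :: "nat \<Rightarrow> nat \<Rightarrow> real \<Rightarrow> (nat \<Rightarrow> nat \<Rightarrow> real) \<Rightarrow> (nat \<times> nat) set" where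
  "rgg_edges n d q X = {(i, j) \<in> vpairs n. qdist q d (X i) (X j) \<le> tau_half q d}"

definition rgg_prob :: "nat \<Rightarrow> nat \<Rightarrow> real \<Rightarrow> (nat \<times> nat) set \<Rightarrow> real" where
  "rgg_prob n d q G = measure (latent n d) {X \<in> space (latent n d). rgg_edges n d q X = G}"

text \<open>Probability that G(n,1/2) equals the graph G (G a subset of vpairs n).\<close>
definition er_prob :: "nat \<Rightarrow> (nat \<times> nat) set \<Rightarrow> real" where
  "er_prob n G = (1 / 2) ^ card (vpairs n)"

definition tv_rgg_er :: "nat \<Rightarrow> nat \<Rightarrow> real \<Rightarrow> real" where
  "tv_rgg_er n d q = (1 / 2) * (\<Sum>G \<in> Pow (vpairs n). \<bar>rgg_prob n d q G - er_prob n G\<bar>)"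

end

theory Submission
  imports Defs
begin

text \<open>
  Conditionally on the first \<open>k\<close> latent points, the next row of the adjacency matrix has a law whose
  chi-square divergence from uniform bits, averaged over these points, is \<open>E (1 + 4 \<gamma>(x,y))^k - 1\<close>,
  where \<open>\<gamma>(x,y)\<close> is the covariance of the neighbourhood indicators of two uniform points \<open>x\<close>, \<open>y\<close>.
  By the chain rule for relative entropy the squared total variation distance is at most
  \<open>\<Sum>k<n. (E exp (4 k \<gamma>) - 1)\<close>.

  Resampling one coordinate \<open>y i\<close> changes \<open>\<gamma>\<close> only through points \<open>w\<close> for which coordinate \<open>i\<close> is
  pivotal for both \<open>x\<close> and \<open>y\<close>, i.e. both sums over the other coordinates lie in a unit window below
  the threshold. This joint event has probability \<open>O(q/d)\<close>: reflecting \<open>w j\<close> at \<open>y j\<close> preserves the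
  distance to \<open>y j\<close> and changes the one to \<open>x j\<close>, and vice versa, so that the two sums can be
  randomised by independent signs and the Littlewood--Offord inequality applies to each of them.
  Up to logarithms, coordinate \<open>i\<close> matters only if its distance is within \<open>1/q + 1/d\<close> of the maximum \<open>1\<close>, which
  gives increments with second moments summing to about \<open>1/(dq) + 1/d\<^sup>2\<close>, and a bounded-difference
  argument bounds the exponential moment of \<open>\<gamma>\<close>.
\<close>

section \<open>Product measures\<close>

text \<open>The cube of n arises as follows. \<open>gam\<close> has mean zero in its second
  argument, so the linear term of its exponential moment vanishes. Row k then costs about k^2 d V,
  where V bounds the second moment of one increment, and the sum over k < n is of order n^3 d V. An
  increment is about p times (overlap + \<open>\<epsilon>\<close>^2), where p is of order q/d and
  the overlap of two arcs of measure \<open>\<epsilon>\<close> = O(log d / q + 1/d) can reach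
  \<open>\<epsilon>\<close> but has mean \<open>\<epsilon>\<close>^2. Hence V is of order p^2
  \<open>\<epsilon>\<close>^3, and d V is at most about log^3 d (1/(dq) + 1/d^2). Bounding
  increments by their supremum would lose a factor 1/\<open>\<epsilon>\<close>, so the
  bounded-difference inequality is of second-moment type.

  As q may vary with d in any way, no asymptotic formula for the threshold is used. What enters is
  scale-free (anticoncentration relative to T) or follows from 1/2 <= (min 1
  \<open>\<tau>\<close>)^d. All estimates have absolute constants, and the two regimes of q separate
  only in the final limit.\<close>

lemma (in prob_space) integrable_bounded:
  fixes f :: "'a \<Rightarrow> real"
  assumes "f \<in> borel_measurable M" "\<And>x. x \<in> space M \<Longrightarrow> \<bar>f x\<bar> \<le> B"
  shows "integrable M f"
  using assms by (intro integrable_const_bound[where B=B]) auto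

lemma (in prob_space) integral_abs_le:
  fixes f :: "'a \<Rightarrow> real"
  assumes "f \<in> borel_measurable M" "\<And>x. x \<in> space M \<Longrightarrow> \<bar>f x\<bar> \<le> B"
  shows "\<bar>integral\<^sup>L M f\<bar> \<le> B"
proof -
  have i: "integrable M f" by (rule integrable_bounded[OF assms])
  have "\<bar>integral\<^sup>L M f\<bar> \<le> (\<integral>x. \<bar>f x\<bar> \<partial>M)"
    using integral_norm_bound[of M f] by simp
  also have "\<dots> \<le> (\<integral>x. B \<partial>M)"
    using i assms by (intro integral_mono) auto
  finally show ?thesis by (simp add: prob_space)
qed

lemma (in prob_space) integral_le_const_real:
  fixes f :: "'a \<Rightarrow> real"
  assumes "integrable M f" "\<And>x. x \<in> space M \<Longrightarrow> f x \<le> B"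
  shows "integral\<^sup>L M f \<le> B"
  using integral_mono[OF assms(1) integrable_const[of B] assms(2)] by (simp add: prob_space)

text \<open>Integrated against a centred variable, this bound leaves only the second moment. For
  negative \<open>x\<close> it comes from the reciprocal of the Taylor lower bound for
  \<open>exp (-x)\<close>.\<close>

lemma exp_le_quadratic:
  fixes x :: real
  assumes "\<bar>x\<bar> \<le> 1"
  shows "exp x \<le> 1 + x + x\<^sup>2"
proof (cases "x \<ge> 0")
  case True then show ?thesis using exp_bound[of x] assms by auto
next
  case False
  have "exp x = 1 / exp (-x)" by (simp add: exp_minus inverse_eq_divide)
  also have "1 - x + x\<^sup>2/2 \<le> exp (-x)"
    using exp_lower_Taylor_quadratic[of "-x"] False by simp
  then have "1 / exp (-x) \<le> 1 / (1 - x + x\<^sup>2/2)"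
    using False by (intro divide_left_mono mult_pos_pos) (auto intro: add_pos_nonneg)
  also have "\<dots> \<le> 1 + x + x\<^sup>2"
  proof -
    have "1 \<le> (1 + x + x\<^sup>2) * (1 - x + x\<^sup>2/2)"
    proof -
      have "(1 + x + x\<^sup>2) * (1 - x + x\<^sup>2/2) - 1 = x\<^sup>2 * (1/2 - x/2 + x\<^sup>2/2)"
        by (simp add: field_simps power2_eq_square)
      also have "\<dots> \<ge> 0" using False by (intro mult_nonneg_nonneg add_nonneg_nonneg) auto
      finally show ?thesis by simp
    qed
    moreover have "0 < 1 - x + x\<^sup>2/2" using False by (auto intro: add_pos_nonneg)
    ultimately show ?thesis by (simp add: divide_le_eq)
  qed
  finally show ?thesis .
qed

locale iid_product = prob_space M for M :: "'a measure"
begin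

sublocale prod: product_sigma_finite "\<lambda>_::nat. M"
  by standard

abbreviation "P I \<equiv> PiM I (\<lambda>_::nat. M)"

lemma prob_space_P: "prob_space (P I)"
  by (intro prob_space_PiM prob_space_axioms)

lemma measurable_upd_pair [measurable]:
  "i \<in> I \<Longrightarrow> (\<lambda>(w, u). w(i := u)) \<in> P I \<Otimes>\<^sub>M M \<rightarrow>\<^sub>M P I"
  by (rule measurable_PiM_single')
     (auto simp: space_pair_measure space_PiM PiE_iff extensional_def fun_upd_def split_beta
        intro!: measurable_If)

lemma measurable_upd_comp:
  assumes "i \<in> I" "w \<in> N \<rightarrow>\<^sub>M P I" "u \<in> N \<rightarrow>\<^sub>M M"
  shows "(\<lambda>x. (w x)(i := u x)) \<in> N \<rightarrow>\<^sub>M P I"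
  using measurable_compose[OF measurable_Pair[OF assms(2,3)] measurable_upd_pair[OF assms(1)]] by simp

lemma space_upd:
  "w \<in> space (P I) \<Longrightarrow> u \<in> space M \<Longrightarrow> i \<in> I \<Longrightarrow> w(i := u) \<in> space (P I)"
  by (auto simp: space_PiM PiE_iff extensional_def)

text \<open>Fubini with the factor \<open>i\<close> split off. The inner integral no longer depends
  on \<open>w i\<close>, so the full product measure can stand on both sides.\<close>

lemma integral_upd_eq:
  fixes f :: "(nat \<Rightarrow> 'a) \<Rightarrow> real"
  assumes "finite I" "i \<in> I" "f \<in> borel_measurable (P I)" "\<And>w. w \<in> space (P I) \<Longrightarrow> \<bar>f w\<bar> \<le> B"
  shows "(\<integral>w. f w \<partial>P I) = (\<integral>w. (\<integral>u. f (w(i := u)) \<partial>M) \<partial>P I)"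
proof -
  interpret PI: prob_space "P I" by (rule prob_space_P)
  define J where "J = I - {i}"
  have I: "I = insert i J" "i \<notin> J" "finite J" using assms unfolding J_def by auto
  interpret PJ: prob_space "P J" by (rule prob_space_P)
  have int: "integrable (P I) f" by (rule PI.integrable_bounded) (use assms in auto)
  have mf: "(\<lambda>(w,u). f (w(i := u))) \<in> borel_measurable (P I \<Otimes>\<^sub>M M)"
    using measurable_compose[OF measurable_upd_pair[OF assms(2)] assms(3)] by (simp add: split_beta)
  have mg: "(\<lambda>w. \<integral>u. f (w(i := u)) \<partial>M) \<in> borel_measurable (P I)"
    using mf by (intro borel_measurable_lebesgue_integral) (simp add: split_beta)
  have bg: "\<bar>\<integral>u. f (w(i := u)) \<partial>M\<bar> \<le> B" if "w \<in> space (P I)" for w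
  proof (rule integral_abs_le)
    show "(\<lambda>u. f (w(i := u))) \<in> borel_measurable M"
      by (rule measurable_compose[OF measurable_upd_comp assms(3)]) (use that assms(2) in auto)
  qed (use that assms space_upd in auto)
  have ig: "integrable (P I) (\<lambda>w. \<integral>u. f (w(i := u)) \<partial>M)"
    by (rule PI.integrable_bounded[OF mg bg])
  have "(\<integral>w. f w \<partial>P I) = (\<integral>w. (\<integral>u. f (w(i := u)) \<partial>M) \<partial>P J)"
    unfolding I(1) by (rule prod.product_integral_insert) (use I int in auto)
  \<comment> \<open>A dummy average over \<open>v\<close>, overwritten by the inner update, brings
    the coordinate \<open>i\<close> back.\<close>
  also have "\<dots> = (\<integral>w. (\<integral>v. (\<integral>u. f ((w(i:=v))(i := u)) \<partial>M) \<partial>M) \<partial>P J)"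
    by (simp add: prob_space)
  also have "\<dots> = (\<integral>w. (\<integral>u. f (w(i := u)) \<partial>M) \<partial>P I)"
    unfolding I(1) by (rule prod.product_integral_insert[symmetric]) (use I ig in auto)
  finally show ?thesis .
qed

text \<open>The martingale method: coordinates are integrated out one at a time. The increment in
  one coordinate is centred and \<open>l\<close> times it is at most 1 in modulus, so it contributes
  a factor at most \<open>1 + l^2 V\<close>. As in Bernstein's inequality, and unlike in
  McDiarmid's, the bound \<open>h i\<close> depends on the current value of the coordinate, so
  \<open>V\<close> is a second moment and not a squared supremum.\<close>

lemma mgf_bounded_differences:
  fixes F :: "(nat \<Rightarrow> 'a) \<Rightarrow> real" and h :: "nat \<Rightarrow> 'a \<Rightarrow> real" and l V B :: real
  assumes "finite I"
    and "F \<in> borel_measurable (P I)" "\<And>w. w \<in> space (P I) \<Longrightarrow> \<bar>F w\<bar> \<le> B"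
    and "\<And>i. i \<in> I \<Longrightarrow> h i \<in> borel_measurable M"
    and "\<And>i u. i \<in> I \<Longrightarrow> u \<in> space M \<Longrightarrow> 0 \<le> h i u \<and> l * h i u \<le> 1"
    and "\<And>i w. i \<in> I \<Longrightarrow> w \<in> space (P I) \<Longrightarrow> \<bar>F w - (\<integral>u. F (w(i := u)) \<partial>M)\<bar> \<le> h i (w i)"
    and "\<And>i. i \<in> I \<Longrightarrow> (\<integral>u. (h i u)\<^sup>2 \<partial>M) \<le> V"
    and "0 \<le> l" "0 \<le> V"
  shows "(\<integral>w. exp (l * F w) \<partial>P I) \<le> exp (l * (\<integral>w. F w \<partial>P I) + card I * (l\<^sup>2 * V))"
  using assms
proof (induction I arbitrary: F rule: finite_induct)
  case empty
  have sp: "space (P {}) = {\<lambda>_. undefined}" by (simp add: space_PiM)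
  interpret E: prob_space "P {}" by (rule prob_space_P)
  have "(\<integral>w. exp (l * F w) \<partial>P {}) = (\<integral>w. exp (l * F (\<lambda>_. undefined)) \<partial>P {})"
    by (rule Bochner_Integration.integral_cong) (auto simp: sp)
  moreover have "(\<integral>w. F w \<partial>P {}) = (\<integral>w. F (\<lambda>_. undefined) \<partial>P {})"
    by (rule Bochner_Integration.integral_cong) (auto simp: sp)
  ultimately show ?case by (simp only: E.prob_space lebesgue_integral_const) simp
next
  case (insert i I)
  note mF = insert.prems(1) and bF = insert.prems(2) and mh = insert.prems(3) and bh = insert.prems(4)
    and dF = insert.prems(5) and hV = insert.prems(6)
  interpret PI: prob_space "P I" by (rule prob_space_P)
  interpret PiI: prob_space "P (insert i I)" by (rule prob_space_P)
  interpret PM: pair_prob_space "P I" M ..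
  have upd_m: "(\<lambda>(w, u). w(i := u)) \<in> P I \<Otimes>\<^sub>M M \<rightarrow>\<^sub>M P (insert i I)"
    by (rule measurable_add_dim)
  have upd_s: "w(i := u) \<in> space (P (insert i I))" if "w \<in> space (P I)" "u \<in> space M" for w u
    using that by (auto simp: space_PiM PiE_iff extensional_def)
  have mF2: "(\<lambda>(w,u). F (w(i := u))) \<in> borel_measurable (P I \<Otimes>\<^sub>M M)"
    using measurable_compose[OF upd_m mF] by (simp add: split_beta' fun_upd_def)
  have mF1: "(\<lambda>u. F (w(i := u))) \<in> borel_measurable M" if "w \<in> space (P I)" for w
    using measurable_compose[OF _ mF2, of "\<lambda>u. (w,u)" M] that by simp
  define Fb where "Fb w = (\<integral>u. F (w(i := u)) \<partial>M)" for w
  have mFb: "Fb \<in> borel_measurable (P I)"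
    unfolding Fb_def using mF2 by (intro borel_measurable_lebesgue_integral) (simp add: split_beta)
  have bFb: "\<bar>Fb w\<bar> \<le> B" if "w \<in> space (P I)" for w
    unfolding Fb_def by (rule integral_abs_le[OF mF1]) (use that bF upd_s in auto)
  have intF1: "integrable M (\<lambda>u. F (w(i := u)))" if "w \<in> space (P I)" for w
    by (rule integrable_bounded[OF mF1]) (use that bF upd_s in auto)
  have bFint: "integrable (P (insert i I)) F"
    by (rule PiI.integrable_bounded[OF mF]) (use bF in auto)
  have eF: "(\<integral>w. F w \<partial>P (insert i I)) = (\<integral>w. Fb w \<partial>P I)"
    unfolding Fb_def by (rule prod.product_integral_insert[OF insert(1,2) bFint])
  have expb: "\<bar>exp (l * F w)\<bar> \<le> exp (l * B)" if "w \<in> space (P (insert i I))" for w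
    using bF[OF that] insert.prems(7) by (auto intro!: mult_left_mono)
  have mE: "(\<lambda>w. exp (l * F w)) \<in> borel_measurable (P (insert i I))"
    using mF by measurable
  have inner: "(\<integral>u. exp (l * F (w(i := u))) \<partial>M) \<le> exp (l * Fb w) * exp (l\<^sup>2 * V)"
    if w: "w \<in> space (P I)" for w
  proof -
    define D where "D u = F (w(i := u)) - Fb w" for u
    have mD: "D \<in> borel_measurable M" unfolding D_def using mF1[OF w] by measurable
    have Dh: "\<bar>D u\<bar> \<le> h i u" if "u \<in> space M" for u
    proof -
      have "\<bar>F (w(i := u)) - (\<integral>v. F ((w(i := u))(i := v)) \<partial>M)\<bar> \<le> h i ((w(i := u)) i)"
        by (rule dF[OF _ upd_s[OF w that]]) simp
      then show ?thesis by (simp add: D_def Fb_def)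
    qed
    have lD: "\<bar>l * D u\<bar> \<le> 1" if "u \<in> space M" for u
      using mult_left_mono[OF Dh[OF that], of l] bh[of i u] that insert.prems(7)
      by (auto simp: abs_mult)
    have intD: "integrable M D" unfolding D_def using intF1[OF w] by auto
    have D0: "(\<integral>u. D u \<partial>M) = 0"
      unfolding D_def using intF1[OF w] by (simp add: Fb_def prob_space)
    have intD2: "integrable M (\<lambda>u. (D u)\<^sup>2)"
    proof (rule integrable_bounded[where B="(2*B)\<^sup>2"])
      show "\<bar>(D u)\<^sup>2\<bar> \<le> (2*B)\<^sup>2" if "u \<in> space M" for u
      proof -
        have "\<bar>D u\<bar> \<le> 2 * B" using bF[OF upd_s[OF w that]] bFb[OF w] unfolding D_def by linarith
        then show ?thesis using power_mono[of "\<bar>D u\<bar>" "2*B" 2] by simp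
      qed
    qed (use mD in measurable)
    have hint: "integrable M (\<lambda>u. (h i u)\<^sup>2)" if "l > 0"
    proof (rule integrable_bounded[where B="(1/l)\<^sup>2"])
      show "\<bar>(h i u)\<^sup>2\<bar> \<le> (1/l)\<^sup>2" if "u \<in> space M" for u
        using bh[of i u] that \<open>l > 0\<close> power_mono[of "h i u" "1/l" 2] by (auto simp: field_simps)
    qed (use mh in measurable)
    \<comment> \<open>Square integrability of \<open>h i\<close> is read off from
      \<open>l * h i u <= 1\<close>, which gives no bound when \<open>l = 0\<close>; hence the case
      split.\<close>
    have D2: "l\<^sup>2 * (\<integral>u. (D u)\<^sup>2 \<partial>M) \<le> l\<^sup>2 * V"
    proof (cases "l = 0")
      case False
      then have "l > 0" using insert.prems(7) by simp
      have "(\<integral>u. (D u)\<^sup>2 \<partial>M) \<le> (\<integral>u. (h i u)\<^sup>2 \<partial>M)"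
        by (rule integral_mono[OF intD2 hint[OF \<open>l > 0\<close>]])
           (use Dh in \<open>auto simp: abs_le_square_iff[symmetric] intro: order_trans[OF _ abs_ge_self]\<close>)
      then show ?thesis using hV[of i] by (intro mult_left_mono) auto
    qed simp
    have "(\<integral>u. exp (l * F (w(i := u))) \<partial>M) = (\<integral>u. exp (l * Fb w) * exp (l * D u) \<partial>M)"
      by (rule Bochner_Integration.integral_cong) (auto simp: D_def exp_add[symmetric] algebra_simps)
    also have "\<dots> \<le> (\<integral>u. exp (l * Fb w) * (1 + l * D u + l\<^sup>2 * (D u)\<^sup>2) \<partial>M)"
    proof (rule integral_mono)
      show "integrable M (\<lambda>u. exp (l * Fb w) * exp (l * D u))"
        by (rule integrable_mult_right, rule integrable_bounded[where B="exp 1"])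
           (use mD lD in \<open>auto simp: abs_le_iff\<close>)
      show "integrable M (\<lambda>u. exp (l * Fb w) * (1 + l * D u + l\<^sup>2 * (D u)\<^sup>2))"
        using intD intD2 by auto
      show "exp (l * Fb w) * exp (l * D u) \<le> exp (l * Fb w) * (1 + l * D u + l\<^sup>2 * (D u)\<^sup>2)"
        if "u \<in> space M" for u
        using exp_le_quadratic[OF lD[OF that]] by (simp add: power_mult_distrib)
    qed
    also have "\<dots> = exp (l * Fb w) * (1 + l\<^sup>2 * (\<integral>u. (D u)\<^sup>2 \<partial>M))"
      using intD intD2 D0 by (simp add: prob_space)
    also have "\<dots> \<le> exp (l * Fb w) * exp (l\<^sup>2 * V)"
    proof (rule mult_left_mono)
      show "1 + l\<^sup>2 * (\<integral>u. (D u)\<^sup>2 \<partial>M) \<le> exp (l\<^sup>2 * V)"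
        using D2 exp_ge_add_one_self[of "l\<^sup>2 * V"] by linarith
    qed simp
    finally show ?thesis .
  qed
  have "(\<integral>w. exp (l * F w) \<partial>P (insert i I)) = (\<integral>w. (\<integral>u. exp (l * F (w(i := u))) \<partial>M) \<partial>P I)"
    by (rule prod.product_integral_insert[OF insert(1,2)])
       (rule PiI.integrable_bounded[OF mE expb])
  also have "\<dots> \<le> (\<integral>w. exp (l * Fb w) * exp (l\<^sup>2 * V) \<partial>P I)"
  proof (rule integral_mono[OF _ _ inner])
    have "(\<lambda>(w,u). exp (l * F (w(i := u)))) \<in> borel_measurable (P I \<Otimes>\<^sub>M M)"
      using mF2 by (simp add: split_beta)
    then have "(\<lambda>w. \<integral>u. exp (l * F (w(i := u))) \<partial>M) \<in> borel_measurable (P I)"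
      by (intro borel_measurable_lebesgue_integral) (simp add: split_beta)
    moreover have "\<bar>\<integral>u. exp (l * F (w(i := u))) \<partial>M\<bar> \<le> exp (l * B)" if "w \<in> space (P I)" for w
      by (rule integral_abs_le) (use that mF1[OF that] expb upd_s in auto)
    ultimately show "integrable (P I) (\<lambda>w. \<integral>u. exp (l * F (w(i := u))) \<partial>M)"
      by (rule PI.integrable_bounded)
    show "integrable (P I) (\<lambda>w. exp (l * Fb w) * exp (l\<^sup>2 * V))"
      by (rule integrable_mult_left, rule PI.integrable_bounded[where B="exp (l * B)"])
         (use mFb bFb insert.prems(7) in \<open>auto simp: abs_le_iff intro!: mult_left_mono\<close>)
  qed
  also have "\<dots> = (\<integral>w. exp (l * Fb w) \<partial>P I) * exp (l\<^sup>2 * V)" by simp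
  also have "(\<integral>w. exp (l * Fb w) \<partial>P I) \<le> exp (l * (\<integral>w. Fb w \<partial>P I) + card I * (l\<^sup>2 * V))"
  proof (rule insert.IH[OF mFb bFb])
    \<comment> \<open>The marginal \<open>Fb\<close> inherits the increment bounds: averaging over
      coordinate \<open>i\<close> commutes with resampling coordinate \<open>j\<close>, and the
      bound \<open>h j\<close> sees coordinate \<open>j\<close> alone.\<close>
    fix j w assume j: "j \<in> I" and w: "w \<in> space (P I)"
    have ji: "j \<noteq> i" using j insert by auto
    have mG: "(\<lambda>(v,u). F ((w(j := v))(i := u))) \<in> borel_measurable (M \<Otimes>\<^sub>M M)"
    proof -
      have "(\<lambda>x. (w(j := fst x), snd x)) \<in> M \<Otimes>\<^sub>M M \<rightarrow>\<^sub>M P I \<Otimes>\<^sub>M M"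
        using w j by (auto intro!: measurable_Pair measurable_upd_comp)
      from measurable_compose[OF this mF2] show ?thesis by (simp add: split_beta)
    qed
    interpret MM: pair_prob_space M M ..
    have iG: "integrable (M \<Otimes>\<^sub>M M) (\<lambda>(v,u). F ((w(j := v))(i := u)))"
      by (rule MM.P.integrable_bounded[OF mG, where B=B])
         (use w j bF upd_s space_upd in \<open>auto simp: space_pair_measure\<close>)
    have "(\<integral>v. Fb (w(j := v)) \<partial>M) = (\<integral>u. (\<integral>v. F ((w(j := v))(i := u)) \<partial>M) \<partial>M)"
      unfolding Fb_def using MM.Fubini_integral[OF iG] by simp
    also have "\<dots> = (\<integral>u. (\<integral>v. F ((w(i := u))(j := v)) \<partial>M) \<partial>M)"
      using ji by (simp add: fun_upd_twist)
    finally have e: "(\<integral>v. Fb (w(j := v)) \<partial>M) = (\<integral>u. (\<integral>v. F ((w(i := u))(j := v)) \<partial>M) \<partial>M)" .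
    have mH: "(\<lambda>u. \<integral>v. F ((w(i := u))(j := v)) \<partial>M) \<in> borel_measurable M"
    proof -
      have "(\<lambda>(u,v). F ((w(i := u))(j := v))) = (\<lambda>(u,v). F ((w(j := v))(i := u)))"
        using ji by (simp add: fun_upd_twist)
      moreover have "(\<lambda>(u,v). F ((w(j := v))(i := u))) \<in> borel_measurable (M \<Otimes>\<^sub>M M)"
        using measurable_compose[OF measurable_pair_swap' mG] by (simp add: split_beta)
      ultimately show ?thesis by (intro borel_measurable_lebesgue_integral) (simp add: split_beta)
    qed
    have s2: "(w(i := u))(j := v) \<in> space (P (insert i I))" if "u \<in> space M" "v \<in> space M" for u v
      using that w j by (auto simp: space_PiM PiE_iff extensional_def)
    have bH: "\<bar>\<integral>v. F ((w(i := u))(j := v)) \<partial>M\<bar> \<le> B" if "u \<in> space M" for u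
    proof (rule integral_abs_le)
      show "(\<lambda>v. F ((w(i := u))(j := v))) \<in> borel_measurable M"
        using measurable_compose[OF _ mG, of "\<lambda>v. (v,u)" M] that ji by (simp add: fun_upd_twist)
    qed (use s2 bF that in auto)
    have "Fb w - (\<integral>v. Fb (w(j := v)) \<partial>M)
        = (\<integral>u. F (w(i := u)) - (\<integral>v. F ((w(i := u))(j := v)) \<partial>M) \<partial>M)"
      unfolding e using intF1[OF w] integrable_bounded[OF mH bH] by (simp add: Fb_def[of w])
    also have "\<bar>\<dots>\<bar> \<le> h j (w j)"
    proof (rule integral_abs_le)
      show "(\<lambda>u. F (w(i := u)) - (\<integral>v. F ((w(i := u))(j := v)) \<partial>M)) \<in> borel_measurable M"
        using mF1[OF w] mH by measurable
      show "\<bar>F (w(i := u)) - (\<integral>v. F ((w(i := u))(j := v)) \<partial>M)\<bar> \<le> h j (w j)" if "u \<in> space M" for u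
        using dF[OF _ upd_s[OF w that], of j] ji j by (simp add: fun_upd_def)
    qed
    finally show "\<bar>Fb w - (\<integral>v. Fb (w(j := v)) \<partial>M)\<bar> \<le> h j (w j)" .
  qed (use insert.prems in auto)
  also have "exp (l * (\<integral>w. Fb w \<partial>P I) + card I * (l\<^sup>2 * V)) * exp (l\<^sup>2 * V)
     = exp (l * (\<integral>w. F w \<partial>P (insert i I)) + card (insert i I) * (l\<^sup>2 * V))"
    using insert by (simp add: eF exp_add[symmetric] algebra_simps)
  finally show ?case by (simp add: mult_right_mono)
qed

text \<open>Exponential Markov inequality with parameter 1: each factor has mean at most
  \<open>1 - p/2\<close>, so the moment is at most \<open>exp (- card G * p / 2)\<close>, and asking
  for a quarter of the expected count gives back half of this exponent. The events
  \<open>B j\<close> vary with \<open>j\<close> because they will be arcs around the coordinates of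
  a fixed point.\<close>

lemma chernoff_count:
  fixes p :: real
  assumes I: "finite I" "G \<subseteq> I" and B: "\<And>j. j \<in> G \<Longrightarrow> B j \<in> sets M \<and> p \<le> prob (B j)" and p: "0 \<le> p"
  shows "measure (P I) {w \<in> space (P I). card {j \<in> G. w j \<in> B j} \<le> real (card G) * p / 4} \<le> exp (- real (card G) * p / 4)"
proof -
  interpret PI: prob_space "P I" by (rule prob_space_P)
  have fG: "finite G" using I finite_subset by auto
  define f where "f j u = (if j \<in> G then exp (- indicator (B j) u) else (1::real))" for j u
  have mf: "f j \<in> borel_measurable M" for j
    unfolding f_def using B by (cases "j \<in> G") (auto intro!: measurable_compose[OF _ borel_measurable_exp] borel_measurable_indicator)
  have bf: "\<bar>f j u\<bar> \<le> 1" for j u unfolding f_def by auto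
  have intf: "integrable M (f j)" for j by (rule integrable_bounded[OF mf bf])
  have e2: "exp (-1) \<le> (1/2::real)"
    using exp_ge_add_one_self[of 1] by (simp add: exp_minus field_simps)
  have If: "(\<integral>u. f j u \<partial>M) \<le> exp (- p / 2)" if "j \<in> G" for j
  proof -
    have "(\<integral>u. f j u \<partial>M) \<le> (\<integral>u. 1 - indicator (B j) u / 2 \<partial>M)"
    proof (rule integral_mono[OF intf])
      show "integrable M (\<lambda>u. 1 - indicator (B j) u / 2 :: real)"
        using B[OF that] by (auto intro!: Bochner_Integration.integrable_diff simp: emeasure_eq_measure)
    qed (use that e2 in \<open>auto simp: f_def indicator_def\<close>)
    also have "\<dots> = 1 - prob (B j) / 2"
      using B[OF that] by (simp add: prob_space emeasure_eq_measure)
    also have "\<dots> \<le> 1 - p / 2" using B[OF that] by simp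
    also have "\<dots> \<le> exp (- p / 2)" using exp_ge_add_one_self[of "-p/2"] by simp
    finally show ?thesis .
  qed
  define c where "c w = card {j \<in> G. w j \<in> B j}" for w
  have cs: "real (c w) = (\<Sum>j\<in>G. indicator (B j) (w j))" for w
    unfolding c_def using fG by (simp add: indicator_def sum.If_cases Int_def)
  have prodc: "(\<Prod>j\<in>I. f j (w j)) = exp (- real (c w))" for w
  proof -
    have "(\<Prod>j\<in>I. f j (w j)) = (\<Prod>j\<in>G. f j (w j))"
      using I by (intro prod.mono_neutral_right) (auto simp: f_def)
    also have "\<dots> = (\<Prod>j\<in>G. exp (- indicator (B j) (w j)))"
      by (rule prod.cong) (auto simp: f_def)
    also have "\<dots> = exp (- real (c w))" using fG by (simp add: cs exp_sum[symmetric] sum_negf)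
    finally show ?thesis .
  qed
  have Bc[measurable]: "(\<lambda>w. indicator (B j) (w j) :: real) \<in> borel_measurable (P I)" if "j \<in> G" for j
  proof -
    have "B j \<in> sets M" "j \<in> I" using B[OF that] that I by auto
    then show ?thesis by measurable
  qed
  have mc: "(\<lambda>w. real (c w)) \<in> borel_measurable (P I)"
    unfolding cs by (rule borel_measurable_sum) (rule Bc)
  have "{w \<in> space (P I). c w \<le> real (card G) * p / 4} = {w \<in> space (P I). exp (- real (card G) * p / 4) \<le> exp (- real (c w))}"
    by auto
  then have "measure (P I) {w \<in> space (P I). c w \<le> real (card G) * p / 4}
     = measure (P I) {w \<in> space (P I). exp (- real (card G) * p / 4) \<le> exp (- real (c w))}" by simp
  also have "\<dots> \<le> (\<integral>w. exp (- real (c w)) \<partial>P I) / exp (- real (card G) * p / 4)"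
    using mc by (intro integral_Markov_inequality_measure[where A="{}"] PI.integrable_bounded[where B=1]) auto
  also have "(\<integral>w. exp (- real (c w)) \<partial>P I) = (\<Prod>j\<in>I. \<integral>u. f j u \<partial>M)"
    unfolding prodc[symmetric] by (rule prod.product_integral_prod) (use I intf in auto)
  also have "\<dots> = (\<Prod>j\<in>G. \<integral>u. f j u \<partial>M)"
    using I by (intro prod.mono_neutral_right) (auto simp: f_def prob_space)
  also have "\<dots> \<le> (\<Prod>j\<in>G. exp (- p / 2))"
    by (intro prod_mono) (use If in \<open>auto simp: f_def intro!: integral_nonneg_AE\<close>)
  also have "\<dots> = exp (- real (card G) * p / 2)"
    by (simp add: exp_of_nat_mult[symmetric])
  finally have "measure (P I) {w \<in> space (P I). c w \<le> real (card G) * p / 4} \<le> exp (- real (card G) * p / 2) / exp (- real (card G) * p / 4)"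
    by (simp add: divide_right_mono)
  also have "\<dots> = exp (- real (card G) * p / 4)" by (simp add: exp_diff[symmetric])
  finally show ?thesis unfolding c_def .
qed

end

section \<open>The circle\<close>

text \<open>The distance from \<open>t\<close> to the nearest even integer, that is, the quotient
  norm on R/2Z. \<open>nrm_witness\<close> and \<open>nrm_le_abs\<close> state this
  characterisation, from which symmetry and the triangle inequality follow without
  \<open>frac\<close>.\<close>

definition nrm :: "real \<Rightarrow> real" where
  "nrm t = min (2 * frac (t / 2)) (2 - 2 * frac (t / 2))"

lemma circ_dist_nrm: "circ_dist a b = nrm (a - b)"
  by (simp add: circ_dist_def nrm_def Let_def)

lemma nrm_nonneg [simp]: "0 \<le> nrm t" and nrm_le_1 [simp]: "nrm t \<le> 1"
  using frac_lt_1[of "t/2"] frac_ge_0[of "t/2"] unfolding nrm_def by linarith+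

lemma nrm_witness: "\<exists>k::int. nrm t = \<bar>t - 2 * of_int k\<bar>"
proof (cases "frac (t/2) \<le> 1/2")
  case True
  then show ?thesis
    by (intro exI[of _ "\<lfloor>t/2\<rfloor>"]) (use frac_ge_0[of "t/2"] in \<open>auto simp: nrm_def frac_def\<close>)
next
  case False
  then show ?thesis
    by (intro exI[of _ "\<lfloor>t/2\<rfloor> + 1"]) (use frac_lt_1[of "t/2"] in \<open>auto simp: nrm_def frac_def\<close>)
qed

lemma nrm_le_abs: "nrm t \<le> \<bar>t - 2 * of_int k\<bar>"
proof -
  define m where "m = \<lfloor>t/2\<rfloor>"
  define f where "f = frac (t/2)"
  have t: "t = 2 * of_int m + 2 * f" unfolding m_def f_def frac_def by simp
  have f: "0 \<le> f" "f < 1" unfolding f_def using frac_lt_1 by auto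
  have n: "nrm t \<le> 2 * f" "nrm t \<le> 2 - 2 * f" unfolding nrm_def f_def by auto
  consider "k \<le> m" | "k \<ge> m + 1" by linarith
  then show ?thesis
  proof cases
    case 1
    then have "real_of_int k \<le> of_int m" by simp
    then show ?thesis using n t f by linarith
  next
    case 2
    then have "real_of_int k \<ge> of_int m + 1" by linarith
    then show ?thesis using n t f by linarith
  qed
qed

lemma nrm_triangle: "nrm (s + t) \<le> nrm s + nrm t"
proof -
  obtain k l :: int where k: "nrm s = \<bar>s - 2 * of_int k\<bar>" and l: "nrm t = \<bar>t - 2 * of_int l\<bar>"
    using nrm_witness by metis
  have "nrm (s + t) \<le> \<bar>s + t - 2 * of_int (k + l)\<bar>" by (rule nrm_le_abs)
  then show ?thesis using k l by simp
qed

lemma nrm_add_period: "nrm (t + 2 * of_int k) = nrm t"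
proof -
  have "frac ((t + 2 * of_int k) / 2) = frac (t/2)" by (simp add: add_divide_distrib)
  then show ?thesis by (simp add: nrm_def)
qed

lemma nrm_minus [simp]: "nrm (- t) = nrm t"
proof -
  have le: "nrm (- t) \<le> nrm t" for t
  proof -
    obtain k :: int where k: "nrm t = \<bar>t - 2 * of_int k\<bar>" using nrm_witness by metis
    show ?thesis using nrm_le_abs[of "-t" "-k"] k by simp
  qed
  show ?thesis using le[of t] le[of "-t"] by simp
qed

lemma nrm_minus_commute: "nrm (a - b) = nrm (b - a)"
  using nrm_minus[of "a - b"] by simp

text \<open>\<open>t - 1\<close> is the antipode of \<open>t\<close>. One inequality is a choice of
  even integer, the other the triangle inequality from 0 to its antipode, with
  \<open>nrm 1 = 1\<close>.\<close>

lemma nrm_diff_1: "nrm (t - 1) = 1 - nrm t"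
proof (rule antisym)
  obtain k :: int where k: "nrm t = \<bar>t - 2 * of_int k\<bar>" using nrm_witness by metis
  have "nrm (t - 1) \<le> \<bar>t - 1 - 2 * of_int k\<bar>" "nrm (t - 1) \<le> \<bar>t - 1 - 2 * of_int (k - 1)\<bar>"
    by (rule nrm_le_abs)+
  then show "nrm (t - 1) \<le> 1 - nrm t" using k nrm_le_1[of t] by auto
  have "1 = nrm 1" by (simp add: nrm_def frac_def)
  also have "\<dots> \<le> nrm t + nrm (- (t - 1))" using nrm_triangle[of t "- (t - 1)"] by simp
  finally show "1 - nrm t \<le> nrm (t - 1)" by (simp only: nrm_minus)
qed

text \<open>Doubling turns a deviation of at most 1/8 from distance 1/2 into a deviation of at most
  1/4 from the antipode 1 of 0.\<close>

lemma nrm_double_diff_1: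
  assumes "3/8 \<le> nrm t" "nrm t \<le> 5/8"
  shows "nrm (2 * t - 1) \<le> 1/4"
proof -
  obtain k :: int where k: "nrm t = \<bar>t - 2 * of_int k\<bar>" using nrm_witness by metis
  have "nrm (2 * t - 1) \<le> \<bar>2 * t - 1 - 2 * of_int (2 * k)\<bar>"
     "nrm (2 * t - 1) \<le> \<bar>2 * t - 1 - 2 * of_int (2 * k - 1)\<bar>"
    by (rule nrm_le_abs)+
  then show ?thesis using k assms by (cases "t - 2 * of_int k \<ge> 0") (simp_all add: abs_if split: if_splits)
qed

lemma borel_measurable_frac [measurable]: "(frac :: real \<Rightarrow> real) \<in> borel_measurable borel"
  unfolding frac_def[abs_def] using borel_measurable_real_floor by measurable

lemma nrm_measurable [measurable]: "nrm \<in> borel_measurable borel"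
  unfolding nrm_def[abs_def] by measurable

definition circle_unif :: "real measure" ("\<mu>") where
  "\<mu> = uniform_measure lborel {0..<2::real}"

lemma space_circle [simp]: "space \<mu> = UNIV" and sets_circle [simp, measurable_cong]: "sets \<mu> = sets borel"
  by (simp_all add: circle_unif_def)

lemma prob_space_circle: "prob_space \<mu>"
  unfolding circle_unif_def by (rule prob_space_uniform_measure) auto

interpretation circ: iid_product \<mu>
  by (simp add: iid_product_def prob_space_circle)

lemma emeasure_circle: "A \<in> sets borel \<Longrightarrow> emeasure \<mu> A = emeasure lborel ({0..<2} \<inter> A) / 2"
  by (simp add: circle_unif_def)

text \<open>The reflection \<open>w\<close> to \<open>s - w\<close> of the circle, which for
  \<open>s = 2 * y\<close> fixes \<open>y\<close>. The representative is taken in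
  \<open>{0..<2}\<close>, where \<open>\<mu>\<close> lives, so that \<open>\<mu>\<close> is
  preserved as a measure on the line.\<close>

definition refl_circ :: "real \<Rightarrow> real \<Rightarrow> real" where
  "refl_circ s w = 2 * frac ((s - w) / 2)"

lemma refl_circ_measurable [measurable]: "refl_circ s \<in> borel_measurable borel"
  unfolding refl_circ_def[abs_def] by measurable

lemma refl_circ_eq: "\<exists>k::int. refl_circ s w = s - w + 2 * of_int k"
  by (rule exI[of _ "- \<lfloor>(s - w) / 2\<rfloor>"]) (simp add: refl_circ_def frac_def)

lemma nrm_refl_circ: "nrm (a - refl_circ s w) = nrm (s - a - w)"
proof -
  obtain k :: int where k: "refl_circ s w = s - w + 2 * of_int k" using refl_circ_eq by metis
  have "nrm (a - refl_circ s w) = nrm (refl_circ s w - a)" by (rule nrm_minus_commute)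
  also have "refl_circ s w - a = (s - a - w) + 2 * of_int k" using k by simp
  finally show ?thesis by (simp only: nrm_add_period)
qed

lemma nrm_refl_circ_0: "nrm (refl_circ s w) = nrm (s - w)"
  using nrm_refl_circ[of 0 s w] by (simp add: nrm_minus_commute)

lemma emeasure_lborel_reflect:
  assumes "B \<in> sets borel"
  shows "emeasure lborel ((\<lambda>w. c - w) -` B) = emeasure lborel (B :: real set)"
proof -
  have e: "(lborel :: real measure) = density (distr lborel borel (\<lambda>x. c + (- 1) * x)) (\<lambda>_. ennreal \<bar>- 1\<bar>)"
    by (rule lborel_real_affine) simp
  have "emeasure lborel B = emeasure (density (distr lborel borel (\<lambda>x. c + (- 1) * x)) (\<lambda>_. ennreal \<bar>- 1\<bar>)) B"
    using e by simp
  also have "\<dots> = emeasure lborel ((\<lambda>w. c - w) -` B)"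
    using assms by (simp add: emeasure_density emeasure_distr)
  finally show ?thesis by simp
qed

text \<open>After reducing \<open>s\<close> modulo 2 to \<open>r\<close>, the map reverses each of
  the intervals \<open>{0..r}\<close> and \<open>{r<..<2}\<close> by an ordinary reflection of the
  line, and these preserve Lebesgue measure.\<close>

lemma distr_refl_circ: "distr \<mu> \<mu> (refl_circ s) = \<mu>"
proof (rule measure_eqI)
  fix A assume "A \<in> sets (distr \<mu> \<mu> (refl_circ s))"
  then have A: "A \<in> sets borel" by simp
  define k where "k = \<lfloor>s/2\<rfloor>"
  define r where "r = s - 2 * of_int k"
  have r: "0 \<le> r" "r < 2" unfolding r_def k_def by linarith+
  have rs: "refl_circ s w = refl_circ r w" for w
  proof -
    have "(s - w) / 2 = (r - w) / 2 + of_int k" unfolding r_def by (simp add: field_simps)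
    then have "frac ((s - w) / 2) = frac ((r - w) / 2)" by (metis frac_add_of_int_right)
    then show ?thesis unfolding refl_circ_def by simp
  qed
  have r1: "refl_circ r w = r - w" if "0 \<le> w" "w \<le> r" for w
    unfolding refl_circ_def using that r by (subst frac_eq_id) auto
  have r2: "refl_circ r w = r + 2 - w" if "r < w" "w < 2" for w
  proof -
    have "frac ((r - w) / 2) = frac ((r - w) / 2 + 1)" by (simp add: frac_1_eq)
    also have "\<dots> = (r - w) / 2 + 1" using that r by (subst frac_eq_id) (auto simp: field_simps)
    finally show ?thesis by (simp add: refl_circ_def)
  qed
  have "{0..<2} \<inter> refl_circ s -` A = ((\<lambda>w. r - w) -` (A \<inter> {0..r})) \<union> ((\<lambda>w. (r + 2) - w) -` (A \<inter> {r<..<2}))"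
    unfolding rs
  proof (rule set_eqI)
    fix w
    show "w \<in> {0..<2} \<inter> refl_circ r -` A \<longleftrightarrow> w \<in> ((\<lambda>w. r - w) -` (A \<inter> {0..r})) \<union> ((\<lambda>w. (r + 2) - w) -` (A \<inter> {r<..<2}))"
      by (cases "w \<le> r") (use r r1[of w] r2[of w] in auto)
  qed
  then have "emeasure lborel ({0..<2} \<inter> refl_circ s -` A)
     = emeasure lborel ((\<lambda>w. r - w) -` (A \<inter> {0..r})) + emeasure lborel ((\<lambda>w. (r + 2) - w) -` (A \<inter> {r<..<2}))"
    using A r
    by (subst plus_emeasure) (auto intro!: measurable_sets_borel[of _ borel])
  also have "\<dots> = emeasure lborel (A \<inter> {0..r}) + emeasure lborel (A \<inter> {r<..<2})"
    by (intro arg_cong2[where f="(+)"] emeasure_lborel_reflect) (use A in auto)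
  also have "\<dots> = emeasure lborel ((A \<inter> {0..r}) \<union> (A \<inter> {r<..<2}))"
    using A by (intro plus_emeasure) auto
  also have "(A \<inter> {0..r}) \<union> (A \<inter> {r<..<2}) = {0..<2} \<inter> A" using r by auto
  finally have "emeasure lborel ({0..<2} \<inter> refl_circ s -` A) = emeasure lborel ({0..<2} \<inter> A)" .
  moreover have "refl_circ s -` A \<in> sets borel"
    using A by (rule measurable_sets_borel[OF refl_circ_measurable])
  ultimately show "emeasure (distr \<mu> \<mu> (refl_circ s)) A = emeasure \<mu> A"
    using A by (simp add: emeasure_distr emeasure_circle)
qed simp

lemma circle_nrm_invariant:
  assumes "S \<in> sets borel"
  shows "measure \<mu> {w. nrm (a - w) \<in> S} = measure \<mu> {w. nrm w \<in> S}"
proof -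
  have m: "{w. nrm w \<in> S} \<in> sets borel"
    using measurable_sets_borel[OF nrm_measurable assms] by (simp add: vimage_def)
  have "measure \<mu> {w. nrm w \<in> S} = measure (distr \<mu> \<mu> (refl_circ a)) {w. nrm w \<in> S}"
    by (simp add: distr_refl_circ)
  also have "\<dots> = measure \<mu> (refl_circ a -` {w. nrm w \<in> S} \<inter> space \<mu>)"
    using m by (intro measure_distr) auto
  also have "refl_circ a -` {w. nrm w \<in> S} \<inter> space \<mu> = {w. nrm (a - w) \<in> S}"
    by (auto simp: nrm_refl_circ_0)
  finally show ?thesis by simp
qed

lemma circle_nrm_greater:
  assumes "0 \<le> t" "t \<le> 1"
  shows "measure \<mu> {w. t < nrm (a - w)} = 1 - t"
proof -
  have "measure \<mu> {w. t < nrm (a - w)} = measure \<mu> {w. t < nrm w}"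
    using circle_nrm_invariant[of "{t<..}" a] by simp
  moreover have "{0..<2} \<inter> {w. t < nrm w} = {t<..<2 - t}"
  proof (rule set_eqI)
    fix w
    have "nrm w = min w (2 - w)" if "0 \<le> w" "w < 2"
      using that unfolding nrm_def by (subst (1 2) frac_eq_id) auto
    then show "w \<in> {0..<2} \<inter> {w. t < nrm w} \<longleftrightarrow> w \<in> {t<..<2 - t}" using assms by auto
  qed
  moreover have "{w. t < nrm w} \<in> sets borel" by measurable
  moreover have "ennreal (2 - 2 * t) / 2 = ennreal (1 - t)"
    using assms divide_ennreal[of "2 - 2 * t" 2] by (simp add: diff_divide_distrib)
  ultimately show ?thesis using assms by (simp add: measure_def emeasure_circle)
qed

lemma circle_nrm_interval:
  assumes "0 \<le> s" "s \<le> t" "t \<le> 1"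
  shows "measure \<mu> {w. s < nrm (a - w) \<and> nrm (a - w) \<le> t} = t - s"
proof -
  have "{w. s < nrm (a - w) \<and> nrm (a - w) \<le> t} = {w. s < nrm (a - w)} - {w. t < nrm (a - w)}" by auto
  also have "measure \<mu> \<dots> = measure \<mu> {w. s < nrm (a - w)} - measure \<mu> {w. t < nrm (a - w)}"
    using assms by (intro circ.finite_measure_Diff) auto
  finally show ?thesis using assms by (simp add: circle_nrm_greater)
qed

section \<open>The Littlewood--Offord inequality\<close>

text \<open>Induction: average the inequality for the members avoiding \<open>x\<close> over all \<open>x \<in> X\<close>.\<close>

lemma LYM_inequality:
  assumes "finite X" "A \<subseteq> Pow X" "\<And>S S'. S \<in> A \<Longrightarrow> S' \<in> A \<Longrightarrow> S \<subseteq> S' \<Longrightarrow> S = S'"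
  shows "(\<Sum>S\<in>A. 1 / real (card X choose card S)) \<le> 1"
  using assms
proof (induction "card X" arbitrary: X A)
  case 0
  have X: "X = {}" using 0(1,2) by simp
  then have "A = {} \<or> A = {{}}" using 0(3) by auto
  then show ?case using X by auto
next
  case (Suc m X A)
  show ?case
  proof (cases "X \<in> A")
    \<comment> \<open>The averaging requires every member to miss some point of \<open>X\<close>; if
      \<open>X\<close> itself is a member, it is the only one.\<close>
    case True
    have "S = X" if "S \<in> A" for S
      by (rule Suc.prems(3)[OF that True]) (use that Suc.prems(2) in auto)
    with True have "A = {X}" by blast
    then show ?thesis by simp
  next
    case False
    have fA: "finite A" using Suc.prems(1,2) finite_subset by auto
    have le: "(\<Sum>S | S \<in> A \<and> x \<notin> S. 1 / real (m choose card S)) \<le> 1" if x: "x \<in> X" for x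
    proof -
      have c: "m = card (X - {x})" using Suc.hyps(2) x Suc.prems(1) by simp
      have "(\<Sum>S | S \<in> A \<and> x \<notin> S. 1 / real (card (X - {x}) choose card S)) \<le> 1"
      proof (rule Suc.hyps(1)[OF c])
        show "S = S'" if "S \<in> {S \<in> A. x \<notin> S}" "S' \<in> {S \<in> A. x \<notin> S}" "S \<subseteq> S'" for S S'
          by (rule Suc.prems(3)) (use that in auto)
      qed (use Suc.prems(1,2) in auto)
      then show ?thesis using c by simp
    qed
    have inner: "(\<Sum>x | x \<in> X \<and> x \<notin> S. 1 / real (m choose card S)) = Suc m * (1 / real (Suc m choose card S))"
      if S: "S \<in> A" for S
    proof -
      have sub: "S \<subseteq> X" "S \<noteq> X" using S Suc.prems(2) False by auto
      then have lt: "card S < Suc m" using Suc.hyps(2) Suc.prems(1) psubset_card_mono[of X S] by auto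
      have "card {x \<in> X. x \<notin> S} = Suc m - card S"
        using card_Diff_subset[of S X] sub Suc.hyps(2) finite_subset[OF sub(1) Suc.prems(1)]
        by (simp add: set_diff_eq)
      moreover have "(Suc m - card S) * (Suc m choose card S) = Suc m * (m choose card S)"
        using binomial_absorb_comp[of "Suc m" "card S"] by simp
      then have "real (Suc m - card S) * real (Suc m choose card S) = real (Suc m) * real (m choose card S)"
        by (metis of_nat_mult)
      moreover have "real (m choose card S) > 0" "real (Suc m choose card S) > 0"
        using lt by (auto simp: zero_less_binomial_iff)
      ultimately show ?thesis by (simp add: field_simps)
    qed
    have "Suc m * (\<Sum>S\<in>A. 1 / real (Suc m choose card S))
       = (\<Sum>S\<in>A. \<Sum>x | x \<in> X \<and> x \<notin> S. 1 / real (m choose card S))"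
      unfolding sum_distrib_left by (rule sum.cong) (auto simp only: inner)
    also have "\<dots> = (\<Sum>x\<in>X. \<Sum>S | S \<in> A \<and> x \<notin> S. 1 / real (m choose card S))"
      by (rule sum.swap_restrict) (use fA Suc.prems(1) in auto)
    also have "\<dots> \<le> (\<Sum>x\<in>X. 1)" by (rule sum_mono) (rule le)
    also have "\<dots> = Suc m" using Suc.hyps(2) by simp
    finally show ?thesis using Suc.hyps(2) by (simp add: mult_le_cancel_left1 del: of_nat_Suc)
  qed
qed

lemma sperner:
  assumes "finite X" "A \<subseteq> Pow X" "\<And>S S'. S \<in> A \<Longrightarrow> S' \<in> A \<Longrightarrow> S \<subseteq> S' \<Longrightarrow> S = S'"
  shows "card A \<le> card X choose (card X div 2)"
proof -
  let ?b = "real (card X choose (card X div 2))"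
  have b: "?b > 0" by (simp add: zero_less_binomial_iff)
  have "(\<Sum>S\<in>A. 1 / ?b) \<le> (\<Sum>S\<in>A. 1 / real (card X choose card S))"
  proof (rule sum_mono)
    fix S assume "S \<in> A"
    then have "card S \<le> card X" using assms(1,2) by (auto intro: card_mono)
    then have "0 < card X choose card S" by (simp add: zero_less_binomial_iff)
    then show "1 / ?b \<le> 1 / real (card X choose card S)"
      using b binomial_maximum[of "card X" "card S"] by (intro divide_left_mono mult_pos_pos) auto
  qed
  also have "\<dots> \<le> 1" by (rule LYM_inequality[OF assms])
  finally have "real (card A) \<le> ?b" using b by (simp add: field_simps)
  then show ?thesis by simp
qed

text \<open>In squared form, with the factor \<open>m + 1\<close> on the left, the bound for even
  \<open>m\<close> is an induction on ratios. For \<open>m = 2 * n + 1\<close> it follows from the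
  even case \<open>2 * n + 2\<close>, whose central coefficient is exactly twice as large.\<close>

lemma central_binomial_upper_bound:
  "real (m choose (m div 2)) \<le> 2 ^ m / sqrt (1 + real m)"
proof -
  have alg0: "X = Y / b * c" if "b * X = Y * c" "b \<noteq> 0" for X Y b c :: real
    using that by (simp add: field_simps)
  have ev: "(real ((2*n) choose n))\<^sup>2 * (2 * real n + 1) \<le> (4 ^ n)\<^sup>2" for n
  proof (induction n)
    case (Suc n)
    have "(Suc n) * ((2 * Suc n) choose Suc n) = 2 * (2 * n + 1) * ((2*n) choose n)"
    proof -
      have a: "Suc n * ((2 * Suc n) choose Suc n) = (2 * Suc n) * ((2 * n + 1) choose n)"
        using Suc_times_binomial_eq[of "2 * n + 1" n] by simp
      have b: "(2 * n + 1) choose n = (2 * n + 1) choose (Suc n)"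
        using binomial_symmetric[of n "2*n+1"] by simp
      have c: "Suc n * ((2 * n + 1) choose (Suc n)) = (2 * n + 1) * ((2*n) choose n)"
        using Suc_times_binomial_eq[of "2 * n" n] by simp
      have "Suc n * ((2 * Suc n) choose Suc n) = 2 * (Suc n * ((2 * n + 1) choose (Suc n)))"
        using a b by simp
      then show ?thesis using c by simp
    qed
    then have "real (Suc n * ((2 * Suc n) choose Suc n)) = real (2 * (2 * n + 1) * ((2*n) choose n))"
      by (rule arg_cong)
    then have "(real n + 1) * real ((2 * Suc n) choose Suc n) = 2 * (2 * real n + 1) * real ((2*n) choose n)"
      by (simp only: of_nat_mult of_nat_add of_nat_numeral of_nat_Suc of_nat_1 add.commute[of 1])
    then have e: "real ((2 * Suc n) choose Suc n) = 2 * (2 * real n + 1) / (real n + 1) * real ((2*n) choose n)"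
      by (intro alg0) auto
    let ?c = "real ((2*n) choose n)"
    have alg: "(2 * a / b * c)\<^sup>2 * e = (c\<^sup>2 * a) * (4 * (a * e) / b\<^sup>2)" for a b c e :: real
      by (simp add: power_mult_distrib power_divide power2_eq_square)
    have "(real ((2 * Suc n) choose Suc n))\<^sup>2 * (2 * real (Suc n) + 1)
        = (2 * (2 * real n + 1) / (real n + 1) * ?c)\<^sup>2 * (2 * real n + 3)"
      unfolding e by simp
    also have "\<dots> = (?c\<^sup>2 * (2 * real n + 1)) * (4 * ((2 * real n + 1) * (2 * real n + 3)) / (real n + 1)\<^sup>2)"
      by (rule alg)
    also have "\<dots> \<le> (4 ^ n)\<^sup>2 * 16"
    proof (rule mult_mono[OF Suc.IH])
      \<comment> \<open>The left side equals \<open>4 * (n + 1)^2 - 1\<close>, so the ratio of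
        consecutive terms stays below 16.\<close>
      have "(2 * real n + 1) * (2 * real n + 3) \<le> 4 * (real n + 1)\<^sup>2"
        by (simp add: power2_eq_square algebra_simps)
      then show "4 * ((2 * real n + 1) * (2 * real n + 3)) / (real n + 1)\<^sup>2 \<le> 16"
        by (simp add: divide_le_eq)
    qed auto
    also have "\<dots> = (4 ^ Suc n)\<^sup>2" by (simp add: power_mult_distrib)
    finally show ?case .
  qed simp
  have sq: "(real (m choose (m div 2)))\<^sup>2 * (1 + real m) \<le> (2 ^ m)\<^sup>2"
  proof (cases "even m")
    case True
    then obtain n where n: "m = 2 * n" by blast
    have "(4::real) ^ n = 2 ^ m" using n by (simp add: power_mult)
    then show ?thesis using ev[of n] n by (simp add: add.commute)
  next
    case False
    then obtain n where n: "m = 2 * n + 1" using oddE by blast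
    have b: "(2 * n + 1) choose n = (2 * n + 1) choose (Suc n)"
        using binomial_symmetric[of n "2*n+1"] by simp
    have "(2 * Suc n) choose Suc n = 2 * ((2 * n + 1) choose n)"
      using b by simp
    then have "4 * ((real ((2 * n + 1) choose n))\<^sup>2 * (2 * real n + 3)) \<le> (4 ^ Suc n)\<^sup>2"
      using ev[of "Suc n"] by (simp add: power_mult_distrib algebra_simps)
    also have "(4 ^ Suc n)\<^sup>2 = 4 * ((2::real) ^ (2 * n + 1))\<^sup>2"
      by (simp add: power_mult_distrib power_mult)
    finally have "(real ((2 * n + 1) choose n))\<^sup>2 * (2 * real n + 3) \<le> (2 ^ (2 * n + 1))\<^sup>2" by linarith
    moreover have "(real ((2 * n + 1) choose n))\<^sup>2 * (2 * real n + 2) \<le> (real ((2 * n + 1) choose n))\<^sup>2 * (2 * real n + 3)"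
      by (intro mult_left_mono) auto
    ultimately have "(real ((2 * n + 1) choose n))\<^sup>2 * (2 * real n + 2) \<le> (2 ^ (2 * n + 1))\<^sup>2"
      by linarith
    moreover have "m div 2 = n" "1 + real m = 2 * real n + 2" using n by auto
    ultimately show ?thesis using n by (simp only:)
  qed
  have "real (m choose (m div 2)) * sqrt (1 + real m) \<le> 2 ^ m"
    by (rule power2_le_imp_le) (use sq in \<open>auto simp: power_mult_distrib\<close>)
  then show ?thesis by (simp add: field_simps)
qed

text \<open>The argument of Erdos: a proper enlargement of a set raises the sum by at least 1/4, so
  the sets with sum in a half-open window of length 1/4 form an antichain and Sperner's bound
  applies. A unit window is a union of four such windows.\<close>

lemma littlewood_offord_pos:
  fixes a :: "'b \<Rightarrow> real"
  assumes "finite X" "\<And>j. j \<in> X \<Longrightarrow> 1/4 \<le> a j"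
  shows "card {e \<in> Pow X. c + (\<Sum>j\<in>e. a j) \<in> {T - 1<..T}} \<le> 4 * (card X choose (card X div 2))"
proof -
  define g where "g e = c + (\<Sum>j\<in>e. a j)" for e
  define E where "E t = {e \<in> Pow X. t - 1/4 < g e \<and> g e \<le> t}" for t
  have fin: "finite (E t)" for t using assms(1) by (simp add: E_def)
  have b: "card (E t) \<le> card X choose (card X div 2)" for t
  proof (rule sperner[OF assms(1)])
    fix S S' assume S: "S \<in> E t" and S': "S' \<in> E t" and sub: "S \<subseteq> S'"
    show "S = S'"
    proof (rule ccontr)
      assume "S \<noteq> S'"
      then obtain x where x: "x \<in> S'" "x \<notin> S" using sub by blast
      have sX: "S' \<subseteq> X" using S' by (simp add: E_def)
      have fS': "finite S'" by (rule finite_subset[OF sX assms(1)])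
      have "1/4 \<le> a x" using assms(2)[of x] x sX by auto
      also have "a x \<le> (\<Sum>j\<in>S' - S. a j)"
      proof (rule member_le_sum)
        show "0 \<le> a j" if "j \<in> S' - S - {x}" for j using assms(2)[of j] that sX by auto
      qed (use x fS' in auto)
      also have "\<dots> = (\<Sum>j\<in>S'. a j) - (\<Sum>j\<in>S. a j)"
        using sub fS' by (intro sum_diff) auto
      finally have "1/4 \<le> g S' - g S" by (simp add: g_def)
      moreover have "t - 1/4 < g S" "g S' \<le> t" using S S' by (auto simp: E_def)
      ultimately show False by linarith
    qed
  qed (auto simp: E_def)
  have "{e \<in> Pow X. g e \<in> {T - 1<..T}} \<subseteq> E T \<union> E (T - 1/4) \<union> E (T - 1/2) \<union> E (T - 3/4)"
  proof
    fix e assume "e \<in> {e \<in> Pow X. g e \<in> {T - 1<..T}}"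
    then have e: "e \<in> Pow X" "T - 1 < g e" "g e \<le> T" by auto
    then consider "T - 1/4 < g e" | "T - 1/4 - 1/4 < g e" "g e \<le> T - 1/4"
      | "T - 1/2 - 1/4 < g e" "g e \<le> T - 1/2" | "T - 3/4 - 1/4 < g e" "g e \<le> T - 3/4" by linarith
    then show "e \<in> E T \<union> E (T - 1/4) \<union> E (T - 1/2) \<union> E (T - 3/4)"
      unfolding E_def Un_iff mem_Collect_eq using e by cases blast+
  qed
  then have "card {e \<in> Pow X. g e \<in> {T - 1<..T}} \<le> card (E T \<union> E (T - 1/4) \<union> E (T - 1/2) \<union> E (T - 3/4))"
    by (rule card_mono[rotated]) (intro finite_UnI fin)
  also have "\<dots> \<le> 4 * (card X choose (card X div 2))"
    using card_Un_le[of "E T \<union> E (T - 1/4) \<union> E (T - 1/2)" "E (T - 3/4)"]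
      card_Un_le[of "E T \<union> E (T - 1/4)" "E (T - 1/2)"] card_Un_le[of "E T" "E (T - 1/4)"]
      b[of T] b[of "T - 1/4"] b[of "T - 1/2"] b[of "T - 3/4"] by linarith
  finally show ?thesis unfolding g_def .
qed

text \<open>Symmetric difference with the set \<open>N\<close> of negative coefficients is an
  involution of the power set; it replaces every \<open>a j\<close> by its absolute value and shifts
  the sum by a constant.\<close>

lemma littlewood_offord_signed:
  fixes a :: "'b \<Rightarrow> real"
  assumes X: "finite X" and a: "\<And>j. j \<in> X \<Longrightarrow> 1/4 \<le> \<bar>a j\<bar>"
  shows "card {e \<in> Pow X. c + (\<Sum>j\<in>e. a j) \<in> {T - 1<..T}} \<le> 4 * (card X choose (card X div 2))"
proof -
  define N where "N = {j \<in> X. a j < 0}"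
  define s where "s e = (e - N) \<union> (N - e)" for e
  have sum_eq: "(\<Sum>j\<in>e. a j) = (\<Sum>j\<in>N. a j) + (\<Sum>j\<in>s e. \<bar>a j\<bar>)" if e: "e \<in> Pow X" for e
  proof -
    have ind: "(\<Sum>j\<in>B. f j) = (\<Sum>j\<in>X. if j \<in> B then f j else 0)" if "B \<subseteq> X" for B and f :: "'b \<Rightarrow> real"
      using that X by (simp add: sum.If_cases Int_absorb1)
    have "N \<subseteq> X" "s e \<subseteq> X" "e \<subseteq> X" using e by (auto simp: N_def s_def)
    then show ?thesis
      unfolding ind[OF \<open>N \<subseteq> X\<close>] ind[OF \<open>s e \<subseteq> X\<close>] ind[OF \<open>e \<subseteq> X\<close>] sum.distrib[symmetric]
      by (intro sum.cong) (auto simp: N_def s_def)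
  qed
  have inj: "inj_on s (Pow X)" by (rule inj_on_inverseI[where g=s]) (auto simp: s_def)
  have "card {e \<in> Pow X. c + (\<Sum>j\<in>e. a j) \<in> {T - 1<..T}}
      = card (s ` {e \<in> Pow X. c + (\<Sum>j\<in>e. a j) \<in> {T - 1<..T}})"
    by (rule card_image[symmetric], rule inj_on_subset[OF inj]) auto
  also have "\<dots> \<le> card {e \<in> Pow X. (c + (\<Sum>j\<in>N. a j)) + (\<Sum>j\<in>e. \<bar>a j\<bar>) \<in> {T - 1<..T}}"
  proof (rule card_mono)
    show "s ` {e \<in> Pow X. c + (\<Sum>j\<in>e. a j) \<in> {T - 1<..T}}
        \<subseteq> {e \<in> Pow X. (c + (\<Sum>j\<in>N. a j)) + (\<Sum>j\<in>e. \<bar>a j\<bar>) \<in> {T - 1<..T}}"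
    proof (intro image_subsetI)
      fix e assume e: "e \<in> {e \<in> Pow X. c + (\<Sum>j\<in>e. a j) \<in> {T - 1<..T}}"
      then have "s e \<in> Pow X" by (auto simp: s_def N_def)
      moreover have "(c + (\<Sum>j\<in>N. a j)) + (\<Sum>j\<in>s e. \<bar>a j\<bar>) = c + (\<Sum>j\<in>e. a j)"
        using sum_eq[of e] e by simp
      ultimately show "s e \<in> {e \<in> Pow X. (c + (\<Sum>j\<in>N. a j)) + (\<Sum>j\<in>e. \<bar>a j\<bar>) \<in> {T - 1<..T}}"
        using e by simp
    qed
  qed (use X in auto)
  also have "\<dots> \<le> 4 * (card X choose (card X div 2))"
    by (rule littlewood_offord_pos) (use assms in auto)
  finally show ?thesis .
qed

text \<open>Each coordinate chooses between \<open>v j\<close> and \<open>v' j\<close>. Coordinates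
  whose options differ by less than 1/4 are frozen at a choice \<open>f\<close>; for every
  \<open>f\<close> the signed bound applies to the remaining ones, with coefficients
  \<open>v' j - v j\<close>.\<close>

lemma littlewood_offord:
  fixes v v' :: "'b \<Rightarrow> real"
  assumes G: "finite G"
  shows "real (card {e \<in> Pow G. c + (\<Sum>j\<in>G. if j \<in> e then v' j else v j) \<in> {T - 1<..T}})
     \<le> 4 * 2 ^ card G / sqrt (1 + real (card {j \<in> G. 1/4 \<le> \<bar>v' j - v j\<bar>}))"
proof -
  define X where "X = {j \<in> G. 1/4 \<le> \<bar>v' j - v j\<bar>}"
  define Y where "Y = G - X"
  have XY: "G = X \<union> Y" "X \<inter> Y = {}" "finite X" "finite Y" using G by (auto simp: X_def Y_def)
  define g where "g e = c + (\<Sum>j\<in>G. if j \<in> e then v' j else v j)" for e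
  define E where "E f = {e \<in> Pow X. (c + (\<Sum>j\<in>Y. if j \<in> f then v' j else v j) + (\<Sum>j\<in>X. v j)) + (\<Sum>j\<in>e. v' j - v j) \<in> {T - 1<..T}}" for f
  have ge: "g (e \<union> f) = (c + (\<Sum>j\<in>Y. if j \<in> f then v' j else v j) + (\<Sum>j\<in>X. v j)) + (\<Sum>j\<in>e. v' j - v j)"
    if "e \<subseteq> X" "f \<subseteq> Y" for e f
  proof -
    have "g (e \<union> f) = c + ((\<Sum>j\<in>X. if j \<in> e \<union> f then v' j else v j) + (\<Sum>j\<in>Y. if j \<in> e \<union> f then v' j else v j))"
      unfolding g_def XY(1) using XY by (subst sum.union_disjoint) auto
    also have "(\<Sum>j\<in>Y. if j \<in> e \<union> f then v' j else v j) = (\<Sum>j\<in>Y. if j \<in> f then v' j else v j)"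
      using that XY by (intro sum.cong) auto
    also have "(\<Sum>j\<in>X. if j \<in> e \<union> f then v' j else v j) = (\<Sum>j\<in>X. v j + (if j \<in> e then v' j - v j else 0))"
      using that XY by (intro sum.cong) auto
    also have "\<dots> = (\<Sum>j\<in>X. v j) + (\<Sum>j\<in>e. v' j - v j)"
      using that XY by (simp add: sum.distrib sum.If_cases Int_absorb1)
    finally show ?thesis by simp
  qed
  have "card {e \<in> Pow G. g e \<in> {T - 1<..T}} \<le> card (\<Union>f\<in>Pow Y. (\<lambda>e. e \<union> f) ` E f)"
  proof (rule card_mono)
    show "finite (\<Union>f\<in>Pow Y. (\<lambda>e. e \<union> f) ` E f)" using XY by (auto simp: E_def)
    show "{e \<in> Pow G. g e \<in> {T - 1<..T}} \<subseteq> (\<Union>f\<in>Pow Y. (\<lambda>e. e \<union> f) ` E f)"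
    proof
      fix e assume e: "e \<in> {e \<in> Pow G. g e \<in> {T - 1<..T}}"
      then have ee: "e = (e \<inter> X) \<union> (e \<inter> Y)" using XY by auto
      have "e \<inter> X \<in> E (e \<inter> Y)" unfolding E_def using e ge[of "e \<inter> X" "e \<inter> Y"] unfolding ee[symmetric] by simp
      with ee have "e \<in> (\<lambda>e'. e' \<union> (e \<inter> Y)) ` E (e \<inter> Y)" by (rule image_eqI)
      then show "e \<in> (\<Union>f\<in>Pow Y. (\<lambda>e. e \<union> f) ` E f)" by (rule UN_I[rotated]) simp
    qed
  qed
  also have "\<dots> \<le> (\<Sum>f\<in>Pow Y. card ((\<lambda>e. e \<union> f) ` E f))" using XY by (intro card_UN_le) auto
  also have "\<dots> \<le> (\<Sum>f\<in>Pow Y. 4 * (card X choose (card X div 2)))"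
  proof (rule sum_mono)
    fix f
    have "card ((\<lambda>e. e \<union> f) ` E f) \<le> card (E f)" by (rule card_image_le) (use XY in \<open>auto simp: E_def\<close>)
    also have "\<dots> \<le> 4 * (card X choose (card X div 2))"
      unfolding E_def by (rule littlewood_offord_signed) (auto simp: X_def G)
    finally show "card ((\<lambda>e. e \<union> f) ` E f) \<le> 4 * (card X choose (card X div 2))" .
  qed
  also have "\<dots> = 2 ^ card Y * (4 * (card X choose (card X div 2)))" using XY by (simp add: card_Pow)
  finally have "real (card {e \<in> Pow G. g e \<in> {T - 1<..T}}) \<le> real (2 ^ card Y * (4 * (card X choose (card X div 2))))"
    by (rule of_nat_mono)
  also have "\<dots> = 4 * 2 ^ card Y * real (card X choose (card X div 2))" by simp
  also have "\<dots> \<le> 4 * 2 ^ card Y * (2 ^ card X / sqrt (1 + real (card X)))"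
    by (intro mult_left_mono central_binomial_upper_bound) auto
  also have "\<dots> = 4 * 2 ^ card G / sqrt (1 + real (card X))"
    using XY by (simp add: card_Un_disjoint power_add)
  finally show ?thesis unfolding g_def X_def .
qed

section \<open>Joint small-ball probabilities\<close>

lemma (in iid_product) distr_coordinatewise:
  assumes "finite I" "\<And>j. j \<in> I \<Longrightarrow> f j \<in> M \<rightarrow>\<^sub>M M" "\<And>j. j \<in> I \<Longrightarrow> distr M M (f j) = M"
  shows "distr (P I) (P I) (\<lambda>w. \<lambda>j\<in>I. f j (w j)) = P I"
proof (rule prod.PiM_eqI[OF assms(1)])
  fix A assume A: "\<And>i. i \<in> I \<Longrightarrow> A i \<in> sets M"
  have m: "(\<lambda>w. \<lambda>j\<in>I. f j (w j)) \<in> P I \<rightarrow>\<^sub>M P I"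
    using assms(2) by (intro measurable_restrict measurable_compose[OF measurable_component_singleton]) auto
  have v: "(\<lambda>w. \<lambda>j\<in>I. f j (w j)) -` Pi\<^sub>E I A \<inter> space (P I) = Pi\<^sub>E I (\<lambda>j. f j -` A j \<inter> space M)"
    by (auto simp: space_PiM PiE_iff extensional_def)
  have "emeasure (distr (P I) (P I) (\<lambda>w. \<lambda>j\<in>I. f j (w j))) (Pi\<^sub>E I A) = emeasure (P I) (Pi\<^sub>E I (\<lambda>j. f j -` A j \<inter> space M))"
    using m A assms(1) by (subst emeasure_distr) (auto simp: v intro!: sets_PiM_I_finite)
  also have "\<dots> = (\<Prod>j\<in>I. emeasure M (f j -` A j \<inter> space M))"
    using A assms by (intro prod.emeasure_PiM) (auto intro: measurable_sets)
  also have "\<dots> = (\<Prod>j\<in>I. emeasure M (A j))"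
  proof (rule prod.cong[OF refl])
    fix j assume j: "j \<in> I"
    have "emeasure M (f j -` A j \<inter> space M) = emeasure (distr M M (f j)) (A j)"
      using A[OF j] assms(2)[OF j] by (simp add: emeasure_distr)
    then show "emeasure M (f j -` A j \<inter> space M) = emeasure M (A j)" using assms(3)[OF j] by simp
  qed
  finally show "emeasure (distr (P I) (P I) (\<lambda>w. \<lambda>j\<in>I. f j (w j))) (Pi\<^sub>E I A) = (\<Prod>i\<in>I. emeasure M (A i))" .
qed simp

definition phi :: "real \<Rightarrow> real \<Rightarrow> real" where "phi q t = nrm t powr q"

lemma phi_nonneg [simp]: "0 \<le> phi q t" by (simp add: phi_def)

lemma phi_le_1: "1 \<le> q \<Longrightarrow> phi q t \<le> 1"
  unfolding phi_def using powr_mono2[of q "nrm t" 1] by simp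

lemma phi_measurable [measurable]: "phi q \<in> borel_measurable borel"
  unfolding phi_def[abs_def] by measurable

definition ssum :: "real \<Rightarrow> nat set \<Rightarrow> (nat \<Rightarrow> real) \<Rightarrow> (nat \<Rightarrow> real) \<Rightarrow> real" where
  "ssum q L x w = (\<Sum>j\<in>L. phi q (x j - w j))"

lemma ssum_measurable2:
  assumes "\<And>j. j \<in> L \<Longrightarrow> (\<lambda>z. X z j) \<in> borel_measurable N" "\<And>j. j \<in> L \<Longrightarrow> (\<lambda>z. W z j) \<in> borel_measurable N"
  shows "(\<lambda>z. ssum q L (X z) (W z)) \<in> borel_measurable N"
  unfolding ssum_def
  by (intro borel_measurable_sum measurable_compose[OF _ phi_measurable] borel_measurable_diff assms)

lemma coord_measurable: "j \<in> I \<Longrightarrow> (\<lambda>w. w j) \<in> borel_measurable (circ.P I)"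
  using measurable_component_singleton[of j I "\<lambda>_. \<mu>"] by (simp cong: measurable_cong_sets)

lemma ssum_measurable: "L \<subseteq> I \<Longrightarrow> ssum q L x \<in> borel_measurable (circ.P I)"
  by (rule ssum_measurable2[of L "\<lambda>_. x" "circ.P I" "\<lambda>w. w" q]) (auto intro: coord_measurable)

lemma ssum_measurable_pair:
  "(\<lambda>z. ssum q I (fst z) (snd z)) \<in> borel_measurable (circ.P I \<Otimes>\<^sub>M circ.P I)"
  by (rule ssum_measurable2)
     (auto intro: measurable_compose[OF measurable_fst coord_measurable] measurable_compose[OF measurable_snd coord_measurable])

lemma ssum_upd_left: "finite L \<Longrightarrow> i \<in> L \<Longrightarrow> ssum q L (x(i := b)) w = phi q (b - w i) + ssum q (L - {i}) x w"
  unfolding ssum_def by (subst sum.remove[of L i]) auto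

lemma ssum_upd_right: "finite L \<Longrightarrow> i \<in> L \<Longrightarrow> ssum q L x (w(i := b)) = phi q (x i - b) + ssum q (L - {i}) x w"
  unfolding ssum_def by (subst sum.remove[of L i]) auto

text \<open>
  The reflection at \<open>y\<close> sends the antipode of \<open>x\<close> close to \<open>x\<close> if the distance of \<open>x\<close> and \<open>y\<close> is
  about \<open>1/2\<close>.
\<close>

lemma reflected_values_differ:
  assumes q: "1 \<le> q" and g: "3/8 \<le> nrm (x - y)" "nrm (x - y) \<le> 5/8" and u: "1 - 1/(8*q) < nrm (x - u)"
  shows "1/4 \<le> \<bar>phi q (2 * y - x - u) - phi q (x - u)\<bar>"
proof -
  define t where "t = 1/(8*q)"
  have t: "0 < t" "t \<le> 1/8" "q * t = 1/8" using q by (auto simp: t_def field_simps)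
  have "nrm (2 * y - x - u) = nrm ((2 * (y - x) - 1) + (x - u - 1 + 2 * of_int 1))" by (simp add: algebra_simps)
  also have "\<dots> \<le> nrm (2 * (y - x) - 1) + nrm (x - u - 1 + 2 * of_int 1)" by (rule nrm_triangle)
  also have "nrm (x - u - 1 + 2 * of_int 1) = 1 - nrm (x - u)" unfolding nrm_add_period by (rule nrm_diff_1)
  also have "nrm (2 * (y - x) - 1) \<le> 1/4"
    by (rule nrm_double_diff_1) (use g in \<open>simp_all add: nrm_minus_commute\<close>)
  finally have n: "nrm (2 * y - x - u) \<le> 1/2" using u t by (simp add: t_def[symmetric])
  have "phi q (2 * y - x - u) \<le> (1/2) powr q" unfolding phi_def using n q by (intro powr_mono2) auto
  also have "\<dots> \<le> (1/2) powr 1" using q by (intro powr_mono') auto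
  finally have a: "phi q (2 * y - x - u) \<le> 1/2" by simp
  \<comment> \<open>The scale \<open>1/(8*q)\<close> makes \<open>q * t = 1/8\<close>, which keeps
    \<open>phi q (x - u)\<close> above 6/7; the reflected value is at most 1/2, and the gap exceeds
    1/4.\<close>
  have "ln (1 - t) \<ge> - (t / (1 - t))"
  proof -
    have "ln (1 / (1 - t)) \<le> 1 / (1 - t) - 1" using t by (intro ln_le_minus_one) auto
    also have "1 / (1 - t) - 1 = t / (1 - t)" using t by (simp add: field_simps)
    finally show ?thesis using t by (simp add: ln_div)
  qed
  then have "q * ln (1 - t) \<ge> q * - (t / (1 - t))" using q by (intro mult_left_mono) auto
  moreover have "q * - (t / (1 - t)) = - ((1/8) / (1 - t))" unfolding t(3)[symmetric] by simp
  moreover have "(1/8) / (1 - t) \<le> 1/7" using t by (simp add: field_simps)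
  ultimately have "q * ln (1 - t) \<ge> - 1/7" by linarith
  then have "exp (q * ln (1 - t)) \<ge> 1 + - 1/7" using exp_ge_add_one_self[of "q * ln (1 - t)"] by linarith
  then have "(1 - t) powr q \<ge> 6/7" using t by (simp add: powr_def)
  moreover have "(1 - t) powr q \<le> phi q (x - u)" unfolding phi_def using t u q by (intro powr_mono2) (auto simp: t_def)
  ultimately show ?thesis using a by linarith
qed

text \<open>The count has mean \<open>card G / (8*q)\<close>. Above a quarter \<open>c\<close> of
  this mean the integrand is at most \<open>32 * q / N\<close>; the complementary event has
  probability at most \<open>exp (- c) <= 1 / c\<close>, which is again at most
  \<open>32 * q / N\<close>.\<close>

lemma expectation_inverse_count:
  assumes q: "1 \<le> q" and I: "finite I" "G \<subseteq> I" and N: "0 < N" "N \<le> real (card G)"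
  shows "(\<integral>w. 1 / (1 + real (card {j\<in>G. 1 - 1/(8*q) < nrm (x j - w j)})) \<partial>circ.P I) \<le> 64 * q / N"
    (is "(\<integral>w. 1 / (1 + real (?k w)) \<partial>_) \<le> _")
    and "(\<lambda>w. 1 / (1 + real (card {j\<in>G. 1 - 1/(8*q) < nrm (x j - w j)}))) \<in> borel_measurable (circ.P I)"
proof -
  interpret PI: prob_space "circ.P I" by (rule circ.prob_space_P)
  have fG: "finite G" using I finite_subset by auto
  have kc: "real (?k w) = (\<Sum>j\<in>G. indicator {1 - 1/(8*q)<..} (nrm (x j - w j)))" for w
    using fG by (simp add: indicator_def sum.If_cases Int_def)
  have mk: "(\<lambda>w. real (?k w)) \<in> borel_measurable (circ.P I)"
    unfolding kc
  proof (rule borel_measurable_sum)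
    fix j assume "j \<in> G"
    then have [measurable]: "(\<lambda>w. w j) \<in> borel_measurable (circ.P I)" using I coord_measurable by auto
    show "(\<lambda>w. indicator {1 - 1 / (8 * q)<..} (nrm (x j - w j)) :: real) \<in> borel_measurable (circ.P I)" by measurable
  qed
  then show m1: "(\<lambda>w. 1 / (1 + real (?k w))) \<in> borel_measurable (circ.P I)" by measurable
  define B where "B j = {u. 1 - 1/(8*q) < nrm (x j - u)}" for j
  define c where "c = real (card G) * (1/(8*q)) / 4"
  have cq: "c > 0" "N / (32 * q) \<le> c" using N q by (auto simp: c_def field_simps)
  have ch: "measure (circ.P I) {w \<in> space (circ.P I). card {j \<in> G. w j \<in> B j} \<le> c} \<le> exp (- real (card G) * (1/(8*q)) / 4)"
    unfolding c_def
  proof (rule circ.chernoff_count[OF I])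
    fix j
    have "measure \<mu> (B j) = 1 - (1 - 1/(8*q))" unfolding B_def using q by (intro circle_nrm_greater) (auto simp: field_simps)
    moreover have "B j \<in> sets borel" unfolding B_def by measurable
    ultimately show "B j \<in> sets \<mu> \<and> 1 / (8 * q) \<le> measure \<mu> (B j)" by simp
  qed (use q in auto)
  have kB: "?k w = card {j \<in> G. w j \<in> B j}" for w by (simp add: B_def)
  define E where "E = {w \<in> space (circ.P I). real (?k w) \<le> c}"
  have mE: "E \<in> sets (circ.P I)" unfolding E_def using mk unfolding borel_measurable_iff_le by blast
  have iE: "integrable (circ.P I) (indicator E :: _ \<Rightarrow> real)"
    by (rule PI.integrable_bounded[OF borel_measurable_indicator[OF mE], where B=1]) (simp add: indicator_def)
  have "(\<integral>w. 1 / (1 + real (?k w)) \<partial>circ.P I) \<le> (\<integral>w. 32 * q / N + indicator E w \<partial>circ.P I)"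
  proof (rule integral_mono)
    show "integrable (circ.P I) (\<lambda>w. 1 / (1 + real (?k w)))"
      by (rule PI.integrable_bounded[OF m1, where B=1]) (auto simp: field_simps)
    show "integrable (circ.P I) (\<lambda>w. 32 * q / N + indicator E w)"
      by (intro Bochner_Integration.integrable_add iE) simp
    show "1 / (1 + real (?k w)) \<le> 32 * q / N + indicator E w" if "w \<in> space (circ.P I)" for w
    proof (cases "real (?k w) \<le> c")
      case True
      have "1 / (1 + real (?k w)) \<le> 1" by simp
      also have "\<dots> \<le> 32 * q / N + indicator E w" using True that N q by (simp add: E_def)
      finally show ?thesis .
    next
      case False
      then have "N / (32 * q) \<le> 1 + real (?k w)" using cq by linarith
      then have "1 / (1 + real (?k w)) \<le> 1 / (N / (32 * q))"
        using N q by (intro divide_left_mono mult_pos_pos) auto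
      then show ?thesis using False by (simp add: E_def)
    qed
  qed
  also have "\<dots> = 32 * q / N + measure (circ.P I) E"
    using iE mE by (simp add: PI.prob_space)
  also have "measure (circ.P I) E \<le> exp (- c)" using ch unfolding E_def kB c_def by simp
  also have "exp (- c) \<le> 1 / c"
  proof -
    have "c \<le> exp c" using exp_ge_add_one_self[of c] by linarith
    then show ?thesis using cq by (simp add: exp_minus field_simps)
  qed
  also have "1 / c \<le> 1 / (N / (32 * q))" using cq N q by (intro divide_left_mono mult_pos_pos) auto
  finally show "(\<integral>w. 1 / (1 + real (?k w)) \<partial>circ.P I) \<le> 64 * q / N" by simp
qed

text \<open>The two reflections act on disjoint coordinate sets \<open>G1\<close> and
  \<open>G2\<close>, so the signs randomising the two sums are independent. Each sum then meets its
  window with conditional probability of order \<open>1 / sqrt (1 + k)\<close>, where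
  \<open>k\<close> counts the coordinates on which the reflection matters. The product of two such
  square roots is what yields \<open>q / N\<close> instead of its square root.\<close>

lemma joint_small_ball:
  assumes q: "1 \<le> q" and I: "finite I" "L \<subseteq> I" and G: "G1 \<subseteq> L" "G2 \<subseteq> L" "G1 \<inter> G2 = {}"
    and good: "\<And>j. j \<in> G1 \<union> G2 \<Longrightarrow> 3/8 \<le> nrm (x j - y j) \<and> nrm (x j - y j) \<le> 5/8"
    and N: "0 < N" "N \<le> real (card G1)" "N \<le> real (card G2)"
  shows "measure (circ.P I) {w \<in> space (circ.P I). ssum q L x w \<in> {T - 1<..T} \<and> ssum q L y w \<in> {T - 1<..T}}
    \<le> 1024 * q / N"
proof -
  interpret PI: prob_space "circ.P I" by (rule circ.prob_space_P)
  have fin: "finite L" "finite G1" "finite G2" using I G finite_subset by metis+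
  note [measurable] = ssum_measurable[OF I(2)]
  define E where "E = {w \<in> space (circ.P I). ssum q L x w \<in> {T - 1<..T} \<and> ssum q L y w \<in> {T - 1<..T}}"
  have mE: "E \<in> sets (circ.P I)" unfolding E_def by measurable
  \<comment> \<open>\<open>e1\<close> selects the reflections at \<open>y j\<close>, which leave the
    sum for \<open>y\<close> unchanged, and \<open>e2\<close> those at \<open>x j\<close>, which
    leave the sum for \<open>x\<close> unchanged. Hence \<open>X\<close> depends on
    \<open>e1\<close> only and \<open>Y\<close> on \<open>e2\<close> only.\<close>
  define f where "f e1 e2 j = (if j \<in> e1 then refl_circ (2 * y j) else if j \<in> e2 then refl_circ (2 * x j) else (\<lambda>u. u))" for e1 e2 j
  define R where "R e1 e2 = (\<lambda>w. \<lambda>j\<in>I. f e1 e2 j (w j))" for e1 e2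
  have mf: "f e1 e2 j \<in> \<mu> \<rightarrow>\<^sub>M \<mu>" for e1 e2 j
    using refl_circ_measurable unfolding f_def by (auto cong: measurable_cong_sets)
  have df: "distr \<mu> \<mu> (f e1 e2 j) = \<mu>" for e1 e2 j
    unfolding f_def by (auto simp: distr_refl_circ distr_id2)
  have mR: "R e1 e2 \<in> circ.P I \<rightarrow>\<^sub>M circ.P I" for e1 e2
    unfolding R_def using mf by (intro measurable_restrict measurable_compose[OF measurable_component_singleton]) auto
  have dR: "distr (circ.P I) (circ.P I) (R e1 e2) = circ.P I" for e1 e2
    unfolding R_def by (rule circ.distr_coordinatewise[OF I(1) mf df])
  define X where "X w e = (ssum q (L - G1) x w + (\<Sum>j\<in>G1. if j \<in> e then phi q (2 * y j - x j - w j) else phi q (x j - w j)))" for w e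
  define Y where "Y w e = (ssum q (L - G2) y w + (\<Sum>j\<in>G2. if j \<in> e then phi q (2 * x j - y j - w j) else phi q (y j - w j)))" for w e
  have RX: "ssum q L x (R e1 e2 w) = X w e1" if e: "e1 \<subseteq> G1" "e2 \<subseteq> G2" for e1 e2 w
  proof -
    have "ssum q L x (R e1 e2 w) = (\<Sum>j\<in>L - G1. phi q (x j - R e1 e2 w j)) + (\<Sum>j\<in>G1. phi q (x j - R e1 e2 w j))"
      unfolding ssum_def using G fin by (intro sum.subset_diff) auto
    also have "(\<Sum>j\<in>L - G1. phi q (x j - R e1 e2 w j)) = ssum q (L - G1) x w"
      unfolding ssum_def
      by (rule sum.cong) (use e I in \<open>auto simp: R_def f_def phi_def nrm_refl_circ nrm_minus_commute\<close>)
    also have "(\<Sum>j\<in>G1. phi q (x j - R e1 e2 w j)) = (\<Sum>j\<in>G1. if j \<in> e1 then phi q (2 * y j - x j - w j) else phi q (x j - w j))"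
      by (rule sum.cong) (use e I G in \<open>auto simp: R_def f_def phi_def nrm_refl_circ\<close>)
    finally show ?thesis by (simp add: X_def)
  qed
  have RY: "ssum q L y (R e1 e2 w) = Y w e2" if e: "e1 \<subseteq> G1" "e2 \<subseteq> G2" for e1 e2 w
  proof -
    have "ssum q L y (R e1 e2 w) = (\<Sum>j\<in>L - G2. phi q (y j - R e1 e2 w j)) + (\<Sum>j\<in>G2. phi q (y j - R e1 e2 w j))"
      unfolding ssum_def using G fin by (intro sum.subset_diff) auto
    also have "(\<Sum>j\<in>L - G2. phi q (y j - R e1 e2 w j)) = ssum q (L - G2) y w"
      unfolding ssum_def
      by (rule sum.cong) (use e I in \<open>auto simp: R_def f_def phi_def nrm_refl_circ nrm_minus_commute\<close>)
    also have "(\<Sum>j\<in>G2. phi q (y j - R e1 e2 w j)) = (\<Sum>j\<in>G2. if j \<in> e2 then phi q (2 * x j - y j - w j) else phi q (y j - w j))"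
      by (rule sum.cong) (use e I G in \<open>auto simp: R_def f_def phi_def nrm_refl_circ\<close>)
    finally show ?thesis by (simp add: Y_def)
  qed
  define k1 where "k1 w = card {j\<in>G1. 1 - 1/(8*q) < nrm (x j - w j)}" for w
  define k2 where "k2 w = card {j\<in>G2. 1 - 1/(8*q) < nrm (y j - w j)}" for w
  have bX: "real (card {e \<in> Pow G1. X w e \<in> {T - 1<..T}}) \<le> 4 * 2 ^ card G1 / sqrt (1 + real (k1 w))" for w
  proof -
    have "real (card {e \<in> Pow G1. X w e \<in> {T - 1<..T}})
      \<le> 4 * 2 ^ card G1 / sqrt (1 + real (card {j \<in> G1. 1/4 \<le> \<bar>phi q (2 * y j - x j - w j) - phi q (x j - w j)\<bar>}))"
      unfolding X_def by (rule littlewood_offord[OF fin(2)])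
    also have "\<dots> \<le> 4 * 2 ^ card G1 / sqrt (1 + real (k1 w))"
    proof (intro divide_left_mono mult_pos_pos)
      have "1/4 \<le> \<bar>phi q (2 * y j - x j - w j) - phi q (x j - w j)\<bar>"
        if "j \<in> G1" "1 - 1/(8*q) < nrm (x j - w j)" for j
        using reflected_values_differ[OF q _ _ that(2), of "y j"] good[of j] that(1) by simp
      then have "k1 w \<le> card {j \<in> G1. 1/4 \<le> \<bar>phi q (2 * y j - x j - w j) - phi q (x j - w j)\<bar>}"
        unfolding k1_def by (intro card_mono) (use fin in auto)
      then show "sqrt (1 + real (k1 w)) \<le> sqrt (1 + real (card {j \<in> G1. 1/4 \<le> \<bar>phi q (2 * y j - x j - w j) - phi q (x j - w j)\<bar>}))"
        by simp
    qed auto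
    finally show ?thesis .
  qed
  have bY: "real (card {e \<in> Pow G2. Y w e \<in> {T - 1<..T}}) \<le> 4 * 2 ^ card G2 / sqrt (1 + real (k2 w))" for w
  proof -
    have "real (card {e \<in> Pow G2. Y w e \<in> {T - 1<..T}})
      \<le> 4 * 2 ^ card G2 / sqrt (1 + real (card {j \<in> G2. 1/4 \<le> \<bar>phi q (2 * x j - y j - w j) - phi q (y j - w j)\<bar>}))"
      unfolding Y_def by (rule littlewood_offord[OF fin(3)])
    also have "\<dots> \<le> 4 * 2 ^ card G2 / sqrt (1 + real (k2 w))"
    proof (intro divide_left_mono mult_pos_pos)
      have "1/4 \<le> \<bar>phi q (2 * x j - y j - w j) - phi q (y j - w j)\<bar>"
        if "j \<in> G2" "1 - 1/(8*q) < nrm (y j - w j)" for j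
        using reflected_values_differ[OF q _ _ that(2), of "x j"] good[of j] that(1)
        by (simp add: nrm_minus_commute[of "y j"])
      then have "k2 w \<le> card {j \<in> G2. 1/4 \<le> \<bar>phi q (2 * x j - y j - w j) - phi q (y j - w j)\<bar>}"
        unfolding k2_def by (intro card_mono) (use fin in auto)
      then show "sqrt (1 + real (k2 w)) \<le> sqrt (1 + real (card {j \<in> G2. 1/4 \<le> \<bar>phi q (2 * x j - y j - w j) - phi q (y j - w j)\<bar>}))"
        by simp
    qed auto
    finally show ?thesis .
  qed
  define h where "h w = 8 * (1 / (1 + real (k1 w)) + 1 / (1 + real (k2 w)))" for w
  define C where "C = (2::real) ^ card G1 * 2 ^ card G2"
  have avg: "(\<Sum>e1\<in>Pow G1. \<Sum>e2\<in>Pow G2. indicator E (R e1 e2 w)) \<le> C * h w"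
    if w: "w \<in> space (circ.P I)" for w
  proof -
    have "(\<Sum>e1\<in>Pow G1. \<Sum>e2\<in>Pow G2. indicator E (R e1 e2 w) :: real)
       = (\<Sum>e1\<in>Pow G1. \<Sum>e2\<in>Pow G2. of_bool (X w e1 \<in> {T - 1<..T}) * of_bool (Y w e2 \<in> {T - 1<..T}))"
    proof (intro sum.cong refl)
      fix e1 e2 assume "e1 \<in> Pow G1" "e2 \<in> Pow G2"
      moreover have "R e1 e2 w \<in> space (circ.P I)" using measurable_space[OF mR w] .
      ultimately show "indicator E (R e1 e2 w) = (of_bool (X w e1 \<in> {T - 1<..T}) * of_bool (Y w e2 \<in> {T - 1<..T}) :: real)"
        unfolding E_def by (simp add: RX RY indicator_def del: greaterThanAtMost_iff)
    qed
    also have "\<dots> = (\<Sum>e1\<in>Pow G1. of_bool (X w e1 \<in> {T - 1<..T})) * (\<Sum>e2\<in>Pow G2. of_bool (Y w e2 \<in> {T - 1<..T}))"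
      by (simp only: sum_product)
    also have "\<dots> = real (card {e \<in> Pow G1. X w e \<in> {T - 1<..T}}) * real (card {e \<in> Pow G2. Y w e \<in> {T - 1<..T}})"
      using fin by (simp only: sum_of_bool_eq finite_Pow_iff Int_def) (simp add: of_bool_def sum.If_cases Int_def)
    also have "\<dots> \<le> (4 * 2 ^ card G1 / sqrt (1 + real (k1 w))) * (4 * 2 ^ card G2 / sqrt (1 + real (k2 w)))"
      by (intro mult_mono bX bY) auto
    also have "\<dots> = 16 * C * ((1 / sqrt (1 + real (k1 w))) * (1 / sqrt (1 + real (k2 w))))" by (simp add: C_def)
    \<comment> \<open>The arithmetic-geometric mean inequality decouples \<open>k1\<close> and
      \<open>k2\<close>, so that only expectations of single inverse counts are required.\<close>
    also have "\<dots> \<le> 16 * C * (((1 / sqrt (1 + real (k1 w)))\<^sup>2 + (1 / sqrt (1 + real (k2 w)))\<^sup>2) / 2)"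
    proof (rule mult_left_mono)
      show "a * b \<le> (a\<^sup>2 + b\<^sup>2) / 2" for a b :: real using sum_squares_bound[of a b] by simp
    qed (simp add: C_def)
    also have "\<dots> = C * h w" by (simp add: h_def power_divide)
    finally show ?thesis .
  qed
  have GI: "G1 \<subseteq> I" "G2 \<subseteq> I" using G I by auto
  have mk: "(\<lambda>w. 1 / (1 + real (k1 w))) \<in> borel_measurable (circ.P I)" "(\<lambda>w. 1 / (1 + real (k2 w))) \<in> borel_measurable (circ.P I)"
    unfolding k1_def k2_def
    by (rule expectation_inverse_count(2)[OF q I(1) GI(1) N(1) N(2)], rule expectation_inverse_count(2)[OF q I(1) GI(2) N(1) N(3)])
  have ik: "integrable (circ.P I) (\<lambda>w. 1 / (1 + real (k1 w)))" "integrable (circ.P I) (\<lambda>w. 1 / (1 + real (k2 w)))"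
    by (rule PI.integrable_bounded[where B=1]; use mk in \<open>auto simp: field_simps\<close>)+
  have ek: "(\<integral>w. 1 / (1 + real (k1 w)) \<partial>circ.P I) \<le> 64 * q / N" "(\<integral>w. 1 / (1 + real (k2 w)) \<partial>circ.P I) \<le> 64 * q / N"
    unfolding k1_def k2_def
    by (rule expectation_inverse_count(1)[OF q I(1) GI(1) N(1) N(2)], rule expectation_inverse_count(1)[OF q I(1) GI(2) N(1) N(3)])
  \<comment> \<open>Every \<open>R e1 e2\<close> preserves the measure, so the probability of
    \<open>E\<close> equals its average over all pairs of sign patterns.\<close>
  have ER: "measure (circ.P I) E = (\<integral>w. indicator E (R e1 e2 w) \<partial>circ.P I)" for e1 e2
  proof -
    have "measure (circ.P I) E = (\<integral>w. indicator E w \<partial>distr (circ.P I) (circ.P I) (R e1 e2))"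
      using mE by (simp add: dR)
    also have "\<dots> = (\<integral>w. indicator E (R e1 e2 w) \<partial>circ.P I)"
      using mE mR by (intro integral_distr) auto
    finally show ?thesis .
  qed
  have iER: "integrable (circ.P I) (\<lambda>w. indicator E (R e1 e2 w) :: real)" for e1 e2
    by (rule PI.integrable_bounded[OF measurable_compose[OF mR borel_measurable_indicator[OF mE]], where B=1])
       (simp add: indicator_def)
  have "C * measure (circ.P I) E = (\<Sum>e1\<in>Pow G1. \<Sum>e2\<in>Pow G2. measure (circ.P I) E)"
    using fin by (simp add: C_def card_Pow)
  also have "\<dots> = (\<Sum>e1\<in>Pow G1. \<Sum>e2\<in>Pow G2. (\<integral>w. indicator E (R e1 e2 w) \<partial>circ.P I))"
    by (intro sum.cong refl ER)
  also have "\<dots> = (\<integral>w. (\<Sum>e1\<in>Pow G1. \<Sum>e2\<in>Pow G2. indicator E (R e1 e2 w)) \<partial>circ.P I)"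
    using iER by (subst Bochner_Integration.integral_sum, force)+ simp
  also have "\<dots> \<le> (\<integral>w. C * h w \<partial>circ.P I)"
  proof (rule integral_mono[OF _ _ avg])
    show "integrable (circ.P I) (\<lambda>w. \<Sum>e1\<in>Pow G1. \<Sum>e2\<in>Pow G2. indicator E (R e1 e2 w) :: real)"
      by (intro Bochner_Integration.integrable_sum iER)
    show "integrable (circ.P I) (\<lambda>w. C * h w)"
      unfolding h_def by (intro integrable_mult_right Bochner_Integration.integrable_add ik)
  qed
  also have "\<dots> = C * (8 * ((\<integral>w. 1 / (1 + real (k1 w)) \<partial>circ.P I) + (\<integral>w. 1 / (1 + real (k2 w)) \<partial>circ.P I)))"
    unfolding h_def by (simp only: integral_mult_right_zero Bochner_Integration.integral_add[OF ik])
  also have "\<dots> \<le> C * (1024 * q / N)"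
    using ek by (intro mult_left_mono) (auto simp: C_def)
  finally show ?thesis unfolding E_def[symmetric] by (rule mult_left_le_imp_le) (simp add: C_def)
qed

section \<open>Anticoncentration and covariances of threshold events\<close>

lemma circle_nrm_closed_interval:
  assumes "0 < s" "s \<le> t" "t \<le> 1"
  shows "measure \<mu> {w. s \<le> nrm (a - w) \<and> nrm (a - w) \<le> t} \<le> t - s"
proof (rule field_le_epsilon)
  fix e :: real assume e: "0 < e"
  define s' where "s' = max 0 (s - e)"
  have s': "0 \<le> s'" "s' < s" "s - e \<le> s'" using e assms by (auto simp: s'_def)
  have "measure \<mu> {w. s \<le> nrm (a - w) \<and> nrm (a - w) \<le> t} \<le> measure \<mu> {w. s' < nrm (a - w) \<and> nrm (a - w) \<le> t}"
    using s' by (intro circ.finite_measure_mono) auto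
  also have "\<dots> = t - s'" using s' assms by (intro circle_nrm_interval) auto
  finally show "measure \<mu> {w. s \<le> nrm (a - w) \<and> nrm (a - w) \<le> t} \<le> t - s + e" using s' by linarith
qed

text \<open>The density of \<open>phi\<close> at a value v is
  \<open>(1/q) * v powr (1/q - 1)\<close>, which is at most \<open>1/v\<close> for every
  \<open>q >= 1\<close>. The proof is the integrated form
  \<open>g powr (1/q) - c powr (1/q) <= 1 - c/g\<close>, so the bound does not deteriorate with
  \<open>q\<close>.\<close>

lemma phi_window:
  assumes q: "1 \<le> q" and h: "0 \<le> h" and b: "0 < b"
  shows "measure \<mu> {u. \<alpha> < phi q (a - u) \<and> phi q (a - u) \<le> \<alpha> + h \<and> b \<le> phi q (a - u)} \<le> h / b"
    (is "measure \<mu> ?S \<le> _")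
proof -
  define c where "c = max \<alpha> b"
  have c: "0 < c" "b \<le> c" using b by (auto simp: c_def)
  show ?thesis
  proof (cases "c \<le> 1")
    case False
    have "?S = {}"
    proof -
      have "\<not> c \<le> phi q (a - u)" for u using False phi_le_1[OF q, of "a - u"] by linarith
      moreover have "c \<le> phi q (a - u)" if "u \<in> ?S" for u using that by (auto simp: c_def)
      ultimately show ?thesis by blast
    qed
    then have "measure \<mu> ?S = 0" by (simp only: measure_empty)
    then show ?thesis using h b by simp
  next
    case True
    define g where "g = min 1 (c + h)"
    have g: "c \<le> g" "g \<le> 1" "g - c \<le> h" "0 < g" using True h c by (auto simp: g_def)
    have r: "0 < 1/q" "1/q \<le> 1" using q by auto
    have S: "?S \<subseteq> {u. c powr (1/q) \<le> nrm (a - u) \<and> nrm (a - u) \<le> g powr (1/q)}"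
    proof
      fix u assume u: "u \<in> ?S"
      have p: "c \<le> phi q (a - u)" "phi q (a - u) \<le> g"
        using u phi_le_1[OF q, of "a - u"] by (auto simp: c_def g_def)
      have e: "phi q (a - u) powr (1/q) = nrm (a - u)"
        unfolding phi_def using q by (simp add: powr_powr)
      show "u \<in> {u. c powr (1/q) \<le> nrm (a - u) \<and> nrm (a - u) \<le> g powr (1/q)}"
        using powr_mono2[OF _ _ p(1), of "1/q"] powr_mono2[OF _ _ p(2), of "1/q"] c r by (simp add: e)
    qed
    have "measure \<mu> ?S \<le> measure \<mu> {u. c powr (1/q) \<le> nrm (a - u) \<and> nrm (a - u) \<le> g powr (1/q)}"
      using S by (intro circ.finite_measure_mono) auto
    also have "\<dots> \<le> g powr (1/q) - c powr (1/q)"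
    proof (rule circle_nrm_closed_interval)
      show "c powr (1/q) \<le> g powr (1/q)" using c g r by (intro powr_mono2) auto
      show "g powr (1/q) \<le> 1" using powr_mono2[of "1/q" g 1] g r by simp
    qed (use c in auto)
    also have "\<dots> \<le> 1 - c / g"
    proof -
      have "c powr (1/q) = g powr (1/q) * (c / g) powr (1/q)"
        using c g by (simp add: powr_divide)
      then have "g powr (1/q) - c powr (1/q) = g powr (1/q) * (1 - (c / g) powr (1/q))"
        by (simp add: algebra_simps)
      also have "\<dots> \<le> 1 * (1 - (c / g) powr (1/q))"
      proof (rule mult_right_mono)
        show "g powr (1/q) \<le> 1" using powr_mono2[of "1/q" g 1] g r by simp
        show "0 \<le> 1 - (c / g) powr (1/q)" using powr_mono2[of "1/q" "c/g" 1] g c r by simp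
      qed
      also have "\<dots> \<le> 1 - c / g"
        using powr_mono'[of "1/q" 1 "c/g"] g c r by simp
      finally show ?thesis .
    qed
    also have "1 - c / g = (g - c) / g" using g by (simp add: diff_divide_distrib)
    also have "\<dots> \<le> h / b" using g c b h by (intro frac_le) auto
    finally show ?thesis .
  qed
qed

text \<open>If the sum exceeds \<open>T/2\<close>, some coordinate contributes at least
  \<open>T / (2*d)\<close>. Given the others, that coordinate must hit a window of length
  \<open>\<eta> * T\<close>, which by \<open>phi_window\<close> has probability at most
  \<open>2 * d * \<eta>\<close>; a union over at most \<open>d\<close> coordinates finishes. Only
  the size relative to \<open>T\<close> matters, so no estimate of \<open>T\<close> is
  involved.\<close>

lemma ssum_anticoncentration:
  assumes q: "1 \<le> q" and I: "finite I" "L \<subseteq> I" and d: "1 \<le> d" "card L \<le> d"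
    and T: "0 < T" and e: "0 \<le> \<eta>" "\<eta> \<le> 1/2"
  shows "measure (circ.P I) {w \<in> space (circ.P I). T - \<eta> * T < ssum q L x w \<and> ssum q L x w \<le> T} \<le> 2 * (real d)\<^sup>2 * \<eta>"
proof -
  interpret PI: prob_space "circ.P I" by (rule circ.prob_space_P)
  have fL: "finite L" using I finite_subset by auto
  define E where "E m = {w \<in> space (circ.P I). (T - \<eta> * T < ssum q L x w \<and> ssum q L x w \<le> T) \<and> T / (2 * d) \<le> phi q (x m - w m)}" for m
  have mE: "E m \<in> sets (circ.P I)" if "m \<in> L" for m
  proof -
    have [measurable]: "(\<lambda>w. w m) \<in> borel_measurable (circ.P I)" using that I coord_measurable by auto
    note [measurable] = ssum_measurable[OF I(2)]
    show ?thesis unfolding E_def by measurable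
  qed
  have sub: "{w \<in> space (circ.P I). T - \<eta> * T < ssum q L x w \<and> ssum q L x w \<le> T} \<subseteq> (\<Union>m\<in>L. E m)"
  proof
    fix w assume w: "w \<in> {w \<in> space (circ.P I). T - \<eta> * T < ssum q L x w \<and> ssum q L x w \<le> T}"
    have "\<exists>m\<in>L. T / (2 * d) \<le> phi q (x m - w m)"
    proof (rule ccontr)
      assume "\<not> (\<exists>m\<in>L. T / (2 * d) \<le> phi q (x m - w m))"
      then have "ssum q L x w \<le> card L * (T / (2 * d))"
        unfolding ssum_def by (intro sum_bounded_above) (auto simp: not_le intro: less_imp_le)
      also have "\<dots> \<le> d * (T / (2 * d))" using d T by (intro mult_right_mono) auto
      also have "\<dots> = T / 2" using d by simp
      also have "\<dots> \<le> T - \<eta> * T" using T e mult_right_mono[of \<eta> "1/2" T] by simp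
      finally show False using w by simp
    qed
    then show "w \<in> (\<Union>m\<in>L. E m)" using w by (auto simp: E_def)
  qed
  have bE: "measure (circ.P I) (E m) \<le> 2 * d * \<eta>" if m: "m \<in> L" for m
  proof -
    have mI: "m \<in> I" using m I by auto
    have "measure (circ.P I) (E m) = (\<integral>w. indicator (E m) w \<partial>circ.P I)" using mE[OF m] by simp
    also have "\<dots> = (\<integral>w. (\<integral>u. indicator (E m) (w(m := u)) \<partial>\<mu>) \<partial>circ.P I)"
      by (rule circ.integral_upd_eq[OF I(1) mI borel_measurable_indicator[OF mE[OF m]], where B=1])
         (simp add: indicator_def)
    also have "\<bar>\<dots>\<bar> \<le> 2 * d * \<eta>"
    proof (rule PI.integral_abs_le)
      show "(\<lambda>w. \<integral>u. indicator (E m) (w(m := u)) \<partial>\<mu> :: real) \<in> borel_measurable (circ.P I)"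
        using measurable_compose[OF circ.measurable_upd_pair[OF mI] borel_measurable_indicator[OF mE[OF m]]]
        by (intro circ.borel_measurable_lebesgue_integral) (simp add: split_beta')
      fix w assume w: "w \<in> space (circ.P I)"
      let ?S = "{u. T - \<eta> * T - ssum q (L - {m}) x w < phi q (x m - u) \<and> phi q (x m - u) \<le> (T - \<eta> * T - ssum q (L - {m}) x w) + \<eta> * T \<and> T / (2 * d) \<le> phi q (x m - u)}"
      have "indicator (E m) (w(m := u)) = (indicator ?S u :: real)" for u
        using circ.space_upd[OF w _ mI, of u] fL m unfolding E_def by (auto simp: ssum_upd_right indicator_def)
      then have "(\<integral>u. indicator (E m) (w(m := u)) \<partial>\<mu>) = (\<integral>u. (indicator ?S u :: real) \<partial>\<mu>)" by simp
      also have "\<dots> = measure \<mu> ?S" by simp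
      also have "\<dots> \<le> (\<eta> * T) / (T / (2 * d))" by (rule phi_window[OF q]) (use e T d in auto)
      also have "\<dots> = 2 * d * \<eta>" using T by simp
      finally show "\<bar>\<integral>u. indicator (E m) (w(m := u)) \<partial>\<mu>\<bar> \<le> 2 * d * \<eta>"
        by simp
    qed
    finally show ?thesis by simp
  qed
  have "measure (circ.P I) {w \<in> space (circ.P I). T - \<eta> * T < ssum q L x w \<and> ssum q L x w \<le> T} \<le> measure (circ.P I) (\<Union>m\<in>L. E m)"
    using sub mE fL by (intro PI.finite_measure_mono sets.finite_UN) auto
  also have "\<dots> \<le> (\<Sum>m\<in>L. measure (circ.P I) (E m))"
    using mE fL by (intro PI.finite_measure_subadditive_finite) auto
  also have "\<dots> \<le> card L * (2 * d * \<eta>)" using bE by (intro sum_bounded_above) auto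
  also have "\<dots> \<le> d * (2 * d * \<eta>)" using d e by (intro mult_right_mono) auto
  also have "\<dots> = 2 * (real d)\<^sup>2 * \<eta>" by (simp add: power2_eq_square)
  finally show ?thesis .
qed

definition overlap :: "real \<Rightarrow> real \<Rightarrow> real \<Rightarrow> real" where
  "overlap \<epsilon> a b = measure \<mu> {u. 1 - \<epsilon> < nrm (a - u) \<and> 1 - \<epsilon> < nrm (b - u)}"

text \<open>Both sides depend on the law of a uniform difference only. Resampling a coordinate of
  \<open>y\<close> with \<open>w\<close> fixed therefore subtracts exactly the mean over that
  coordinate of \<open>w\<close>, which turns the increment of \<open>gam\<close> into a covariance
  on the circle.\<close>

lemma indicator_phi_mean:
  "(\<integral>b. indicator {..B} (phi q (b - u)) - 1/2 \<partial>\<mu>) = (\<integral>v. indicator {..B} (phi q (a - v)) - 1/2 \<partial>\<mu> :: real)"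
proof -
  have *: "(\<integral>v. indicator {..B} (phi q (c - v)) \<partial>\<mu> :: real) = measure \<mu> {v. nrm v \<in> {t. t powr q \<le> B}}" for c
  proof -
    have "(\<integral>v. indicator {..B} (phi q (c - v)) \<partial>\<mu> :: real) = (\<integral>v. indicator {v. nrm (c - v) \<in> {t. t powr q \<le> B}} v \<partial>\<mu>)"
      by (rule Bochner_Integration.integral_cong) (auto simp: indicator_def phi_def)
    also have "\<dots> = measure \<mu> {v. nrm (c - v) \<in> {t. t powr q \<le> B}}" by simp
    also have "\<dots> = measure \<mu> {v. nrm v \<in> {t. t powr q \<le> B}}"
      by (rule circle_nrm_invariant) measurable
    finally show ?thesis .
  qed
  have "(\<integral>b. indicator {..B} (phi q (b - u)) \<partial>\<mu> :: real) = (\<integral>b. indicator {..B} (phi q (u - b)) \<partial>\<mu>)"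
    by (simp add: phi_def nrm_minus_commute)
  then have e: "(\<integral>b. indicator {..B} (phi q (b - u)) \<partial>\<mu> :: real) = (\<integral>v. indicator {..B} (phi q (a - v)) \<partial>\<mu>)"
    unfolding * .
  have i: "integrable \<mu> (\<lambda>b. indicator {..B} (phi q (b - u)) :: real)" "integrable \<mu> (\<lambda>v. indicator {..B} (phi q (a - v)) :: real)"
    by (rule circ.integrable_bounded[where B=1]; auto simp: indicator_def)+
  show ?thesis using i e by simp
qed

text \<open>\<open>A\<close> and \<open>B\<close> are the amounts left for one coordinate below the
  threshold. Outside \<open>{0..<1}\<close> an indicator is constant and the covariance vanishes. If
  both are at least \<open>\<kappa>\<close>, exceeding them forces \<open>u\<close> into the
  near-antipodal arcs of \<open>a\<close> and \<open>b\<close>, of measure \<open>\<epsilon>\<close>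
  each. In the remaining cases the trivial bound 1 is charged to the last two terms.\<close>

lemma circle_covariance_bound:
  fixes q \<epsilon> \<kappa> a b A B :: real
  assumes q: "1 \<le> q" and eps: "0 \<le> \<epsilon>" "\<epsilon> \<le> 1" and th: "\<And>t. \<kappa> < phi q t \<Longrightarrow> 1 - \<epsilon> < nrm t"
  defines "X \<equiv> \<lambda>u. indicator {..A} (phi q (a - u)) - 1/2 :: real"
    and "Y \<equiv> \<lambda>u. indicator {..B} (phi q (b - u)) - 1/2 :: real"
  shows "\<bar>\<integral>u. X u * (Y u - (\<integral>v. Y v \<partial>\<mu>)) \<partial>\<mu>\<bar>
    \<le> of_bool (0 \<le> A \<and> A < 1 \<and> 0 \<le> B \<and> B < 1) * (overlap \<epsilon> a b + \<epsilon>\<^sup>2)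
      + of_bool (0 \<le> A \<and> A < \<kappa>) + of_bool (0 \<le> B \<and> B < \<kappa>)"
    (is "_ \<le> ?R")
proof -
  have o0: "0 \<le> overlap \<epsilon> a b" by (simp add: overlap_def)
  have R0: "0 \<le> ?R" using o0 by simp
  have mX: "X \<in> borel_measurable \<mu>" and mY: "Y \<in> borel_measurable \<mu>" unfolding X_def Y_def by measurable
  have bX: "\<bar>X u\<bar> \<le> 1/2" and bY: "\<bar>Y u\<bar> \<le> 1/2" for u unfolding X_def Y_def by (auto simp: indicator_def)
  have iY: "integrable \<mu> Y" by (rule circ.integrable_bounded[OF mY bY])
  define m where "m = (\<integral>v. Y v \<partial>\<mu>)"
  have bm: "\<bar>m\<bar> \<le> 1/2" unfolding m_def by (rule circ.integral_abs_le[OF mY bY])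
  have Y0: "(\<integral>u. Y u - m \<partial>\<mu>) = 0" using iY by (simp add: m_def circ.prob_space[simplified])
  show ?thesis
  proof (cases "0 \<le> A \<and> A < 1 \<and> 0 \<le> B \<and> B < 1")
    case False
    then consider "A < 0 \<or> 1 \<le> A" | "B < 0 \<or> 1 \<le> B" by linarith
    then have "(\<integral>u. X u * (Y u - m) \<partial>\<mu>) = 0"
    proof cases
      case 1
      define c where "c = X 0"
      have "X u = c" for u
        using 1 phi_nonneg[of q "a - u"] phi_le_1[OF q, of "a - u"] phi_nonneg[of q a] phi_le_1[OF q, of a]
        unfolding c_def X_def by (auto simp: indicator_def simp del: phi_nonneg)
      then show ?thesis using Y0 by simp
    next
      case 2
      define c where "c = Y 0"
      have Yc: "Y = (\<lambda>u. c)"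
      proof
        show "Y u = c" for u
        using 2 phi_nonneg[of q "b - u"] phi_le_1[OF q, of "b - u"] phi_nonneg[of q b] phi_le_1[OF q, of b]
        unfolding c_def Y_def by (auto simp: indicator_def simp del: phi_nonneg)
      qed
      then have "m = c" unfolding m_def using circ.prob_space by simp
      then show ?thesis using Yc by simp
    qed
    then show ?thesis using R0 unfolding m_def by simp
  next
    case True
    show ?thesis
    proof (cases "\<kappa> \<le> A \<and> \<kappa> \<le> B")
      case False
      have "\<bar>\<integral>u. X u * (Y u - m) \<partial>\<mu>\<bar> \<le> 1"
      proof (rule circ.integral_abs_le)
        show "(\<lambda>u. X u * (Y u - m)) \<in> borel_measurable \<mu>" using mX mY by measurable
        show "\<bar>X u * (Y u - m)\<bar> \<le> 1" for u
        proof -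
          have "\<bar>Y u - m\<bar> \<le> 1" using bY[of u] bm by linarith
          then have "\<bar>X u\<bar> * \<bar>Y u - m\<bar> \<le> 1/2 * 1" using bX[of u] by (intro mult_mono) auto
          then show ?thesis by (simp add: abs_mult)
        qed
      qed
      also have "1 \<le> ?R" using False True o0 by (auto simp: not_le)
      finally show ?thesis unfolding m_def .
    next
      case k: True
      define SX where "SX = {u. A < phi q (a - u)}"
      define SY where "SY = {u. B < phi q (b - u)}"
      have mS[measurable]: "SX \<in> sets borel" "SY \<in> sets borel" unfolding SX_def SY_def by measurable
      have X': "X u = 1/2 - indicator SX u" and Y': "Y u = 1/2 - indicator SY u" for u
        unfolding X_def Y_def SX_def SY_def by (auto simp: indicator_def)
      have mSY: "m = 1/2 - measure \<mu> SY"
        unfolding m_def Y'[abs_def] using mS circ.prob_space by (simp add: circ.emeasure_eq_measure)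
      have ind: "integrable \<mu> (indicator S :: real \<Rightarrow> real)" if "S \<in> sets borel" for S
        using that by (simp add: circ.emeasure_eq_measure)
      \<comment> \<open>The constant part 1/2 of \<open>X\<close> is multiplied by a centred
        function and drops out; what remains is the covariance of the small sets \<open>SX\<close>
        and \<open>SY\<close>.\<close>
      have "(\<integral>u. X u * (Y u - m) \<partial>\<mu>)
        = (\<integral>u. (1/2) * (Y u - m) + (indicator (SX \<inter> SY) u - measure \<mu> SY * indicator SX u) \<partial>\<mu>)"
        by (rule Bochner_Integration.integral_cong)
           (auto simp: X' Y' mSY indicator_def algebra_simps)
      also have "\<dots> = (1/2) * (\<integral>u. Y u - m \<partial>\<mu>) + (measure \<mu> (SX \<inter> SY) - measure \<mu> SY * measure \<mu> SX)"
        using iY ind mS by simp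
      finally have eq: "(\<integral>u. X u * (Y u - m) \<partial>\<mu>) = measure \<mu> (SX \<inter> SY) - measure \<mu> SX * measure \<mu> SY"
        using Y0 by simp
      have SXe: "SX \<subseteq> {u. 1 - \<epsilon> < nrm (a - u)}" and SYe: "SY \<subseteq> {u. 1 - \<epsilon> < nrm (b - u)}"
        using k th unfolding SX_def SY_def by (auto intro: th)
      have "measure \<mu> SX \<le> measure \<mu> {u. 1 - \<epsilon> < nrm (a - u)}" using SXe by (intro circ.finite_measure_mono) auto
      also have "\<dots> = \<epsilon>" using eps by (subst circle_nrm_greater) auto
      finally have pX: "measure \<mu> SX \<le> \<epsilon>" .
      have "measure \<mu> SY \<le> measure \<mu> {u. 1 - \<epsilon> < nrm (b - u)}" using SYe by (intro circ.finite_measure_mono) auto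
      also have "\<dots> = \<epsilon>" using eps by (subst circle_nrm_greater) auto
      finally have pY: "measure \<mu> SY \<le> \<epsilon>" .
      have "measure \<mu> (SX \<inter> SY) \<le> overlap \<epsilon> a b"
        unfolding overlap_def using SXe SYe by (intro circ.finite_measure_mono) auto
      moreover have "measure \<mu> SX * measure \<mu> SY \<le> \<epsilon>\<^sup>2"
        unfolding power2_eq_square using pX pY eps by (intro mult_mono) auto
      moreover have "0 \<le> measure \<mu> (SX \<inter> SY)" "0 \<le> measure \<mu> SX * measure \<mu> SY" by auto
      ultimately have "\<bar>\<integral>u. X u * (Y u - m) \<partial>\<mu>\<bar> \<le> overlap \<epsilon> a b + \<epsilon>\<^sup>2"
        unfolding eq using o0 by (smt (verit) zero_le_power2)
      also have "\<dots> \<le> ?R" using True by simp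
      finally show ?thesis unfolding m_def .
    qed
  qed
qed

section \<open>The correlation of two neighbourhoods\<close>

text \<open>\<open>T\<close> stands for the \<open>q\<close>-th power of the distance threshold.
  Subtracting 1/2 centres the indicator once \<open>T\<close> comes from the median
  distance.\<close>

definition sg :: "real \<Rightarrow> nat \<Rightarrow> real \<Rightarrow> (nat \<Rightarrow> real) \<Rightarrow> (nat \<Rightarrow> real) \<Rightarrow> real" where
  "sg q d T x w = indicator {..T} (ssum q {..<d} x w) - 1/2"

definition gam :: "real \<Rightarrow> nat \<Rightarrow> real \<Rightarrow> (nat \<Rightarrow> real) \<Rightarrow> (nat \<Rightarrow> real) \<Rightarrow> real" where
  "gam q d T x y = (\<integral>w. sg q d T x w * sg q d T y w \<partial>circ.P {..<d})"

lemma sg_bound: "\<bar>sg q d T x w\<bar> \<le> 1/2"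
  by (simp add: sg_def indicator_def)

lemma sg_prod_bound: "\<bar>sg q d T x w * sg q d T y v\<bar> \<le> 1/4"
  using mult_mono[OF sg_bound[of q d T x w] sg_bound[of q d T y v]] by (simp add: abs_mult)

lemma sg_measurable [measurable]: "sg q d T x \<in> borel_measurable (circ.P {..<d})"
  unfolding sg_def[abs_def] using ssum_measurable[of "{..<d}" "{..<d}" q x] by measurable

lemma sg_measurable_pair:
  "(\<lambda>(y, w). sg q d T y w) \<in> borel_measurable (circ.P {..<d} \<Otimes>\<^sub>M circ.P {..<d})"
  unfolding sg_def[abs_def] split_beta using ssum_measurable_pair[of q "{..<d}"] by measurable

lemma sg_commute: "sg q d T x w = sg q d T w x"
  by (simp add: sg_def ssum_def phi_def nrm_minus_commute)

lemma gam_measurable: "gam q d T x \<in> borel_measurable (circ.P {..<d})"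
proof -
  interpret PI: prob_space "circ.P {..<d}" by (rule circ.prob_space_P)
  have "(\<lambda>(y, w). sg q d T x w * sg q d T y w) \<in> borel_measurable (circ.P {..<d} \<Otimes>\<^sub>M circ.P {..<d})"
    using sg_measurable_pair[of q d T] by (simp add: split_beta')
  then show ?thesis unfolding gam_def[abs_def] by (intro PI.borel_measurable_lebesgue_integral) simp
qed

lemma gam_bound: "\<bar>gam q d T x y\<bar> \<le> 1/4"
proof -
  interpret PI: prob_space "circ.P {..<d}" by (rule circ.prob_space_P)
  show ?thesis unfolding gam_def
    by (rule PI.integral_abs_le) (measurable, rule sg_prod_bound)
qed

lemma gam_mean:
  assumes "\<And>w. w \<in> space (circ.P {..<d}) \<Longrightarrow> (\<integral>y. sg q d T y w \<partial>circ.P {..<d}) = 0"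
  shows "(\<integral>y. gam q d T x y \<partial>circ.P {..<d}) = 0"
proof -
  interpret PI: prob_space "circ.P {..<d}" by (rule circ.prob_space_P)
  interpret PP: pair_prob_space "circ.P {..<d}" "circ.P {..<d}" ..
  have m: "(\<lambda>(y, w). sg q d T x w * sg q d T y w) \<in> borel_measurable (circ.P {..<d} \<Otimes>\<^sub>M circ.P {..<d})"
    using sg_measurable_pair[of q d T] by (simp add: split_beta')
  have i: "integrable (circ.P {..<d} \<Otimes>\<^sub>M circ.P {..<d}) (\<lambda>(y, w). sg q d T x w * sg q d T y w)"
    by (rule PP.P.integrable_bounded[OF m, where B="1/4"]) (simp only: split_beta sg_prod_bound)
  have "(\<integral>y. gam q d T x y \<partial>circ.P {..<d}) = (\<integral>w. (\<integral>y. sg q d T x w * sg q d T y w \<partial>circ.P {..<d}) \<partial>circ.P {..<d})"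
    unfolding gam_def using PP.Fubini_integral[OF i] by simp
  also have "\<dots> = (\<integral>w. 0 \<partial>circ.P {..<d})"
    by (rule Bochner_Integration.integral_cong) (auto simp: assms)
  finally show ?thesis by simp
qed

lemma overlap_le: "0 \<le> \<epsilon> \<Longrightarrow> \<epsilon> \<le> 1 \<Longrightarrow> overlap \<epsilon> a b \<le> \<epsilon>"
proof -
  assume e: "0 \<le> \<epsilon>" "\<epsilon> \<le> 1"
  have "overlap \<epsilon> a b \<le> measure \<mu> {u. 1 - \<epsilon> < nrm (a - u)}"
    unfolding overlap_def by (intro circ.finite_measure_mono) auto
  also have "\<dots> = \<epsilon>" using e by (subst circle_nrm_greater) auto
  finally show ?thesis .
qed

text \<open>For fixed \<open>u\<close> the condition on a uniform \<open>b\<close> has probability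
  \<open>\<epsilon>\<close>, whether or not the condition on \<open>a\<close> holds; so on average
  over \<open>b\<close> the two arcs behave like independent events.\<close>

lemma overlap_integral:
  shows "overlap \<epsilon> a \<in> borel_measurable \<mu>"
    and "0 \<le> \<epsilon> \<Longrightarrow> \<epsilon> \<le> 1 \<Longrightarrow> (\<integral>b. overlap \<epsilon> a b \<partial>\<mu>) = \<epsilon>\<^sup>2"
proof -
  interpret MM: pair_prob_space \<mu> \<mu> ..
  define f where "f b u = (indicator {1 - \<epsilon><..} (nrm (a - u)) * indicator {1 - \<epsilon><..} (nrm (b - u)) :: real)" for b u
  have mf: "(\<lambda>(b, u). f b u) \<in> borel_measurable (\<mu> \<Otimes>\<^sub>M \<mu>)"
    unfolding f_def split_beta by measurable
  have o: "overlap \<epsilon> a b = (\<integral>u. f b u \<partial>\<mu>)" for b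
  proof -
    have "(\<integral>u. f b u \<partial>\<mu>) = (\<integral>u. indicator {u. 1 - \<epsilon> < nrm (a - u) \<and> 1 - \<epsilon> < nrm (b - u)} u \<partial>\<mu>)"
      by (rule Bochner_Integration.integral_cong) (auto simp: f_def indicator_def)
    then show ?thesis by (simp add: overlap_def)
  qed
  show "overlap \<epsilon> a \<in> borel_measurable \<mu>"
    unfolding o[abs_def] using mf by (intro circ.borel_measurable_lebesgue_integral) simp
  assume e: "0 \<le> \<epsilon>" "\<epsilon> \<le> 1"
  have i: "integrable (\<mu> \<Otimes>\<^sub>M \<mu>) (\<lambda>(b, u). f b u)"
    by (rule MM.P.integrable_bounded[OF mf, where B=1]) (auto simp: f_def indicator_def)
  have g: "(\<integral>b. indicator {1 - \<epsilon><..} (nrm (c - b)) \<partial>\<mu>) = \<epsilon>" for c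
  proof -
    have "(\<integral>b. indicator {1 - \<epsilon><..} (nrm (c - b)) \<partial>\<mu>) = (\<integral>b. indicator {b. 1 - \<epsilon> < nrm (c - b)} b \<partial>\<mu> :: real)"
      by (rule Bochner_Integration.integral_cong) (auto simp: indicator_def)
    also have "\<dots> = \<epsilon>" using circle_nrm_greater[of "1 - \<epsilon>" c] e by simp
    finally show ?thesis .
  qed
  have "(\<integral>b. overlap \<epsilon> a b \<partial>\<mu>) = (\<integral>u. (\<integral>b. f b u \<partial>\<mu>) \<partial>\<mu>)"
    unfolding o using MM.Fubini_integral[OF i] by simp
  also have "\<dots> = (\<integral>u. indicator {1 - \<epsilon><..} (nrm (a - u)) * \<epsilon> \<partial>\<mu>)"
    by (rule Bochner_Integration.integral_cong)
       (simp_all add: f_def nrm_minus_commute[of _ u for u] g[unfolded nrm_minus_commute] g)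
  also have "\<dots> = \<epsilon>\<^sup>2" by (simp add: g power2_eq_square)
  finally show "(\<integral>b. overlap \<epsilon> a b \<partial>\<mu>) = \<epsilon>\<^sup>2" .
qed

text \<open>The overlap is at most \<open>\<epsilon>\<close> with mean \<open>\<epsilon>^2\<close>,
  so its second moment is at most \<open>\<epsilon>^3\<close>. This is the gain over the squared
  supremum \<open>\<epsilon>^2\<close>.\<close>

lemma increment_second_moment:
  assumes e: "0 \<le> \<epsilon>" "\<epsilon> \<le> 1" and p: "0 \<le> p"
  shows "(\<integral>b. (p * (overlap \<epsilon> a b + \<epsilon>\<^sup>2) + \<xi>)\<^sup>2 \<partial>\<mu>) \<le> 8 * p\<^sup>2 * \<epsilon>^3 + 2 * \<xi>\<^sup>2"
proof -
  have m[measurable]: "overlap \<epsilon> a \<in> borel_measurable \<mu>" by (rule overlap_integral)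
  have o: "0 \<le> overlap \<epsilon> a b" "overlap \<epsilon> a b \<le> \<epsilon>" for b
    using overlap_le[OF e] by (auto simp: overlap_def)
  have io: "integrable \<mu> (overlap \<epsilon> a)"
    by (rule circ.integrable_bounded[where B=1]) (use o e in \<open>auto intro: order_trans\<close>)
  have pt: "(p * (overlap \<epsilon> a b + \<epsilon>\<^sup>2) + \<xi>)\<^sup>2 \<le> 4 * p\<^sup>2 * \<epsilon> * overlap \<epsilon> a b + (4 * p\<^sup>2 * \<epsilon>^3 + 2 * \<xi>\<^sup>2)" for b
  proof -
    have sq: "(s + t)\<^sup>2 \<le> 2 * s\<^sup>2 + 2 * t\<^sup>2" for s t :: real
      using sum_squares_bound[of s t] by (simp add: power2_sum)
    have "(p * (overlap \<epsilon> a b + \<epsilon>\<^sup>2) + \<xi>)\<^sup>2 \<le> 2 * p\<^sup>2 * (overlap \<epsilon> a b + \<epsilon>\<^sup>2)\<^sup>2 + 2 * \<xi>\<^sup>2"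
      using sq[of "p * (overlap \<epsilon> a b + \<epsilon>\<^sup>2)" \<xi>] by (simp add: power_mult_distrib)
    also have "2 * p\<^sup>2 * (overlap \<epsilon> a b + \<epsilon>\<^sup>2)\<^sup>2 \<le> 2 * p\<^sup>2 * (2 * (overlap \<epsilon> a b)\<^sup>2 + 2 * (\<epsilon>\<^sup>2)\<^sup>2)"
      by (intro mult_left_mono sq) auto
    also have "\<dots> \<le> 2 * p\<^sup>2 * (2 * (\<epsilon> * overlap \<epsilon> a b) + 2 * \<epsilon>^3)"
    proof (intro mult_left_mono add_mono)
      show "(overlap \<epsilon> a b)\<^sup>2 \<le> \<epsilon> * overlap \<epsilon> a b"
        unfolding power2_eq_square using o by (intro mult_right_mono) auto
      have "(\<epsilon>\<^sup>2)\<^sup>2 = \<epsilon>^4" by simp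
      also have "\<dots> \<le> \<epsilon>^3" using e by (intro power_decreasing) auto
      finally show "(\<epsilon>\<^sup>2)\<^sup>2 \<le> \<epsilon>^3" .
    qed auto
    finally show ?thesis by (simp add: algebra_simps)
  qed
  have "(\<integral>b. (p * (overlap \<epsilon> a b + \<epsilon>\<^sup>2) + \<xi>)\<^sup>2 \<partial>\<mu>) \<le> (\<integral>b. 4 * p\<^sup>2 * \<epsilon> * overlap \<epsilon> a b + (4 * p\<^sup>2 * \<epsilon>^3 + 2 * \<xi>\<^sup>2) \<partial>\<mu>)"
  proof (rule integral_mono[OF _ _ pt])
    show "integrable \<mu> (\<lambda>b. 4 * p\<^sup>2 * \<epsilon> * overlap \<epsilon> a b + (4 * p\<^sup>2 * \<epsilon>^3 + 2 * \<xi>\<^sup>2))" using io by simp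
    show "integrable \<mu> (\<lambda>b. (p * (overlap \<epsilon> a b + \<epsilon>\<^sup>2) + \<xi>)\<^sup>2)"
    proof (rule circ.integrable_bounded)
      show "\<bar>(p * (overlap \<epsilon> a b + \<epsilon>\<^sup>2) + \<xi>)\<^sup>2\<bar> \<le> 4 * p\<^sup>2 * \<epsilon> * \<epsilon> + (4 * p\<^sup>2 * \<epsilon>^3 + 2 * \<xi>\<^sup>2)" for b
        using pt[of b] o[of b] mult_left_mono[OF o(2)[of b], of "4 * p\<^sup>2 * \<epsilon>"] e by simp
    qed measurable
  qed
  also have "\<dots> = 4 * p\<^sup>2 * \<epsilon> * \<epsilon>\<^sup>2 + (4 * p\<^sup>2 * \<epsilon>^3 + 2 * \<xi>\<^sup>2)"
    using io overlap_integral(2)[OF e] circ.prob_space by simp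
  also have "\<dots> = 8 * p\<^sup>2 * \<epsilon>^3 + 2 * \<xi>\<^sup>2" by (simp add: power2_eq_square power3_eq_cube)
  finally show ?thesis .
qed

definition window_prob :: "real \<Rightarrow> nat \<Rightarrow> real \<Rightarrow> nat \<Rightarrow> (nat \<Rightarrow> real) \<Rightarrow> (nat \<Rightarrow> real) \<Rightarrow> real" where
  "window_prob q d T i x y = measure (circ.P {..<d}) {w \<in> space (circ.P {..<d}).
     ssum q ({..<d} - {i}) x w \<in> {T - 1<..T} \<and> ssum q ({..<d} - {i}) y w \<in> {T - 1<..T}}"

text \<open>With the coordinates of \<open>w\<close> other than \<open>i\<close> fixed, the integral
  of the increment over \<open>w i\<close> is a circle covariance with \<open>A\<close> and
  \<open>B\<close> the distances of the two partial sums below \<open>T\<close>. Integrating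
  \<open>circle_covariance_bound\<close> over the rest gives the window probability times the
  overlap term, plus two anticoncentration errors of \<open>2 * d^2 * \<eta>\<close>.\<close>

lemma gam_resample_bound:
  assumes q: "1 \<le> q" and i: "i < d" and T: "0 < T" and eta: "0 \<le> \<eta>" "\<eta> \<le> 1/2"
    and eps: "0 \<le> \<epsilon>" "\<epsilon> \<le> 1" and th: "\<And>t. \<eta> * T < phi q t \<Longrightarrow> 1 - \<epsilon> < nrm t"
  shows "\<bar>gam q d T x y - (\<integral>b. gam q d T x (y(i := b)) \<partial>\<mu>)\<bar>
     \<le> window_prob q d T i x y * (overlap \<epsilon> (x i) (y i) + \<epsilon>\<^sup>2) + 4 * (real d)\<^sup>2 * \<eta>"
proof -
  define I where "I = {..<d}"
  define L where "L = I - {i}"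
  have I: "finite I" "i \<in> I" "L \<subseteq> I" "finite L" using i by (auto simp: I_def L_def)
  interpret PI: prob_space "circ.P I" by (rule circ.prob_space_P)
  interpret MP: pair_prob_space \<mu> "circ.P I" ..
  have sL: "ssum q I z (w(i := u)) = phi q (z i - u) + ssum q L z w" for z w u
    unfolding L_def using I by (intro ssum_upd_right)
  have sL': "ssum q I (z(i := b)) w = phi q (b - w i) + ssum q L z w" for z w b
    unfolding L_def using I by (intro ssum_upd_left)
  note mL = ssum_measurable[OF I(3)]
  have mxw: "sg q d T z \<in> borel_measurable (circ.P I)" for z unfolding I_def by measurable
  have mby: "(\<lambda>(b, w). sg q d T (y(i := b)) w) \<in> borel_measurable (\<mu> \<Otimes>\<^sub>M circ.P I)"
  proof -
    have [measurable]: "(\<lambda>z. snd z i) \<in> borel_measurable (\<mu> \<Otimes>\<^sub>M circ.P I)"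
      by (rule measurable_compose[OF measurable_snd coord_measurable]) (use I in auto)
    have [measurable]: "(\<lambda>z. ssum q L y (snd z)) \<in> borel_measurable (\<mu> \<Otimes>\<^sub>M circ.P I)"
      by (rule measurable_compose[OF measurable_snd mL])
    show ?thesis unfolding sg_def I_def[symmetric] sL' split_beta by measurable
  qed
  define K where "K w = (\<integral>b. sg q d T (y(i := b)) w \<partial>\<mu>)" for w
  have mK: "K \<in> borel_measurable (circ.P I)"
    unfolding K_def using measurable_compose[OF measurable_pair_swap' mby]
    by (intro circ.borel_measurable_lebesgue_integral) (simp add: split_beta')
  have bK: "\<bar>K w\<bar> \<le> 1/2" if "w \<in> space (circ.P I)" for w
    unfolding K_def by (rule circ.integral_abs_le)
      (use that measurable_compose[OF measurable_Pair1'[OF that] measurable_compose[OF measurable_pair_swap' mby]] sg_bound in \<open>auto simp: split_beta'\<close>)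
  have "(\<integral>b. gam q d T x (y(i := b)) \<partial>\<mu>) = (\<integral>b. (\<integral>w. sg q d T x w * sg q d T (y(i := b)) w \<partial>circ.P I) \<partial>\<mu>)"
    unfolding gam_def I_def ..
  also have "\<dots> = (\<integral>w. (\<integral>b. sg q d T x w * sg q d T (y(i := b)) w \<partial>\<mu>) \<partial>circ.P I)"
  proof -
    have "(\<lambda>(b, w). sg q d T x w * sg q d T (y(i := b)) w) \<in> borel_measurable (\<mu> \<Otimes>\<^sub>M circ.P I)"
      using measurable_compose[OF measurable_snd mxw[of x], of \<mu>] mby by (simp add: split_beta')
    then have "integrable (\<mu> \<Otimes>\<^sub>M circ.P I) (\<lambda>(b, w). sg q d T x w * sg q d T (y(i := b)) w)"
      by (rule MP.P.integrable_bounded[where B="1/4"]) (simp only: split_beta sg_prod_bound)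
    from MP.Fubini_integral[OF this] show ?thesis by simp
  qed
  also have "\<dots> = (\<integral>w. sg q d T x w * K w \<partial>circ.P I)" by (simp add: K_def)
  finally have e1: "(\<integral>b. gam q d T x (y(i := b)) \<partial>\<mu>) = (\<integral>w. sg q d T x w * K w \<partial>circ.P I)" .
  have bxK: "\<bar>sg q d T x w * K w\<bar> \<le> 1/4" if "w \<in> space (circ.P I)" for w
    using mult_mono[OF sg_bound[of q d T x w] bK[OF that]] by (simp add: abs_mult)
  have mxK: "(\<lambda>w. sg q d T x w * K w) \<in> borel_measurable (circ.P I)"
    "(\<lambda>w. sg q d T x w * sg q d T y w) \<in> borel_measurable (circ.P I)"
    using mxw mK by (auto intro!: borel_measurable_times)
  define f where "f w = sg q d T x w * (sg q d T y w - K w)" for w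
  have mf: "f \<in> borel_measurable (circ.P I)" unfolding f_def using mxw mK by (auto intro!: borel_measurable_times borel_measurable_diff)
  have bf: "\<bar>f w\<bar> \<le> 1" if "w \<in> space (circ.P I)" for w
    using bxK[OF that] sg_prod_bound[of q d T x w y w] unfolding f_def by (simp add: algebra_simps)
  have "gam q d T x y - (\<integral>b. gam q d T x (y(i := b)) \<partial>\<mu>) = (\<integral>w. f w \<partial>circ.P I)"
    unfolding e1 unfolding gam_def I_def[symmetric] f_def right_diff_distrib
    by (rule Bochner_Integration.integral_diff[symmetric])
       (rule PI.integrable_bounded[OF mxK(2)], rule sg_prod_bound, rule PI.integrable_bounded[OF mxK(1)], rule bxK)
  also have "\<dots> = (\<integral>w. (\<integral>u. f (w(i := u)) \<partial>\<mu>) \<partial>circ.P I)"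
    by (rule circ.integral_upd_eq[OF I(1,2) mf bf])
  finally have e2: "gam q d T x y - (\<integral>b. gam q d T x (y(i := b)) \<partial>\<mu>) = (\<integral>w. (\<integral>u. f (w(i := u)) \<partial>\<mu>) \<partial>circ.P I)" .
  \<comment> \<open>\<open>E2\<close> is the event that coordinate \<open>i\<close> can be pivotal
    for both points. On \<open>E3 z\<close> the partial sum is so close to \<open>T\<close> that
    even a small contribution is pivotal, and the near-antipodal description fails.\<close>
  define E2 where "E2 = {w \<in> space (circ.P I). ssum q L x w \<in> {T - 1<..T} \<and> ssum q L y w \<in> {T - 1<..T}}"
  define E3 where "E3 z = {w \<in> space (circ.P I). T - \<eta> * T < ssum q L z w \<and> ssum q L z w \<le> T}" for z
  have mE: "E2 \<in> sets (circ.P I)" "E3 z \<in> sets (circ.P I)" for z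
    unfolding E2_def E3_def using mL[of q x] mL[of q y] mL[of q z] by measurable
  define oe where "oe = overlap \<epsilon> (x i) (y i) + \<epsilon>\<^sup>2"
  define g where "g w = indicator E2 w * oe + indicator (E3 x) w + indicator (E3 y) w" for w
  have inner: "\<bar>\<integral>u. f (w(i := u)) \<partial>\<mu>\<bar> \<le> g w" if w: "w \<in> space (circ.P I)" for w
  proof -
    define A where "A = T - ssum q L x w"
    define B where "B = T - ssum q L y w"
    have a1: "sg q d T x (w(i := u)) = indicator {..A} (phi q (x i - u)) - 1/2" for u
      unfolding sg_def I_def[symmetric] sL A_def by (auto simp: indicator_def)
    have a2: "sg q d T y (w(i := u)) = indicator {..B} (phi q (y i - u)) - 1/2" for u
      unfolding sg_def I_def[symmetric] sL B_def by (auto simp: indicator_def)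
    have "ssum q L y (w(i := u)) = ssum q L y w" for u
      unfolding ssum_def by (rule sum.cong) (auto simp: L_def)
    then have "sg q d T (y(i := b)) (w(i := u)) = indicator {..B} (phi q (b - u)) - 1/2" for u b
      unfolding sg_def I_def[symmetric] sL' B_def by (auto simp: indicator_def)
    then have a3: "K (w(i := u)) = (\<integral>v. indicator {..B} (phi q (y i - v)) - 1/2 \<partial>\<mu>)" for u
      unfolding K_def by (simp only: indicator_phi_mean[of B q u "y i"])
    have "\<bar>\<integral>u. f (w(i := u)) \<partial>\<mu>\<bar> \<le> of_bool (0 \<le> A \<and> A < 1 \<and> 0 \<le> B \<and> B < 1) * (overlap \<epsilon> (x i) (y i) + \<epsilon>\<^sup>2)
      + of_bool (0 \<le> A \<and> A < \<eta> * T) + of_bool (0 \<le> B \<and> B < \<eta> * T)"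
      unfolding f_def a1 a2 a3 by (rule circle_covariance_bound[OF q eps th])
    also have "\<dots> = g w"
      unfolding g_def oe_def E2_def E3_def A_def B_def using w by (auto simp: indicator_def)
    finally show ?thesis .
  qed
  have ind: "integrable (circ.P I) (indicator S :: _ \<Rightarrow> real)" if "S \<in> sets (circ.P I)" for S
    by (rule PI.integrable_bounded[OF borel_measurable_indicator[OF that], where B=1]) (simp add: indicator_def)
  have "\<bar>\<integral>w. (\<integral>u. f (w(i := u)) \<partial>\<mu>) \<partial>circ.P I\<bar> \<le> (\<integral>w. \<bar>\<integral>u. f (w(i := u)) \<partial>\<mu>\<bar> \<partial>circ.P I)"
    by (rule integral_abs_bound)
  also have "\<dots> \<le> (\<integral>w. g w \<partial>circ.P I)"
  proof (rule integral_mono[OF _ _ inner])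
    have mff: "(\<lambda>w. \<integral>u. f (w(i := u)) \<partial>\<mu>) \<in> borel_measurable (circ.P I)"
      using measurable_compose[OF circ.measurable_upd_pair[OF I(2)] mf]
      by (intro circ.borel_measurable_lebesgue_integral) (simp add: split_beta')
    have "integrable (circ.P I) (\<lambda>w. \<integral>u. f (w(i := u)) \<partial>\<mu>)"
    proof (rule PI.integrable_bounded[OF mff])
      show "\<bar>\<integral>u. f (w(i := u)) \<partial>\<mu>\<bar> \<le> 1" if w: "w \<in> space (circ.P I)" for w
      proof (rule circ.integral_abs_le)
        show "(\<lambda>u. f (w(i := u))) \<in> borel_measurable \<mu>"
          by (rule measurable_compose[OF circ.measurable_upd_comp mf]) (use w I in auto)
        show "\<bar>f (w(i := u))\<bar> \<le> 1" for u by (rule bf[OF circ.space_upd[OF w _ I(2)]]) simp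
      qed
    qed
    then show "integrable (circ.P I) (\<lambda>w. \<bar>\<integral>u. f (w(i := u)) \<partial>\<mu>\<bar>)" by (rule integrable_abs)
    show "integrable (circ.P I) g"
      unfolding g_def by (intro Bochner_Integration.integrable_add integrable_mult_left ind mE)
  qed
  also have "\<dots> = measure (circ.P I) E2 * oe + measure (circ.P I) (E3 x) + measure (circ.P I) (E3 y)"
    unfolding g_def using ind[OF mE(1)] ind[OF mE(2)[of x]] ind[OF mE(2)[of y]] mE by simp
  also have "\<dots> \<le> measure (circ.P I) E2 * oe + 2 * (real d)\<^sup>2 * \<eta> + 2 * (real d)\<^sup>2 * \<eta>"
  proof -
    have "card L \<le> d" using card_mono[of I L] I by (simp add: I_def)
    then have "measure (circ.P I) (E3 z) \<le> 2 * (real d)\<^sup>2 * \<eta>" for z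
      unfolding E3_def by (intro ssum_anticoncentration[OF q I(1,3)]) (use i T eta in auto)
    from this[of x] this[of y] show ?thesis by linarith
  qed
  finally show ?thesis
    unfolding e2 window_prob_def I_def[symmetric] L_def[symmetric] E2_def[symmetric] oe_def[symmetric] by linarith
qed

section \<open>Exponential moments of the correlation\<close>

text \<open>The distances within 1/8 of 1/2 are those to which
  \<open>reflected_values_differ\<close> applies.\<close>

definition good_coords :: "(nat \<Rightarrow> real) \<Rightarrow> (nat \<Rightarrow> real) \<Rightarrow> nat set \<Rightarrow> nat set" where
  "good_coords x y J = {j\<in>J. 3/8 \<le> nrm (x j - y j) \<and> nrm (x j - y j) \<le> 5/8}"

lemma window_prob_bounds: "0 \<le> window_prob q d T i x y" "window_prob q d T i x y \<le> 1"
proof -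
  interpret PI: prob_space "circ.P {..<d}" by (rule circ.prob_space_P)
  show "0 \<le> window_prob q d T i x y" "window_prob q d T i x y \<le> 1" unfolding window_prob_def by auto
qed

text \<open>The good coordinates are split into two disjoint sets of equal size at least
  \<open>d/256\<close>, for which \<open>joint_small_ball\<close> gives
  \<open>1024 * 256 * q / d\<close>. The rounding in the halving is absorbed by
  \<open>128 <= d\<close>, and \<open>i \<notin> J\<close> keeps the good coordinates inside the
  partial sums.\<close>

lemma window_prob_good:
  assumes q: "1 \<le> q" and d: "128 \<le> d" and J: "J \<subseteq> {..<d}" "i \<notin> J"
    and g: "real d / 64 < real (card (good_coords x y J))"
  shows "window_prob q d T i x y \<le> 262144 * q / d"
proof -
  define G where "G = good_coords x y J"
  have fG: "finite G" "G \<subseteq> {..<d} - {i}" using J finite_subset[of J "{..<d}"] by (auto simp: G_def good_coords_def)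
  define n where "n = card G div 2"
  have n: "2 * n \<le> card G" "card G \<le> 2 * n + 1" unfolding n_def by presburger+
  then have N: "real d / 256 \<le> real n" using g d unfolding G_def[symmetric] by linarith
  obtain G1 where G1: "G1 \<subseteq> G" "card G1 = n" using obtain_subset_with_card_n[of n G] n by (metis le_add1 mult_2 order_trans)
  have "card (G - G1) = card G - n" using G1 fG by (simp add: card_Diff_subset finite_subset)
  then have "n \<le> card (G - G1)" using n by linarith
  then obtain G2 where G2: "G2 \<subseteq> G - G1" "card G2 = n" using obtain_subset_with_card_n by metis
  have "window_prob q d T i x y \<le> 1024 * q / (real d / 256)"
    unfolding window_prob_def
  proof (rule joint_small_ball[OF q, where ?G1.0=G1 and ?G2.0=G2])
    show "3/8 \<le> nrm (x j - y j) \<and> nrm (x j - y j) \<le> 5/8" if "j \<in> G1 \<union> G2" for j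
      using that G1 G2 by (auto simp: G_def good_coords_def)
  qed (use G1 G2 fG N d in auto)
  then show ?thesis by simp
qed

text \<open>A coordinate is good with probability at least \<open>5/8 - 3/8 = 1/4\<close>, so at
  least \<open>d/16\<close> good ones are expected in \<open>J\<close>, and \<open>d/64\<close> is a
  quarter of that.\<close>

lemma few_good_coords:
  assumes J: "J \<subseteq> {..<d}" "real d / 4 \<le> real (card J)" "finite I" "J \<subseteq> I"
  shows "measure (circ.P I) {y \<in> space (circ.P I). real (card (good_coords x y J)) \<le> real d / 64} \<le> exp (- real d / 64)"
    and "{y \<in> space (circ.P I). real (card (good_coords x y J)) \<le> real d / 64} \<in> sets (circ.P I)"
proof -
  interpret PI: prob_space "circ.P I" by (rule circ.prob_space_P)
  define B where "B j = {u. 3/8 \<le> nrm (x j - u) \<and> nrm (x j - u) \<le> 5/8}" for j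
  have gB: "good_coords x y J = {j\<in>J. y j \<in> B j}" for y by (simp add: good_coords_def B_def)
  have fJ: "finite J" using J finite_subset by auto
  have mB: "B j \<in> sets borel" for j unfolding B_def by measurable
  have meas: "{y \<in> space (circ.P I). real (card {j\<in>J. y j \<in> B j}) \<le> c} \<in> sets (circ.P I)" for c
  proof -
    have kc: "real (card {j\<in>J. y j \<in> B j}) = (\<Sum>j\<in>J. indicator (B j) (y j))" for y
      using fJ by (simp add: indicator_def sum.If_cases Int_def)
    have "(\<lambda>y. real (card {j\<in>J. y j \<in> B j})) \<in> borel_measurable (circ.P I)"
      unfolding kc using J mB
      by (intro borel_measurable_sum measurable_compose[OF coord_measurable borel_measurable_indicator]) auto
    then show ?thesis unfolding borel_measurable_iff_le by blast
  qed
  show "{y \<in> space (circ.P I). real (card (good_coords x y J)) \<le> real d / 64} \<in> sets (circ.P I)"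
    unfolding gB by (rule meas)
  have "measure (circ.P I) {y \<in> space (circ.P I). real (card (good_coords x y J)) \<le> real d / 64}
     \<le> measure (circ.P I) {y \<in> space (circ.P I). real (card {j\<in>J. y j \<in> B j}) \<le> real (card J) * (1/4) / 4}"
    unfolding gB by (rule PI.finite_measure_mono[OF _ meas]) (use J in auto)
  also have "\<dots> \<le> exp (- real (card J) * (1/4) / 4)"
  proof (rule circ.chernoff_count[OF J(3,4)])
    fix j
    have "1/4 = measure \<mu> {w. 3/8 < nrm (x j - w) \<and> nrm (x j - w) \<le> 5/8}" by (subst circle_nrm_interval) auto
    also have "\<dots> \<le> measure \<mu> (B j)" using mB by (intro circ.finite_measure_mono) (auto simp: B_def)
    finally show "B j \<in> sets \<mu> \<and> 1/4 \<le> measure \<mu> (B j)" using mB by simp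
  qed simp
  also have "\<dots> \<le> exp (- real d / 64)" using J by simp
  finally show "measure (circ.P I) {y \<in> space (circ.P I). real (card (good_coords x y J)) \<le> real d / 64} \<le> exp (- real d / 64)" .
qed

text \<open>
  The window probability is small only if many coordinates of \<open>y\<close> are good. To make this
  deterministic, split the coordinates into halves: for a typical second half, the increments in
  the first half are small for every first half; and after averaging over the first half, the
  increments in the second half are small because they are so for a typical first half.
\<close>

lemma gam_mgf_bound:
  assumes q: "1 \<le> q" and d: "128 \<le> d" and T: "0 < T" and eta: "0 \<le> \<eta>" "\<eta> \<le> 1/2"
    and eps: "0 \<le> \<epsilon>" "\<epsilon> \<le> 1" and th: "\<And>t. \<eta> * T < phi q t \<Longrightarrow> 1 - \<epsilon> < nrm t"
    and half: "\<And>w. w \<in> space (circ.P {..<d}) \<Longrightarrow> (\<integral>y. sg q d T y w \<partial>circ.P {..<d}) = 0"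
    and l: "0 \<le> l"
  defines "p \<equiv> min 1 (262208 * q / d)" and "\<xi> \<equiv> 4 * (real d)\<^sup>2 * \<eta>"
  assumes small: "l * (2 * p * \<epsilon> + \<xi>) \<le> 1"
  shows "(\<integral>y. exp (l * gam q d T x y) \<partial>circ.P {..<d})
    \<le> exp (d * (l\<^sup>2 * (8 * p\<^sup>2 * \<epsilon>^3 + 2 * \<xi>\<^sup>2))) + exp (l / 4) * exp (- real d / 64)"
proof -
  define H1 where "H1 = {..<d div 2}"
  define H2 where "H2 = {d div 2..<d}"
  define I where "I = {..<d}"
  define V where "V = 8 * p\<^sup>2 * \<epsilon>^3 + 2 * \<xi>\<^sup>2"
  have H: "I = H2 \<union> H1" "H2 \<inter> H1 = {}" "finite H1" "finite H2" "finite I" "H1 \<subseteq> {..<d}" "H2 \<subseteq> {..<d}"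
    by (auto simp: H1_def H2_def I_def)
  have cH: "real d / 4 \<le> real (card H1)" "real d / 4 \<le> real (card H2)" "card H1 + card H2 = d"
    using d by (auto simp: H1_def H2_def)
  interpret P1: prob_space "circ.P H1" by (rule circ.prob_space_P)
  interpret P2: prob_space "circ.P H2" by (rule circ.prob_space_P)
  interpret PI: prob_space "circ.P I" by (rule circ.prob_space_P)
  have p: "0 \<le> p" "p \<le> 1" using q by (auto simp: p_def)
  have xi: "0 \<le> \<xi>" using eta by (auto simp: \<xi>_def)
  have V: "0 \<le> V" using eps by (auto simp: V_def)
  define h where "h i u = p * (overlap \<epsilon> (x i) u + \<epsilon>\<^sup>2) + \<xi>" for i u
  have o: "0 \<le> overlap \<epsilon> a b" "overlap \<epsilon> a b \<le> \<epsilon>" for a b using overlap_le[OF eps] by (auto simp: overlap_def)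
  have mh: "h i \<in> borel_measurable \<mu>" for i
    unfolding h_def using overlap_integral(1)[of \<epsilon> "x i"] by measurable
  have bh: "0 \<le> h i u \<and> l * h i u \<le> 1" for i u
  proof -
    have e2: "\<epsilon>\<^sup>2 \<le> \<epsilon>" unfolding power2_eq_square using eps mult_left_mono[of \<epsilon> 1 \<epsilon>] by simp
    have "h i u \<le> p * (\<epsilon> + \<epsilon>) + \<xi>" unfolding h_def using o[of "x i" u] e2 p by (intro add_mono mult_left_mono) auto
    then have "l * h i u \<le> l * (2 * p * \<epsilon> + \<xi>)" using l by (intro mult_left_mono) (auto simp: algebra_simps)
    then show ?thesis using small p xi o[of "x i" u] by (auto simp: h_def)
  qed
  have Vh: "(\<integral>u. (h i u)\<^sup>2 \<partial>\<mu>) \<le> V" for i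
    unfolding h_def V_def by (rule increment_second_moment[OF eps p(1)])
  define m where "m y2 y1 = merge H2 H1 (y2, y1)" for y1 y2 :: "nat \<Rightarrow> real"
  have msp: "m y2 y1 \<in> space (circ.P I)" if "y2 \<in> space (circ.P H2)" "y1 \<in> space (circ.P H1)" for y1 y2
    using that H(1) unfolding m_def by (auto simp: space_PiM PiE_iff)
  have mm: "(\<lambda>(y2, y1). m y2 y1) \<in> circ.P H2 \<Otimes>\<^sub>M circ.P H1 \<rightarrow>\<^sub>M circ.P I"
    unfolding m_def H(1) split_beta prod.collapse by measurable
  have mupd1: "m y2 (y1(i := b)) = (m y2 y1)(i := b)" if "i \<in> H1" for i b y1 y2
    using that H(2) unfolding m_def by (auto simp: merge_def fun_eq_iff)
  have mupd2: "m (y2(i := b)) y1 = (m y2 y1)(i := b)" if "i \<in> H2" for i b y1 y2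
    using that H(2) unfolding m_def by (auto simp: merge_def fun_eq_iff)
  have mval: "i \<in> H1 \<Longrightarrow> m y2 y1 i = y1 i" "i \<in> H2 \<Longrightarrow> m y2 y1 i = y2 i" for i y1 y2
    using H(2) unfolding m_def by (auto simp: merge_def)
  let ?g = "gam q d T x"
  have mg: "?g \<in> borel_measurable (circ.P I)" unfolding I_def by (rule gam_measurable)
  have mgm: "(\<lambda>(y2, y1). ?g (m y2 y1)) \<in> borel_measurable (circ.P H2 \<Otimes>\<^sub>M circ.P H1)"
    using measurable_compose[OF mm mg] by (simp add: split_beta')
  have mgm1: "(\<lambda>y1. ?g (m y2 y1)) \<in> borel_measurable (circ.P H1)" if "y2 \<in> space (circ.P H2)" for y2
    using measurable_compose[OF measurable_Pair1'[OF that] mgm] by simp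
  have step: "\<bar>?g y - (\<integral>b. ?g (y(i := b)) \<partial>\<mu>)\<bar> \<le> window_prob q d T i x y * (overlap \<epsilon> (x i) (y i) + \<epsilon>\<^sup>2) + \<xi>"
    if "i < d" for i y
    unfolding \<xi>_def by (rule gam_resample_bound[OF q that T eta eps th])
  have oe: "0 \<le> overlap \<epsilon> a b + \<epsilon>\<^sup>2" for a b using o[of a b] by simp
  \<comment> \<open>The surplus \<open>262208 - 262144 = 64\<close> pays for the first halves with
    few good coordinates, whose probability is at most
    \<open>exp (- d/64) <= 64/d <= 64 * q / d\<close>.\<close>
  have good_p: "262144 * q / d \<le> 262208 * q / d" using q by (intro divide_right_mono) auto

  have typ1: "(\<integral>y1. exp (l * ?g (m y2 y1)) \<partial>circ.P H1) \<le> exp (l * (\<integral>y1. ?g (m y2 y1) \<partial>circ.P H1) + card H1 * (l\<^sup>2 * V))"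
    if y2: "y2 \<in> space (circ.P H2)" and ty: "real d / 64 < real (card (good_coords x y2 H2))" for y2
  proof (rule circ.mgf_bounded_differences[OF H(3) mgm1[OF y2] _ mh bh _ Vh l V])
    show "\<bar>?g (m y2 y1)\<bar> \<le> 1/4" for y1 by (rule gam_bound)
    fix i y1 assume i: "i \<in> H1" and y1: "y1 \<in> space (circ.P H1)"
    have id: "i < d" "i \<notin> H2" using i H by auto
    have "good_coords x (m y2 y1) H2 = good_coords x y2 H2"
      unfolding good_coords_def using mval(2) by auto
    then have "window_prob q d T i x (m y2 y1) \<le> 262144 * q / d"
      using ty id by (intro window_prob_good[OF q d H(7)]) auto
    then have wp: "window_prob q d T i x (m y2 y1) \<le> p"
      using window_prob_bounds(2)[of q d T i x "m y2 y1"] good_p by (simp add: p_def)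
    have "\<bar>?g (m y2 y1) - (\<integral>b. ?g (m y2 (y1(i := b))) \<partial>\<mu>)\<bar>
       \<le> window_prob q d T i x (m y2 y1) * (overlap \<epsilon> (x i) (y1 i) + \<epsilon>\<^sup>2) + \<xi>"
      using step[OF id(1), of "m y2 y1"] by (simp add: mupd1[OF i] mval(1)[OF i])
    also have "\<dots> \<le> h i (y1 i)" unfolding h_def using wp oe by (intro add_right_mono mult_right_mono) auto
    finally show "\<bar>?g (m y2 y1) - (\<integral>b. ?g (m y2 (y1(i := b))) \<partial>\<mu>)\<bar> \<le> h i (y1 i)" .
  qed

  define F where "F y2 = (\<integral>y1. ?g (m y2 y1) \<partial>circ.P H1)" for y2
  have mF: "F \<in> borel_measurable (circ.P H2)"
    unfolding F_def using mgm by (intro P1.borel_measurable_lebesgue_integral) simp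
  have bF: "\<bar>F y2\<bar> \<le> 1/4" if "y2 \<in> space (circ.P H2)" for y2
    unfolding F_def by (rule P1.integral_abs_le[OF mgm1[OF that]]) (rule gam_bound)
  \<comment> \<open>The threshold is a median, so \<open>gam\<close> is centred, and the linear term
    left over by the first half disappears after integrating the second.\<close>
  have F0: "(\<integral>y2. F y2 \<partial>circ.P H2) = 0"
  proof -
    have "(\<integral>y2. F y2 \<partial>circ.P H2) = (\<integral>y. ?g y \<partial>circ.P I)"
      unfolding F_def m_def H(1)
      by (rule circ.prod.product_integral_fold[symmetric, OF H(2,4,3)])
         (rule PI.integrable_bounded[OF mg gam_bound, unfolded H(1)])
    then show ?thesis using gam_mean[OF half] by (simp add: I_def)
  qed
  define At where "At = {y1 \<in> space (circ.P H1). real (card (good_coords x y1 H1)) \<le> real d / 64}"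
  have At: "At \<in> sets (circ.P H1)" "measure (circ.P H1) At \<le> exp (- real d / 64)"
    unfolding At_def using few_good_coords[OF H(6) cH(1) H(3) subset_refl] by auto
  have dF: "\<bar>F y2 - (\<integral>b. F (y2(i := b)) \<partial>\<mu>)\<bar> \<le> h i (y2 i)" if i: "i \<in> H2" and y2: "y2 \<in> space (circ.P H2)" for i y2
  proof -
    have id: "i < d" "i \<notin> H1" using i H by auto
    interpret MP: pair_prob_space \<mu> "circ.P H1" ..
    have mb: "(\<lambda>(b, y1). ?g (m (y2(i := b)) y1)) \<in> borel_measurable (\<mu> \<Otimes>\<^sub>M circ.P H1)"
    proof -
      have "(\<lambda>z. (y2(i := fst z), snd z)) \<in> \<mu> \<Otimes>\<^sub>M circ.P H1 \<rightarrow>\<^sub>M circ.P H2 \<Otimes>\<^sub>M circ.P H1"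
        using y2 i by (intro measurable_Pair circ.measurable_upd_comp) auto
      from measurable_compose[OF this mgm] show ?thesis by (simp add: split_beta')
    qed
    have ib: "integrable (\<mu> \<Otimes>\<^sub>M circ.P H1) (\<lambda>(b, y1). ?g (m (y2(i := b)) y1))"
      by (rule MP.P.integrable_bounded[OF mb]) (simp only: split_beta, rule gam_bound)
    define Q where "Q y1 = (\<integral>b. ?g (m (y2(i := b)) y1) \<partial>\<mu>)" for y1
    have mQ: "Q \<in> borel_measurable (circ.P H1)"
      unfolding Q_def using measurable_compose[OF measurable_pair_swap' mb]
      by (intro circ.borel_measurable_lebesgue_integral) (simp add: split_beta')
    have bQ: "\<bar>Q y1\<bar> \<le> 1/4" if "y1 \<in> space (circ.P H1)" for y1
    proof -
      have "(\<lambda>b. ?g (m (y2(i := b)) y1)) \<in> borel_measurable \<mu>"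
        using measurable_compose[OF measurable_Pair2'[OF that] mb] by simp
      then show ?thesis unfolding Q_def by (rule circ.integral_abs_le) (rule gam_bound)
    qed
    have "(\<integral>b. F (y2(i := b)) \<partial>\<mu>) = (\<integral>y1. Q y1 \<partial>circ.P H1)"
      unfolding F_def Q_def using MP.Fubini_integral[OF ib] by simp
    then have "F y2 - (\<integral>b. F (y2(i := b)) \<partial>\<mu>) = (\<integral>y1. ?g (m y2 y1) - Q y1 \<partial>circ.P H1)"
      unfolding F_def[of y2]
      using P1.integrable_bounded[OF mgm1[OF y2] gam_bound] P1.integrable_bounded[OF mQ bQ] by simp
    also have "\<bar>\<dots>\<bar> \<le> (\<integral>y1. \<bar>?g (m y2 y1) - Q y1\<bar> \<partial>circ.P H1)" by (rule integral_abs_bound)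
    also have "\<dots> \<le> h i (y2 i)"
    proof -
      have pt: "\<bar>?g (m y2 y1) - Q y1\<bar> \<le> window_prob q d T i x (m y2 y1) * (overlap \<epsilon> (x i) (y2 i) + \<epsilon>\<^sup>2) + \<xi>" for y1
        using step[OF id(1), of "m y2 y1"] unfolding Q_def by (simp add: mupd2[OF i] mval(2)[OF i])
      have mabs: "(\<lambda>y1. \<bar>?g (m y2 y1) - Q y1\<bar>) \<in> borel_measurable (circ.P H1)"
        using mgm1[OF y2] mQ by (intro borel_measurable_abs borel_measurable_diff)
      have iabs: "integrable (circ.P H1) (\<lambda>y1. \<bar>?g (m y2 y1) - Q y1\<bar>)"
        by (intro integrable_abs Bochner_Integration.integrable_diff P1.integrable_bounded[OF mgm1[OF y2] gam_bound] P1.integrable_bounded[OF mQ bQ])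
      show ?thesis
      \<comment> \<open>For \<open>q\<close> of order \<open>d\<close> or larger,
        \<open>p = 1\<close> and the trivial bound on the window probability suffices.\<close>
      proof (cases "1 \<le> 262208 * q / d")
        case True
        then have p1: "p = 1" by (simp add: p_def)
        have "\<bar>?g (m y2 y1) - Q y1\<bar> \<le> h i (y2 i)" for y1
          using pt[of y1] mult_right_mono[OF window_prob_bounds(2) oe, of q d T i x "m y2 y1" "x i" "y2 i"]
          unfolding h_def p1 by linarith
        then show ?thesis by (intro P1.integral_le_const_real[OF iabs])
      next
        case False
        then have p1: "p = 262208 * q / d" by (simp add: p_def)
        let ?c = "overlap \<epsilon> (x i) (y2 i) + \<epsilon>\<^sup>2"
        have c1: "0 \<le> ?c" by (rule oe)
        have wp: "window_prob q d T i x (m y2 y1) \<le> 262144 * q / d + indicator At y1" if "y1 \<in> space (circ.P H1)" for y1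
        proof (cases "y1 \<in> At")
          case True
          have "0 \<le> 262144 * q / d" using q by simp
          then show ?thesis using window_prob_bounds(2)[of q d T i x "m y2 y1"] True by simp
        next
          case False
          have "good_coords x (m y2 y1) H1 = good_coords x y1 H1"
            unfolding good_coords_def using mval(1) by auto
          then have "window_prob q d T i x (m y2 y1) \<le> 262144 * q / d"
            using False that id by (intro window_prob_good[OF q d H(6)]) (auto simp: At_def)
          then show ?thesis using False by simp
        qed
        have iAt: "integrable (circ.P H1) (indicator At :: _ \<Rightarrow> real)"
          by (rule P1.integrable_bounded[OF borel_measurable_indicator[OF At(1)], where B=1]) (simp add: indicator_def)
        have "(\<integral>y1. \<bar>?g (m y2 y1) - Q y1\<bar> \<partial>circ.P H1) \<le> (\<integral>y1. (262144 * q / d + indicator At y1) * ?c + \<xi> \<partial>circ.P H1)"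
        proof (rule integral_mono[OF iabs])
          show "integrable (circ.P H1) (\<lambda>y1. (262144 * q / d + indicator At y1) * ?c + \<xi>)" using iAt by auto
          show "\<bar>?g (m y2 y1) - Q y1\<bar> \<le> (262144 * q / d + indicator At y1) * ?c + \<xi>" if "y1 \<in> space (circ.P H1)" for y1
            using pt[of y1] mult_right_mono[OF wp[OF that] c1] by linarith
        qed
        also have "\<dots> = (262144 * q / d + measure (circ.P H1) At) * ?c + \<xi>"
          using iAt At(1) by (simp add: P1.prob_space)
        also have "\<dots> \<le> p * ?c + \<xi>"
        proof (intro add_right_mono mult_right_mono c1)
          have "exp (- real d / 64) \<le> 64 / d"
          proof -
            have "real d / 64 \<le> exp (real d / 64)" using exp_ge_add_one_self[of "real d / 64"] by linarith
            then have "1 / exp (real d / 64) \<le> 1 / (real d / 64)" using d by (intro divide_left_mono) auto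
            then show ?thesis by (simp add: exp_minus inverse_eq_divide)
          qed
          also have "\<dots> \<le> 64 * q / d" using q by (intro divide_right_mono) auto
          finally have "measure (circ.P H1) At \<le> 64 * q / d" using At(2) by linarith
          moreover have "262144 * q / d + 64 * q / d = 262208 * q / d" by (simp add: add_divide_distrib[symmetric])
          ultimately show "262144 * q / d + measure (circ.P H1) At \<le> p" unfolding p1 by linarith
        qed
        finally show ?thesis by (simp add: h_def)
      qed
    qed
    finally show ?thesis .
  qed
  have mgfF: "(\<integral>y2. exp (l * F y2) \<partial>circ.P H2) \<le> exp (card H2 * (l\<^sup>2 * V))"
    using circ.mgf_bounded_differences[OF H(4) mF bF mh bh dF Vh l V] F0 by simp

  define B where "B = {y2 \<in> space (circ.P H2). real (card (good_coords x y2 H2)) \<le> real d / 64}"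
  have B: "B \<in> sets (circ.P H2)" "measure (circ.P H2) B \<le> exp (- real d / 64)"
    unfolding B_def using few_good_coords[OF H(7) cH(2) H(4) subset_refl] by auto
  \<comment> \<open>On the exceptional second halves \<open>B\<close> only the trivial bound on
    \<open>gam\<close> is available; the resulting term \<open>exp (l/4) * exp (- d/64)\<close> is
    harmless once \<open>d\<close> is large compared with \<open>n\<close>.\<close>
  have expb: "\<bar>exp (l * ?g y)\<bar> \<le> exp (l / 4)" for y
    using mult_left_mono[of "?g y" "1/4" l] gam_bound[of q d T x y] l by auto
  have iB: "integrable (circ.P H2) (indicator B :: _ \<Rightarrow> real)"
    by (rule P2.integrable_bounded[OF borel_measurable_indicator[OF B(1)], where B=1]) (simp add: indicator_def)
  have mexp: "(\<lambda>y. exp (l * ?g y)) \<in> borel_measurable (circ.P I)" using mg by measurable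
  have iexpF: "integrable (circ.P H2) (\<lambda>y2. exp (l * F y2))"
  proof (rule P2.integrable_bounded)
    show "(\<lambda>y2. exp (l * F y2)) \<in> borel_measurable (circ.P H2)" using mF by measurable
    show "\<bar>exp (l * F y2)\<bar> \<le> exp (l / 4)" if "y2 \<in> space (circ.P H2)" for y2
      using mult_left_mono[of "F y2" "1/4" l] bF[OF that] l by auto
  qed
  have mexp1: "(\<lambda>y1. exp (l * ?g (m y2 y1))) \<in> borel_measurable (circ.P H1)" if "y2 \<in> space (circ.P H2)" for y2
    using mgm1[OF that] by measurable
  have bexp1: "\<bar>\<integral>y1. exp (l * ?g (m y2 y1)) \<partial>circ.P H1\<bar> \<le> exp (l / 4)" if "y2 \<in> space (circ.P H2)" for y2
    by (rule P1.integral_abs_le[OF mexp1[OF that] expb])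
  have "(\<integral>y. exp (l * ?g y) \<partial>circ.P I) = (\<integral>y2. (\<integral>y1. exp (l * ?g (m y2 y1)) \<partial>circ.P H1) \<partial>circ.P H2)"
    unfolding m_def H(1)
    by (rule circ.prod.product_integral_fold[OF H(2,4,3)])
       (rule PI.integrable_bounded[OF mexp expb, unfolded H(1)])
  also have "\<dots> \<le> (\<integral>y2. exp (card H1 * (l\<^sup>2 * V)) * exp (l * F y2) + exp (l / 4) * indicator B y2 \<partial>circ.P H2)"
  proof (rule integral_mono)
    have "(\<lambda>(y2, y1). exp (l * ?g (m y2 y1))) \<in> borel_measurable (circ.P H2 \<Otimes>\<^sub>M circ.P H1)"
      using mgm by (simp add: split_beta')
    then have "(\<lambda>y2. \<integral>y1. exp (l * ?g (m y2 y1)) \<partial>circ.P H1) \<in> borel_measurable (circ.P H2)"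
      by (intro P1.borel_measurable_lebesgue_integral) simp
    then show "integrable (circ.P H2) (\<lambda>y2. \<integral>y1. exp (l * ?g (m y2 y1)) \<partial>circ.P H1)"
      by (rule P2.integrable_bounded[OF _ bexp1])
    show "integrable (circ.P H2) (\<lambda>y2. exp (card H1 * (l\<^sup>2 * V)) * exp (l * F y2) + exp (l / 4) * indicator B y2)"
      by (intro Bochner_Integration.integrable_add integrable_mult_right iexpF iB)
    show "(\<integral>y1. exp (l * ?g (m y2 y1)) \<partial>circ.P H1) \<le> exp (card H1 * (l\<^sup>2 * V)) * exp (l * F y2) + exp (l / 4) * indicator B y2"
      if y2: "y2 \<in> space (circ.P H2)" for y2
    proof (cases "y2 \<in> B")
      case True
      have "(\<integral>y1. exp (l * ?g (m y2 y1)) \<partial>circ.P H1) \<le> exp (l / 4)" using bexp1[OF y2] by linarith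
      also have "\<dots> \<le> exp (card H1 * (l\<^sup>2 * V)) * exp (l * F y2) + exp (l / 4) * indicator B y2" using True by simp
      finally show ?thesis .
    next
      case False
      then have "(\<integral>y1. exp (l * ?g (m y2 y1)) \<partial>circ.P H1) \<le> exp (l * F y2 + card H1 * (l\<^sup>2 * V))"
        unfolding F_def using y2 by (intro typ1) (auto simp: B_def)
      then show ?thesis using False by (simp add: exp_add mult.commute)
    qed
  qed
  also have "\<dots> = exp (card H1 * (l\<^sup>2 * V)) * (\<integral>y2. exp (l * F y2) \<partial>circ.P H2) + exp (l / 4) * measure (circ.P H2) B"
    using iexpF iB B(1) by simp
  also have "\<dots> \<le> exp (card H1 * (l\<^sup>2 * V)) * exp (card H2 * (l\<^sup>2 * V)) + exp (l / 4) * exp (- real d / 64)"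
    by (intro add_mono mult_left_mono mgfF B(2)) auto
  also have "exp (card H1 * (l\<^sup>2 * V)) * exp (card H2 * (l\<^sup>2 * V)) = exp (d * (l\<^sup>2 * V))"
    unfolding exp_add[symmetric] cH(3)[symmetric] by (simp add: algebra_simps)
  finally show ?thesis unfolding I_def V_def .
qed

section \<open>Entropy of latent-variable graphs\<close>

text \<open>A form of Pinsker's inequality with a worse constant, obtained from the Hellinger distance.\<close>

lemma l1_distance_le_entropy:
  fixes p :: "'b \<Rightarrow> real"
  assumes S: "finite S" and p: "\<And>s. s \<in> S \<Longrightarrow> 0 \<le> p s" "sum p S = 1" and u: "0 < u" "real (card S) * u = 1"
  shows "(\<Sum>s\<in>S. \<bar>p s - u\<bar>)\<^sup>2 \<le> 4 * (\<Sum>s\<in>S. p s * ln (p s / u))"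
proof -
  \<comment> \<open>This is \<open>ln x >= 1 - 1/x\<close> at \<open>x = sqrt (p s / u)\<close>. The
    terms \<open>- p s + u\<close> cancel in the sum over \<open>S\<close>, since both weights have
    total mass 1.\<close>
  have pt: "(sqrt (p s) - sqrt u)\<^sup>2 \<le> p s * ln (p s / u) - p s + u" if s: "s \<in> S" for s
  proof (cases "p s = 0")
    case True then show ?thesis using u by simp
  next
    case False
    then have ps: "p s > 0" using p(1)[OF s] by simp
    define x where "x = sqrt (p s / u)"
    have x: "x > 0" "x\<^sup>2 = p s / u" using ps u by (auto simp: x_def)
    have "ln (1 / x) \<le> 1 / x - 1" using x by (intro ln_le_minus_one) auto
    then have l: "ln x \<ge> 1 - 1 / x" using x by (simp add: ln_div)
    have "ln (p s / u) = 2 * ln x" using x by (metis ln_realpow of_nat_numeral)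
    then have "p s * ln (p s / u) \<ge> p s * (2 * (1 - 1 / x))" using l ps by (intro mult_left_mono) auto
    moreover have "p s / x = sqrt (p s) * sqrt u"
    proof -
      have "x * sqrt u = sqrt (p s)" using u by (simp add: x_def real_sqrt_divide)
      then have "p s = (x * sqrt u) * sqrt (p s)" using ps by simp
      then have "p s / x = (x * sqrt u) * sqrt (p s) / x" by simp
      then show ?thesis using x by (simp add: mult.commute)
    qed
    moreover have "p s * (2 * (1 - 1 / x)) = 2 * p s - 2 * (p s / x)" by (simp add: algebra_simps)
    moreover have "(sqrt (p s) - sqrt u)\<^sup>2 = p s + u - 2 * (sqrt (p s) * sqrt u)"
      using ps u by (simp add: power2_diff)
    ultimately show ?thesis by linarith
  qed
  \<comment> \<open>Factoring the difference prepares Cauchy-Schwarz; the second factor has square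
    sum at most 4.\<close>
  have "(\<Sum>s\<in>S. \<bar>p s - u\<bar>) = (\<Sum>s\<in>S. \<bar>sqrt (p s) - sqrt u\<bar> * (sqrt (p s) + sqrt u))"
  proof (rule sum.cong[OF refl])
    fix s assume s: "s \<in> S"
    have "p s - u = (sqrt (p s) - sqrt u) * (sqrt (p s) + sqrt u)"
      using p(1)[OF s] u by (simp add: algebra_simps)
    then show "\<bar>p s - u\<bar> = \<bar>sqrt (p s) - sqrt u\<bar> * (sqrt (p s) + sqrt u)"
      using p(1)[OF s] u by (simp add: abs_mult)
  qed
  also have "\<dots>\<^sup>2 \<le> (\<Sum>s\<in>S. \<bar>sqrt (p s) - sqrt u\<bar>\<^sup>2) * (\<Sum>s\<in>S. (sqrt (p s) + sqrt u)\<^sup>2)"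
    by (rule Cauchy_Schwarz_ineq_sum)
  also have "\<dots> \<le> (\<Sum>s\<in>S. p s * ln (p s / u)) * 4"
  proof (rule mult_mono)
    have "(\<Sum>s\<in>S. \<bar>sqrt (p s) - sqrt u\<bar>\<^sup>2) \<le> (\<Sum>s\<in>S. p s * ln (p s / u) - p s + u)"
      using pt by (intro sum_mono) auto
    also have "\<dots> = (\<Sum>s\<in>S. p s * ln (p s / u))"
      using p(2) u(2) by (simp add: sum.distrib sum_subtractf)
    finally show le: "(\<Sum>s\<in>S. \<bar>sqrt (p s) - sqrt u\<bar>\<^sup>2) \<le> (\<Sum>s\<in>S. p s * ln (p s / u))" .
    show "0 \<le> (\<Sum>s\<in>S. p s * ln (p s / u))" by (rule order_trans[OF _ le]) (simp add: sum_nonneg)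
    have "(\<Sum>s\<in>S. (sqrt (p s) + sqrt u)\<^sup>2) \<le> (\<Sum>s\<in>S. 2 * p s + 2 * u)"
    proof (rule sum_mono)
      fix s assume s: "s \<in> S"
      show "(sqrt (p s) + sqrt u)\<^sup>2 \<le> 2 * p s + 2 * u"
        using sum_squares_bound[of "sqrt (p s)" "sqrt u"] p(1)[OF s] u by (simp add: power2_sum)
    qed
    also have "\<dots> = 4" using p(2) u(2) by (simp add: sum.distrib sum_distrib_left[symmetric])
    finally show "(\<Sum>s\<in>S. (sqrt (p s) + sqrt u)\<^sup>2) \<le> 4" .
  qed (simp add: sum_nonneg)
  finally show ?thesis by simp
qed

text \<open>The chain rule splits \<open>ln (r * M0 * M1)\<close> into
  \<open>ln (p * M0) + ln (M1 * r / p)\<close>, and \<open>ln t <= t - 1\<close> turns the second,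
  conditional part into a chi-square term.\<close>

lemma entropy_refinement:
  fixes p :: "'b \<Rightarrow> real" and r :: "'b \<Rightarrow> 'c \<Rightarrow> real"
  assumes r: "\<And>G e. G \<in> A \<Longrightarrow> e \<in> B \<Longrightarrow> 0 \<le> r G e" and rs: "\<And>G. G \<in> A \<Longrightarrow> (\<Sum>e\<in>B. r G e) = p G"
    and B: "finite B" and M: "0 < M0" "0 < M1"
  shows "(\<Sum>G\<in>A. \<Sum>e\<in>B. r G e * ln (r G e * (M0 * M1)))
     \<le> (\<Sum>G\<in>A. p G * ln (p G * M0)) + (M1 * (\<Sum>G\<in>A. \<Sum>e\<in>B. (r G e)\<^sup>2 / p G) - (\<Sum>G\<in>A. p G))"
proof -
  have pt: "r G e * ln (r G e * (M0 * M1)) \<le> r G e * ln (p G * M0) + (M1 * ((r G e)\<^sup>2 / p G) - r G e)"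
    if G: "G \<in> A" and e: "e \<in> B" for G e
  proof (cases "r G e = 0")
    case False
    then have r0: "0 < r G e" using r[OF G e] by simp
    also have "r G e \<le> p G" unfolding rs[OF G, symmetric] using r[OF G] e B by (intro member_le_sum) auto
    finally have p0: "0 < p G" .
    have "r G e * (M0 * M1) = (p G * M0) * (M1 * r G e / p G)" using p0 by simp
    then have "ln (r G e * (M0 * M1)) = ln (p G * M0) + ln (M1 * r G e / p G)"
      using p0 r0 M by (simp add: ln_mult ln_div)
    also have "\<dots> \<le> ln (p G * M0) + (M1 * r G e / p G - 1)"
      using p0 r0 M by (intro add_left_mono ln_le_minus_one) auto
    finally have "r G e * ln (r G e * (M0 * M1)) \<le> r G e * (ln (p G * M0) + (M1 * r G e / p G - 1))"
      using r0 by (intro mult_left_mono) auto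
    then show ?thesis by (simp add: algebra_simps power2_eq_square)
  qed simp
  have "(\<Sum>G\<in>A. \<Sum>e\<in>B. r G e * ln (r G e * (M0 * M1)))
     \<le> (\<Sum>G\<in>A. \<Sum>e\<in>B. r G e * ln (p G * M0) + (M1 * ((r G e)\<^sup>2 / p G) - r G e))"
    by (intro sum_mono pt)
  also have "\<dots> = (\<Sum>G\<in>A. (\<Sum>e\<in>B. r G e) * ln (p G * M0)) + (M1 * (\<Sum>G\<in>A. \<Sum>e\<in>B. (r G e)\<^sup>2 / p G) - (\<Sum>G\<in>A. \<Sum>e\<in>B. r G e))"
    by (simp add: sum.distrib sum_subtractf sum_distrib_left sum_distrib_right)
  also have "\<dots> = (\<Sum>G\<in>A. p G * ln (p G * M0)) + (M1 * (\<Sum>G\<in>A. \<Sum>e\<in>B. (r G e)\<^sup>2 / p G) - (\<Sum>G\<in>A. p G))"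
    by (simp add: rs)
  finally show ?thesis .
qed

section \<open>Building a graph by adding one vertex and its row of edges\<close>

lemma vpairs_Suc: "vpairs (Suc n) = vpairs n \<union> (\<lambda>j. (j, n)) ` {..<n}"
  by (auto simp: vpairs_def less_Suc_eq)

lemma finite_vpairs: "finite (vpairs n)"
  by (induction n) (auto simp: vpairs_Suc vpairs_def[of 0])

lemma vpairs_disjoint: "vpairs n \<inter> (\<lambda>j. (j, n)) ` {..<n} = {}"
  by (auto simp: vpairs_def)

lemma card_vpairs_Suc: "card (vpairs (Suc n)) = card (vpairs n) + n"
  unfolding vpairs_Suc using finite_vpairs vpairs_disjoint
  by (subst card_Un_disjoint) (auto simp: card_image inj_on_def)

definition add_row :: "nat \<Rightarrow> (nat \<times> nat) set \<Rightarrow> nat set \<Rightarrow> (nat \<times> nat) set" where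
  "add_row n G e = G \<union> (\<lambda>j. (j, n)) ` e"

lemma sum_Pow_vpairs_Suc:
  "(\<Sum>G\<in>Pow (vpairs (Suc n)). f G) = (\<Sum>G\<in>Pow (vpairs n). \<Sum>e\<in>Pow {..<n}. (f (add_row n G e) :: real))"
proof -
  have inj: "inj_on (\<lambda>(G, e). add_row n G e) (Pow (vpairs n) \<times> Pow {..<n})"
  proof (rule inj_on_inverseI[where g="\<lambda>H. (H \<inter> vpairs n, {j. j < n \<and> (j, n) \<in> H})"])
    fix z assume "z \<in> Pow (vpairs n) \<times> Pow {..<n}"
    then show "(\<lambda>H. (H \<inter> vpairs n, {j. j < n \<and> (j, n) \<in> H})) (case z of (G, e) \<Rightarrow> add_row n G e) = z"
      by (auto simp: add_row_def vpairs_def)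
  qed
  have img: "(\<lambda>(G, e). add_row n G e) ` (Pow (vpairs n) \<times> Pow {..<n}) = Pow (vpairs (Suc n))"
  proof
    show "(\<lambda>(G, e). add_row n G e) ` (Pow (vpairs n) \<times> Pow {..<n}) \<subseteq> Pow (vpairs (Suc n))"
      by (auto simp: add_row_def vpairs_Suc)
    show "Pow (vpairs (Suc n)) \<subseteq> (\<lambda>(G, e). add_row n G e) ` (Pow (vpairs n) \<times> Pow {..<n})"
    proof
      fix H assume "H \<in> Pow (vpairs (Suc n))"
      then have "H = add_row n (H \<inter> vpairs n) {j. j < n \<and> (j, n) \<in> H}"
        by (auto simp: add_row_def vpairs_Suc)
      then show "H \<in> (\<lambda>(G, e). add_row n G e) ` (Pow (vpairs n) \<times> Pow {..<n})"
        by (intro image_eqI[where x="(H \<inter> vpairs n, {j. j < n \<and> (j, n) \<in> H})"]) auto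
    qed
  qed
  have "(\<Sum>G\<in>Pow (vpairs (Suc n)). f G) = (\<Sum>z\<in>Pow (vpairs n) \<times> Pow {..<n}. f (case z of (G, e) \<Rightarrow> add_row n G e))"
    unfolding img[symmetric] by (rule sum.reindex_cong[OF inj]) auto
  also have "\<dots> = (\<Sum>G\<in>Pow (vpairs n). \<Sum>e\<in>Pow {..<n}. f (add_row n G e))"
    by (simp add: sum.cartesian_product split_beta')
  finally show ?thesis .
qed

locale latent_graph = iid_product M for M :: "'a measure" +
  fixes E :: "'a \<Rightarrow> 'a \<Rightarrow> bool"
  assumes mE: "Measurable.pred (M \<Otimes>\<^sub>M M) (\<lambda>z. E (fst z) (snd z))"
begin

definition edges :: "nat \<Rightarrow> (nat \<Rightarrow> 'a) \<Rightarrow> (nat \<times> nat) set" where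
  "edges n X = {(i, j) \<in> vpairs n. E (X i) (X j)}"

definition row :: "nat \<Rightarrow> (nat \<Rightarrow> 'a) \<Rightarrow> 'a \<Rightarrow> nat set" where
  "row n X z = {j. j < n \<and> E (X j) z}"

definition gprob :: "nat \<Rightarrow> (nat \<times> nat) set \<Rightarrow> real" where
  "gprob n G = measure (P {..<n}) {X \<in> space (P {..<n}). edges n X = G}"

text \<open>The probability that a random point is adjacent to both or to neither of
  \<open>z\<close> and \<open>z'\<close>; for edge probability 1/2 it equals 1/2 plus twice the
  covariance of the two neighbourhoods.\<close>

definition agree :: "'a \<Rightarrow> 'a \<Rightarrow> real" where
  "agree z z' = (\<integral>x. of_bool (E x z = E x z') \<partial>M)"

definition edge_entropy :: "nat \<Rightarrow> real" where
  "edge_entropy n = (\<Sum>G\<in>Pow (vpairs n). gprob n G * ln (gprob n G * 2 ^ card (vpairs n)))"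

lemma pred_E_compose:
  assumes "f \<in> N \<rightarrow>\<^sub>M M" "g \<in> N \<rightarrow>\<^sub>M M"
  shows "Measurable.pred N (\<lambda>z. E (f z) (g z))"
  using measurable_compose[OF measurable_Pair[OF assms] mE] by simp

lemma edges_Suc: "edges (Suc n) (X(n := z)) = add_row n (edges n X) (row n X z)"
  by (auto simp: edges_def add_row_def row_def vpairs_def less_Suc_eq split: if_splits)

lemma edges_eq_iff: "G \<subseteq> vpairs n \<Longrightarrow> edges n X = G \<longleftrightarrow> (\<forall>p\<in>vpairs n. E (X (fst p)) (X (snd p)) \<longleftrightarrow> p \<in> G)"
  unfolding edges_def by (force simp: set_eq_iff)

lemma row_eq_iff: "e \<subseteq> {..<n} \<Longrightarrow> row n X z = e \<longleftrightarrow> (\<forall>j\<in>{..<n}. E (X j) z \<longleftrightarrow> j \<in> e)"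
  by (auto simp: row_def)

lemma pred_edges: "G \<subseteq> vpairs n \<Longrightarrow> Measurable.pred (P {..<n}) (\<lambda>X. edges n X = G)"
  unfolding edges_eq_iff
proof (rule pred_intros_finite)
  fix p assume "p \<in> vpairs n"
  then have "fst p < n" "snd p < n" by (auto simp: vpairs_def)
  then have "Measurable.pred (P {..<n}) (\<lambda>X. E (X (fst p)) (X (snd p)))"
    by (intro pred_E_compose) auto
  then show "Measurable.pred (P {..<n}) (\<lambda>X. E (X (fst p)) (X (snd p)) \<longleftrightarrow> p \<in> G)" by measurable
qed (rule finite_vpairs)

lemma pred_row: "e \<subseteq> {..<n} \<Longrightarrow> Measurable.pred (P {..<n} \<Otimes>\<^sub>M M) (\<lambda>y. row n (fst y) (snd y) = e)"
  unfolding row_eq_iff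
proof (rule pred_intros_finite)
  fix j assume j: "j \<in> {..<n}"
  have "Measurable.pred (P {..<n} \<Otimes>\<^sub>M M) (\<lambda>y. E (fst y j) (snd y))"
    by (intro pred_E_compose measurable_snd measurable_compose[OF measurable_fst measurable_component_singleton] j)
  then show "Measurable.pred (P {..<n} \<Otimes>\<^sub>M M) (\<lambda>y. E (fst y j) (snd y) \<longleftrightarrow> j \<in> e)" by measurable
qed simp

definition graph_ind :: "nat \<Rightarrow> (nat \<times> nat) set \<Rightarrow> (nat \<Rightarrow> 'a) \<Rightarrow> real" where
  "graph_ind n G X = of_bool (edges n X = G)"

definition row_prob :: "nat \<Rightarrow> nat set \<Rightarrow> (nat \<Rightarrow> 'a) \<Rightarrow> real" where
  "row_prob n e X = (\<integral>z. of_bool (row n X z = e) \<partial>M)"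

lemma graph_ind_measurable: "G \<subseteq> vpairs n \<Longrightarrow> graph_ind n G \<in> borel_measurable (P {..<n})"
  unfolding graph_ind_def[abs_def] using pred_edges[of G n] by measurable

lemma row_indicator_measurable:
  "e \<subseteq> {..<n} \<Longrightarrow> (\<lambda>(X, z). of_bool (row n X z = e) :: real) \<in> borel_measurable (P {..<n} \<Otimes>\<^sub>M M)"
  using pred_row[of e n] unfolding split_beta' by measurable

lemma row_prob_measurable: "e \<subseteq> {..<n} \<Longrightarrow> row_prob n e \<in> borel_measurable (P {..<n})"
  unfolding row_prob_def[abs_def] using row_indicator_measurable[of e n]
  by (intro borel_measurable_lebesgue_integral) simp

lemma row_measurable1:
  "e \<subseteq> {..<n} \<Longrightarrow> X \<in> space (P {..<n}) \<Longrightarrow> (\<lambda>z. of_bool (row n X z = e) :: real) \<in> borel_measurable M"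
  using measurable_compose[OF measurable_Pair1' row_indicator_measurable] by simp

lemma row_prob_bound: "e \<subseteq> {..<n} \<Longrightarrow> X \<in> space (P {..<n}) \<Longrightarrow> \<bar>row_prob n e X\<bar> \<le> 1"
  unfolding row_prob_def by (rule integral_abs_le[OF row_measurable1]) auto

lemma row_prob_nonneg: "0 \<le> row_prob n e X"
  unfolding row_prob_def by (intro integral_nonneg_AE) simp

lemma row_prob_sum: "X \<in> space (P {..<n}) \<Longrightarrow> (\<Sum>e\<in>Pow {..<n}. row_prob n e X) = 1"
proof -
  assume X: "X \<in> space (P {..<n})"
  have "(\<Sum>e\<in>Pow {..<n}. row_prob n e X) = (\<integral>z. (\<Sum>e\<in>Pow {..<n}. of_bool (row n X z = e)) \<partial>M)"
    unfolding row_prob_def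
    by (intro Bochner_Integration.integral_sum[symmetric] integrable_bounded[OF row_measurable1[OF _ X], where B=1]) auto
  also have "\<dots> = (\<integral>z. 1 \<partial>M)"
  proof (rule Bochner_Integration.integral_cong[OF refl])
    fix z
    have "row n X z \<in> Pow {..<n}" by (auto simp: row_def)
    then show "(\<Sum>e\<in>Pow {..<n}. of_bool (row n X z = e)) = (1::real)"
      by (simp add: of_bool_def sum.delta)
  qed
  finally show ?thesis by (simp add: prob_space)
qed

lemma graph_ind_sum: "(\<Sum>G\<in>Pow (vpairs n). graph_ind n G X) = 1"
proof -
  have "edges n X \<in> Pow (vpairs n)" by (auto simp: edges_def)
  then show ?thesis using finite_vpairs[of n] by (simp add: graph_ind_def of_bool_def sum.delta)
qed

lemma gprob_eq: "G \<subseteq> vpairs n \<Longrightarrow> gprob n G = (\<integral>X. graph_ind n G X \<partial>P {..<n})"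
proof -
  assume G: "G \<subseteq> vpairs n"
  have "(\<integral>X. graph_ind n G X \<partial>P {..<n}) = (\<integral>X. indicator {X \<in> space (P {..<n}). edges n X = G} X \<partial>P {..<n})"
    by (rule Bochner_Integration.integral_cong) (auto simp: graph_ind_def indicator_def)
  then show ?thesis using pred_edges[OF G] by (simp add: gprob_def pred_def)
qed

lemma gprob_Suc:
  assumes G: "G \<subseteq> vpairs n" and e: "e \<subseteq> {..<n}"
  shows "gprob (Suc n) (add_row n G e) = (\<integral>X. graph_ind n G X * row_prob n e X \<partial>P {..<n})"
proof -
  interpret PS: prob_space "P {..<Suc n}" by (rule prob_space_P)
  have sub: "add_row n G e \<subseteq> vpairs (Suc n)" using G e by (auto simp: add_row_def vpairs_Suc)
  have inj: "add_row n H f = add_row n G e \<longleftrightarrow> H = G \<and> f = e" if "H \<subseteq> vpairs n" "f \<subseteq> {..<n}" for H f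
  proof
    assume eq: "add_row n H f = add_row n G e"
    have "H = add_row n H f \<inter> vpairs n" "f = {j. j < n \<and> (j, n) \<in> add_row n H f}"
      using that by (auto simp: add_row_def vpairs_def)
    moreover have "G = add_row n G e \<inter> vpairs n" "e = {j. j < n \<and> (j, n) \<in> add_row n G e}"
      using G e by (auto simp: add_row_def vpairs_def)
    ultimately show "H = G \<and> f = e" using eq by metis
  qed simp
  have "gprob (Suc n) (add_row n G e) = (\<integral>X. graph_ind (Suc n) (add_row n G e) X \<partial>P (insert n {..<n}))"
    using gprob_eq[OF sub] by (simp add: lessThan_Suc)
  also have "\<dots> = (\<integral>X. (\<integral>z. graph_ind (Suc n) (add_row n G e) (X(n := z)) \<partial>M) \<partial>P {..<n})"
  proof (rule prod.product_integral_insert)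
    have "integrable (P {..<Suc n}) (graph_ind (Suc n) (add_row n G e))"
      by (rule PS.integrable_bounded[OF graph_ind_measurable[OF sub], where B=1]) (simp add: graph_ind_def)
    then show "integrable (P (insert n {..<n})) (graph_ind (Suc n) (add_row n G e))" by (simp add: lessThan_Suc)
  qed auto
  also have "\<dots> = (\<integral>X. graph_ind n G X * row_prob n e X \<partial>P {..<n})"
  proof (rule Bochner_Integration.integral_cong[OF refl])
    fix X
    have "graph_ind (Suc n) (add_row n G e) (X(n := z)) = graph_ind n G X * of_bool (row n X z = e)" for z
      unfolding graph_ind_def edges_Suc by (subst inj) (auto simp: edges_def row_def)
    then show "(\<integral>z. graph_ind (Suc n) (add_row n G e) (X(n := z)) \<partial>M) = graph_ind n G X * row_prob n e X" by (simp add: row_prob_def)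
  qed
  finally show ?thesis .
qed

lemma gprob_nonneg: "0 \<le> gprob n G" by (simp add: gprob_def)

lemma gprob_sum: "(\<Sum>G\<in>Pow (vpairs n). gprob n G) = 1"
proof -
  interpret PS: prob_space "P {..<n}" by (rule prob_space_P)
  have "(\<Sum>G\<in>Pow (vpairs n). gprob n G) = (\<Sum>G\<in>Pow (vpairs n). \<integral>X. graph_ind n G X \<partial>P {..<n})"
    by (rule sum.cong) (auto simp: gprob_eq)
  also have "\<dots> = (\<integral>X. (\<Sum>G\<in>Pow (vpairs n). graph_ind n G X) \<partial>P {..<n})"
    by (intro Bochner_Integration.integral_sum[symmetric] PS.integrable_bounded[OF graph_ind_measurable, where B=1])
       (auto simp: graph_ind_def)
  finally show ?thesis by (simp add: graph_ind_sum PS.prob_space)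
qed

lemma agree_measurable: "(\<lambda>(z, z'). agree z z') \<in> borel_measurable (M \<Otimes>\<^sub>M M)"
proof -
  have 1: "Measurable.pred ((M \<Otimes>\<^sub>M M) \<Otimes>\<^sub>M M) (\<lambda>y. E (snd y) (fst (fst y)))"
    and 2: "Measurable.pred ((M \<Otimes>\<^sub>M M) \<Otimes>\<^sub>M M) (\<lambda>y. E (snd y) (snd (fst y)))"
    by (intro pred_E_compose; measurable)+
  have "(\<lambda>(y, x). of_bool (E x (fst y) = E x (snd y)) :: real) \<in> borel_measurable ((M \<Otimes>\<^sub>M M) \<Otimes>\<^sub>M M)"
    using 1 2 unfolding split_beta' by measurable
  then show ?thesis unfolding agree_def[abs_def] split_beta'
    by (intro borel_measurable_lebesgue_integral) simp
qed

lemma agree_bounds: "z \<in> space M \<Longrightarrow> z' \<in> space M \<Longrightarrow> 0 \<le> agree z z' \<and> agree z z' \<le> 1"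
proof
  assume z: "z \<in> space M" "z' \<in> space M"
  show "0 \<le> agree z z'" unfolding agree_def by (intro integral_nonneg_AE) simp
  have "Measurable.pred M (\<lambda>x. E x z)" "Measurable.pred M (\<lambda>x. E x z')"
    by (intro pred_E_compose; use z in measurable)+
  then have "(\<lambda>x. of_bool (E x z = E x z') :: real) \<in> borel_measurable M" by measurable
  then have "\<bar>agree z z'\<bar> \<le> 1" unfolding agree_def by (rule integral_abs_le) auto
  then show "agree z z' \<le> 1" by linarith
qed

text \<open>Second-moment identity with two replicas: the sum of squares is the probability that two
  independent new points \<open>z\<close> and \<open>z'\<close> see the same row. Given
  \<open>z\<close> and \<open>z'\<close>, the \<open>n\<close> old points decide this independently,
  each with probability \<open>agree z z'\<close>.\<close>

lemma sum_row_prob_squares: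
  "(\<integral>X. (\<Sum>e\<in>Pow {..<n}. (row_prob n e X)\<^sup>2) \<partial>P {..<n}) = (\<integral>z. (\<integral>z'. agree z z' ^ n \<partial>M) \<partial>M)"
proof -
  interpret PS: prob_space "P {..<n}" by (rule prob_space_P)
  interpret MM: pair_prob_space M M ..
  interpret Q: pair_prob_space "P {..<n}" "M \<Otimes>\<^sub>M M"
    by (intro pair_prob_space.intro pair_sigma_finite.intro PS.sigma_finite_measure_axioms MM.P.sigma_finite_measure_axioms PS.prob_space_axioms MM.P.prob_space_axioms)
  define f where "f X y = (\<Prod>j<n. of_bool (E (X j) (fst y) = E (X j) (snd y)) :: real)" for X :: "nat \<Rightarrow> 'a" and y :: "'a \<times> 'a"
  have mf: "(\<lambda>(X, y). f X y) \<in> borel_measurable (P {..<n} \<Otimes>\<^sub>M (M \<Otimes>\<^sub>M M))"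
    unfolding f_def split_beta'
  proof (rule borel_measurable_prod)
    fix j assume j: "j \<in> {..<n}"
    have "Measurable.pred (P {..<n} \<Otimes>\<^sub>M (M \<Otimes>\<^sub>M M)) (\<lambda>y. E (fst y j) (fst (snd y)))"
      by (intro pred_E_compose measurable_compose[OF measurable_fst measurable_component_singleton[OF j]]) measurable
    moreover have "Measurable.pred (P {..<n} \<Otimes>\<^sub>M (M \<Otimes>\<^sub>M M)) (\<lambda>y. E (fst y j) (snd (snd y)))"
      by (intro pred_E_compose measurable_compose[OF measurable_fst measurable_component_singleton[OF j]]) measurable
    ultimately show "(\<lambda>y. of_bool (E (fst y j) (fst (snd y)) = E (fst y j) (snd (snd y))) :: real)
        \<in> borel_measurable (P {..<n} \<Otimes>\<^sub>M (M \<Otimes>\<^sub>M M))" by measurable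
  qed
  have bf: "\<bar>f X y\<bar> \<le> 1" for X y
    unfolding f_def abs_prod by (intro prod_le_1) auto
  have intf: "integrable (P {..<n} \<Otimes>\<^sub>M (M \<Otimes>\<^sub>M M)) (\<lambda>(X, y). f X y)"
    by (rule Q.P.integrable_bounded[OF mf, where B=1]) (simp only: split_beta bf)
  have f_rows: "f X y = (\<Sum>e\<in>Pow {..<n}. of_bool (row n X (fst y) = e) * of_bool (row n X (snd y) = e))" for X y
  proof -
    have "f X y = of_bool (row n X (fst y) = row n X (snd y))"
    proof (cases "row n X (fst y) = row n X (snd y)")
      case True
      then have "E (X j) (fst y) = E (X j) (snd y)" if "j < n" for j using that by (auto simp: row_def set_eq_iff)
      then show ?thesis using True by (simp add: f_def)
    next
      case False
      then obtain j where "j < n" "E (X j) (fst y) \<noteq> E (X j) (snd y)" by (auto simp: row_def)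
      then show ?thesis using False by (auto simp: f_def intro!: prod_zero)
    qed
    moreover have "row n X (fst y) \<in> Pow {..<n}" by (auto simp: row_def)
    then have "(\<Sum>e\<in>Pow {..<n}. of_bool (row n X (fst y) = e) * of_bool (row n X (snd y) = e)) = (of_bool (row n X (fst y) = row n X (snd y)) :: real)"
      by (subst sum.remove[of _ "row n X (fst y)"]) (auto intro!: sum.neutral)
    ultimately show ?thesis by simp
  qed
  have f1: "(\<integral>y. f X y \<partial>(M \<Otimes>\<^sub>M M)) = (\<Sum>e\<in>Pow {..<n}. (row_prob n e X)\<^sup>2)" if X: "X \<in> space (P {..<n})" for X
  proof -
    let ?i = "\<lambda>e z. of_bool (row n X z = e) :: real"
    have i2m: "(\<lambda>y. ?i e (fst y) * ?i e (snd y)) \<in> borel_measurable (M \<Otimes>\<^sub>M M)" if "e \<in> Pow {..<n}" for e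
    proof -
      have m: "?i e \<in> borel_measurable M" by (rule row_measurable1[OF _ X]) (use that in auto)
      show ?thesis
        by (intro borel_measurable_times measurable_compose[OF measurable_fst m] measurable_compose[OF measurable_snd m])
    qed
    have i2: "integrable (M \<Otimes>\<^sub>M M) (\<lambda>y. ?i e (fst y) * ?i e (snd y))" if "e \<in> Pow {..<n}" for e
      by (rule MM.P.integrable_bounded[OF i2m[OF that], where B=1]) auto
    have "(\<integral>y. f X y \<partial>(M \<Otimes>\<^sub>M M)) = (\<Sum>e\<in>Pow {..<n}. \<integral>y. ?i e (fst y) * ?i e (snd y) \<partial>(M \<Otimes>\<^sub>M M))"
      unfolding f_rows by (rule Bochner_Integration.integral_sum) (rule i2)
    also have "\<dots> = (\<Sum>e\<in>Pow {..<n}. (row_prob n e X)\<^sup>2)"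
    proof (rule sum.cong[OF refl])
      fix e assume e: "e \<in> Pow {..<n}"
      have "(\<integral>y. ?i e (fst y) * ?i e (snd y) \<partial>(M \<Otimes>\<^sub>M M)) = (\<integral>z. (\<integral>z'. ?i e z * ?i e z' \<partial>M) \<partial>M)"
        using MM.integral_fst'[OF i2[OF e]] by simp
      also have "\<dots> = (row_prob n e X)\<^sup>2" by (simp add: row_prob_def power2_eq_square)
      finally show "(\<integral>y. ?i e (fst y) * ?i e (snd y) \<partial>(M \<Otimes>\<^sub>M M)) = (row_prob n e X)\<^sup>2" .
    qed
    finally show ?thesis .
  qed
  have f2: "(\<integral>X. f X y \<partial>P {..<n}) = agree (fst y) (snd y) ^ n" if y: "y \<in> space (M \<Otimes>\<^sub>M M)" for y
  proof -
    have ys: "fst y \<in> space M" "snd y \<in> space M" using y by (auto simp: space_pair_measure)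
    have "Measurable.pred M (\<lambda>x. E x (fst y))" "Measurable.pred M (\<lambda>x. E x (snd y))"
      by (intro pred_E_compose; use ys in measurable)+
    then have m: "(\<lambda>x. of_bool (E x (fst y) = E x (snd y)) :: real) \<in> borel_measurable M" by measurable
    have "(\<integral>X. f X y \<partial>P {..<n}) = (\<Prod>j<n. \<integral>x. of_bool (E x (fst y) = E x (snd y)) \<partial>M)"
      unfolding f_def by (rule prod.product_integral_prod) (auto intro!: integrable_bounded[OF m, where B=1])
    then show ?thesis by (simp add: agree_def)
  qed
  have "(\<integral>X. (\<Sum>e\<in>Pow {..<n}. (row_prob n e X)\<^sup>2) \<partial>P {..<n}) = (\<integral>X. (\<integral>y. f X y \<partial>(M \<Otimes>\<^sub>M M)) \<partial>P {..<n})"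
    by (rule Bochner_Integration.integral_cong) (simp_all add: f1)
  also have "\<dots> = (\<integral>y. (\<integral>X. f X y \<partial>P {..<n}) \<partial>(M \<Otimes>\<^sub>M M))"
    using Q.Fubini_integral[OF intf] by simp
  also have "\<dots> = (\<integral>y. agree (fst y) (snd y) ^ n \<partial>(M \<Otimes>\<^sub>M M))"
    by (rule Bochner_Integration.integral_cong) (simp_all add: f2)
  also have "\<dots> = (\<integral>z. (\<integral>z'. agree z z' ^ n \<partial>M) \<partial>M)"
  proof -
    have "integrable (M \<Otimes>\<^sub>M M) (\<lambda>y. agree (fst y) (snd y) ^ n)"
    proof (rule MM.P.integrable_bounded[where B=1])
      show "(\<lambda>y. agree (fst y) (snd y) ^ n) \<in> borel_measurable (M \<Otimes>\<^sub>M M)"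
        using agree_measurable by (simp add: split_beta')
      show "\<bar>agree (fst y) (snd y) ^ n\<bar> \<le> 1" if "y \<in> space (M \<Otimes>\<^sub>M M)" for y
        using agree_bounds[of "fst y" "snd y"] that by (auto simp: space_pair_measure intro!: power_le_one)
    qed
    from MM.integral_fst'[OF this] show ?thesis by simp
  qed
  finally show ?thesis .
qed

lemma edge_entropy_Suc:
  "edge_entropy (Suc n) \<le> edge_entropy n + ((\<integral>z. (\<integral>z'. (2 * agree z z') ^ n \<partial>M) \<partial>M) - 1)"
proof -
  interpret PS: prob_space "P {..<n}" by (rule prob_space_P)
  define r where "r G e = gprob (Suc n) (add_row n G e)" for G e
  have iab: "integrable (P {..<n}) (\<lambda>X. graph_ind n G X * row_prob n e X ^ k)" if "G \<subseteq> vpairs n" "e \<subseteq> {..<n}" for G e k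
  proof (rule PS.integrable_bounded[where B=1])
    show "(\<lambda>X. graph_ind n G X * row_prob n e X ^ k) \<in> borel_measurable (P {..<n})"
      using graph_ind_measurable[OF that(1)] row_prob_measurable[OF that(2)] by measurable
    show "\<bar>graph_ind n G X * row_prob n e X ^ k\<bar> \<le> 1" if "X \<in> space (P {..<n})" for X
      using row_prob_bound[OF \<open>e \<subseteq> {..<n}\<close> that] row_prob_nonneg[of n e X] by (auto simp: graph_ind_def intro!: power_le_one)
  qed
  have ia: "integrable (P {..<n}) (graph_ind n G)" if "G \<subseteq> vpairs n" for G
    using iab[OF that, of "{}" 0] by simp
  have rsum: "(\<Sum>e\<in>Pow {..<n}. r G e) = gprob n G" if G: "G \<in> Pow (vpairs n)" for G
  proof -
    have "(\<Sum>e\<in>Pow {..<n}. r G e) = (\<Sum>e\<in>Pow {..<n}. \<integral>X. graph_ind n G X * row_prob n e X \<partial>P {..<n})"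
      using G by (intro sum.cong) (auto simp: r_def gprob_Suc)
    also have "\<dots> = (\<integral>X. (\<Sum>e\<in>Pow {..<n}. graph_ind n G X * row_prob n e X) \<partial>P {..<n})"
      by (rule Bochner_Integration.integral_sum[symmetric]) (use iab[of G _ 1] G in auto)
    also have "\<dots> = (\<integral>X. graph_ind n G X \<partial>P {..<n})"
      by (rule Bochner_Integration.integral_cong) (simp_all add: sum_distrib_left[symmetric] row_prob_sum)
    finally show ?thesis using G by (simp add: gprob_eq)
  qed
  \<comment> \<open>Entropy conditions on the graph, the replica identity on the latent points. By
    convexity of the square, the finer conditioning only increases the chi-square term.\<close>
  have cs: "(r G e)\<^sup>2 / gprob n G \<le> (\<integral>X. graph_ind n G X * (row_prob n e X)\<^sup>2 \<partial>P {..<n})" if G: "G \<subseteq> vpairs n" and e: "e \<subseteq> {..<n}" for G e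
  proof (cases "gprob n G = 0")
    case True
    then show ?thesis by (auto intro!: integral_nonneg_AE simp: graph_ind_def)
  next
    case False
    \<comment> \<open>The conditional mean of \<open>row_prob\<close> given the graph
      \<open>G\<close>; the inequality is nonnegativity of the conditional variance.\<close>
    define c where "c = r G e / gprob n G"
    have "0 \<le> (\<integral>X. graph_ind n G X * (row_prob n e X - c)\<^sup>2 \<partial>P {..<n})"
      by (intro integral_nonneg_AE) (auto simp: graph_ind_def)
    also have "\<dots> = (\<integral>X. graph_ind n G X * (row_prob n e X)\<^sup>2 - (2 * c) * (graph_ind n G X * row_prob n e X) + c\<^sup>2 * graph_ind n G X \<partial>P {..<n})"
      by (rule Bochner_Integration.integral_cong) (simp_all add: power2_diff algebra_simps)
    also have "\<dots> = (\<integral>X. graph_ind n G X * (row_prob n e X)\<^sup>2 \<partial>P {..<n}) - (2 * c) * r G e + c\<^sup>2 * gprob n G"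
      using iab[OF G e, of 2] iab[OF G e, of 1] ia[OF G] by (simp add: r_def gprob_Suc[OF G e] gprob_eq[OF G])
    also have "(2 * c) * r G e = 2 * ((r G e)\<^sup>2 / gprob n G)" by (simp add: c_def power2_eq_square)
    also have "c\<^sup>2 * gprob n G = (r G e)\<^sup>2 / gprob n G" using False by (simp add: c_def power2_eq_square)
    finally show ?thesis by linarith
  qed
  have "edge_entropy (Suc n) = (\<Sum>G\<in>Pow (vpairs n). \<Sum>e\<in>Pow {..<n}. r G e * ln (r G e * (2 ^ card (vpairs n) * 2 ^ n)))"
    unfolding edge_entropy_def sum_Pow_vpairs_Suc r_def by (simp add: card_vpairs_Suc power_add)
  also have "\<dots> \<le> (\<Sum>G\<in>Pow (vpairs n). gprob n G * ln (gprob n G * 2 ^ card (vpairs n)))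
     + (2 ^ n * (\<Sum>G\<in>Pow (vpairs n). \<Sum>e\<in>Pow {..<n}. (r G e)\<^sup>2 / gprob n G) - (\<Sum>G\<in>Pow (vpairs n). gprob n G))"
    by (rule entropy_refinement[OF _ rsum]) (auto simp: r_def gprob_nonneg)
  also have "\<dots> = edge_entropy n + (2 ^ n * (\<Sum>G\<in>Pow (vpairs n). \<Sum>e\<in>Pow {..<n}. (r G e)\<^sup>2 / gprob n G) - 1)"
    by (simp add: edge_entropy_def gprob_sum)
  also have "(\<Sum>G\<in>Pow (vpairs n). \<Sum>e\<in>Pow {..<n}. (r G e)\<^sup>2 / gprob n G)
      \<le> (\<Sum>G\<in>Pow (vpairs n). \<Sum>e\<in>Pow {..<n}. \<integral>X. graph_ind n G X * (row_prob n e X)\<^sup>2 \<partial>P {..<n})"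
    by (intro sum_mono cs) auto
  also have "\<dots> = (\<integral>X. (\<Sum>G\<in>Pow (vpairs n). \<Sum>e\<in>Pow {..<n}. graph_ind n G X * (row_prob n e X)\<^sup>2) \<partial>P {..<n})"
  proof -
    have "(\<Sum>e\<in>Pow {..<n}. \<integral>X. graph_ind n G X * (row_prob n e X)\<^sup>2 \<partial>P {..<n}) = (\<integral>X. (\<Sum>e\<in>Pow {..<n}. graph_ind n G X * (row_prob n e X)\<^sup>2) \<partial>P {..<n})"
      if "G \<in> Pow (vpairs n)" for G
      by (rule Bochner_Integration.integral_sum[symmetric]) (use that iab in auto)
    then have "(\<Sum>G\<in>Pow (vpairs n). \<Sum>e\<in>Pow {..<n}. \<integral>X. graph_ind n G X * (row_prob n e X)\<^sup>2 \<partial>P {..<n})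
      = (\<Sum>G\<in>Pow (vpairs n). \<integral>X. (\<Sum>e\<in>Pow {..<n}. graph_ind n G X * (row_prob n e X)\<^sup>2) \<partial>P {..<n})" by simp
    also have "\<dots> = (\<integral>X. (\<Sum>G\<in>Pow (vpairs n). \<Sum>e\<in>Pow {..<n}. graph_ind n G X * (row_prob n e X)\<^sup>2) \<partial>P {..<n})"
      by (rule Bochner_Integration.integral_sum[symmetric]) (intro Bochner_Integration.integrable_sum iab; auto)
    finally show ?thesis .
  qed
  also have "\<dots> = (\<integral>X. (\<Sum>e\<in>Pow {..<n}. (row_prob n e X)\<^sup>2) \<partial>P {..<n})"
  proof (rule Bochner_Integration.integral_cong[OF refl])
    fix X
    have "(\<Sum>G\<in>Pow (vpairs n). \<Sum>e\<in>Pow {..<n}. graph_ind n G X * (row_prob n e X)\<^sup>2)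
        = (\<Sum>G\<in>Pow (vpairs n). graph_ind n G X) * (\<Sum>e\<in>Pow {..<n}. (row_prob n e X)\<^sup>2)" by (simp only: sum_product)
    then show "(\<Sum>G\<in>Pow (vpairs n). \<Sum>e\<in>Pow {..<n}. graph_ind n G X * (row_prob n e X)\<^sup>2) = (\<Sum>e\<in>Pow {..<n}. (row_prob n e X)\<^sup>2)"
      by (simp add: graph_ind_sum)
  qed
  also have "\<dots> = (\<integral>z. (\<integral>z'. agree z z' ^ n \<partial>M) \<partial>M)" by (rule sum_row_prob_squares)
  finally have "edge_entropy (Suc n) \<le> edge_entropy n + (2 ^ n * (\<integral>z. (\<integral>z'. agree z z' ^ n \<partial>M) \<partial>M) - 1)" by simp
  then show ?thesis by (simp add: power_mult_distrib)
qed

lemma edge_entropy_bound: "edge_entropy n \<le> (\<Sum>k<n. (\<integral>z. (\<integral>z'. (2 * agree z z') ^ k \<partial>M) \<partial>M) - 1)"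
proof (induction n)
  case 0
  have "vpairs 0 = {}" by (auto simp: vpairs_def)
  then show ?case using gprob_sum[of 0] by (simp add: edge_entropy_def)
next
  case (Suc n)
  then show ?case using edge_entropy_Suc[of n] by simp
qed

text \<open>The factor 4 in \<open>l1_distance_le_entropy\<close> cancels against the square of the
  factor 1/2 in the total variation distance.\<close>

lemma total_variation_bound:
  "((1/2) * (\<Sum>G\<in>Pow (vpairs n). \<bar>gprob n G - (1/2) ^ card (vpairs n)\<bar>))\<^sup>2
    \<le> (\<Sum>k<n. (\<integral>z. (\<integral>z'. (2 * agree z z') ^ k \<partial>M) \<partial>M) - 1)"
proof -
  have "(\<Sum>G\<in>Pow (vpairs n). \<bar>gprob n G - (1/2) ^ card (vpairs n)\<bar>)\<^sup>2
     \<le> 4 * (\<Sum>G\<in>Pow (vpairs n). gprob n G * ln (gprob n G / (1/2) ^ card (vpairs n)))"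
    by (rule l1_distance_le_entropy)
       (auto simp: finite_vpairs gprob_nonneg gprob_sum card_Pow power_mult_distrib[symmetric])
  also have "\<dots> = 4 * edge_entropy n" by (simp add: edge_entropy_def power_one_over)
  finally show ?thesis using edge_entropy_bound[of n] by (simp add: power_mult_distrib power_divide)
qed

end

section \<open>The median threshold\<close>

lemma unif_torus_eq: "unif_torus d = circ.P {..<d}"
  by (simp add: unif_torus_def circle_unif_def)

lemma qdist_eq: "qdist q d x y = ssum q {..<d} x y powr (1/q)"
  by (simp add: qdist_def ssum_def phi_def circ_dist_nrm)

lemma ssum_nonneg: "0 \<le> ssum q L x w"
  by (simp add: ssum_def sum_nonneg)

lemma qdist_le_iff:
  assumes q: "1 \<le> q" and t: "0 \<le> t"
  shows "qdist q d x y \<le> t \<longleftrightarrow> ssum q {..<d} x y \<le> t powr q"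
proof
  assume "qdist q d x y \<le> t"
  then have "(ssum q {..<d} x y powr (1/q)) powr q \<le> t powr q"
    unfolding qdist_eq using q by (intro powr_mono2) auto
  then show "ssum q {..<d} x y \<le> t powr q" using q ssum_nonneg[of q "{..<d}" x y] by (simp add: powr_powr)
next
  assume "ssum q {..<d} x y \<le> t powr q"
  then have "ssum q {..<d} x y powr (1/q) \<le> (t powr q) powr (1/q)"
    using q ssum_nonneg by (intro powr_mono2) auto
  then show "qdist q d x y \<le> t" unfolding qdist_eq using q t by (simp add: powr_powr)
qed

text \<open>Homogeneity of the torus, through the coordinatewise reflection \<open>w\<close> to
  \<open>x - w\<close>. Hence conditioning on one endpoint leaves the edge probability at 1/2, which
  is what makes \<open>sg\<close> centred for every fixed point.\<close>

lemma ssum_law_invariant: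
  "measure (circ.P {..<d}) {w \<in> space (circ.P {..<d}). ssum q {..<d} x w \<le> t}
   = measure (circ.P {..<d}) {w \<in> space (circ.P {..<d}). ssum q {..<d} (\<lambda>_. 0) w \<le> t}"
proof -
  define R where "R = (\<lambda>w. \<lambda>j\<in>{..<d}. refl_circ (x j) (w j))"
  have mr: "refl_circ s \<in> \<mu> \<rightarrow>\<^sub>M \<mu>" for s using refl_circ_measurable by (simp cong: measurable_cong_sets)
  have mR: "R \<in> circ.P {..<d} \<rightarrow>\<^sub>M circ.P {..<d}"
    unfolding R_def using mr by (intro measurable_restrict measurable_compose[OF measurable_component_singleton]) auto
  have dR: "distr (circ.P {..<d}) (circ.P {..<d}) R = circ.P {..<d}"
    unfolding R_def by (rule circ.distr_coordinatewise) (auto simp: mr distr_refl_circ)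
  have m: "{w \<in> space (circ.P {..<d}). ssum q {..<d} (\<lambda>_. 0) w \<le> t} \<in> sets (circ.P {..<d})"
    using ssum_measurable[of "{..<d}" "{..<d}" q "\<lambda>_. 0"] by measurable
  have s: "ssum q {..<d} (\<lambda>_. 0) (R w) = ssum q {..<d} x w" for w
    unfolding ssum_def by (rule sum.cong) (auto simp: R_def phi_def nrm_refl_circ_0)
  have "measure (circ.P {..<d}) {w \<in> space (circ.P {..<d}). ssum q {..<d} (\<lambda>_. 0) w \<le> t}
     = measure (distr (circ.P {..<d}) (circ.P {..<d}) R) {w \<in> space (circ.P {..<d}). ssum q {..<d} (\<lambda>_. 0) w \<le> t}"
    by (simp add: dR)
  also have "\<dots> = measure (circ.P {..<d}) (R -` {w \<in> space (circ.P {..<d}). ssum q {..<d} (\<lambda>_. 0) w \<le> t} \<inter> space (circ.P {..<d}))"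
    by (rule measure_distr[OF mR m])
  also have "R -` {w \<in> space (circ.P {..<d}). ssum q {..<d} (\<lambda>_. 0) w \<le> t} \<inter> space (circ.P {..<d})
     = {w \<in> space (circ.P {..<d}). ssum q {..<d} x w \<le> t}"
    using measurable_space[OF mR] by (auto simp: s)
  finally show ?thesis by simp
qed

definition ssum_cdf :: "real \<Rightarrow> nat \<Rightarrow> real \<Rightarrow> real" where
  "ssum_cdf q d t = measure (circ.P {..<d}) {w \<in> space (circ.P {..<d}). ssum q {..<d} (\<lambda>_. 0) w \<le> t}"

lemma pair_ssum_law:
  "measure (unif_torus d \<Otimes>\<^sub>M unif_torus d)
     {p \<in> space (unif_torus d \<Otimes>\<^sub>M unif_torus d). ssum q {..<d} (fst p) (snd p) \<le> t} = ssum_cdf q d t"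
proof -
  interpret PI: prob_space "circ.P {..<d}" by (rule circ.prob_space_P)
  interpret PP: pair_prob_space "circ.P {..<d}" "circ.P {..<d}" ..
  define S where "S = {p \<in> space (circ.P {..<d} \<Otimes>\<^sub>M circ.P {..<d}). ssum q {..<d} (fst p) (snd p) \<le> t}"
  have mS: "S \<in> sets (circ.P {..<d} \<Otimes>\<^sub>M circ.P {..<d})"
    unfolding S_def using ssum_measurable_pair[of q "{..<d}"] by measurable
  have "measure (circ.P {..<d} \<Otimes>\<^sub>M circ.P {..<d}) S = (\<integral>p. indicator S p \<partial>(circ.P {..<d} \<Otimes>\<^sub>M circ.P {..<d}))"
    using mS by simp
  also have "\<dots> = (\<integral>x. (\<integral>w. indicator S (x, w) \<partial>circ.P {..<d}) \<partial>circ.P {..<d})"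
    by (rule PP.integral_fst'[symmetric], rule PP.P.integrable_bounded[OF borel_measurable_indicator[OF mS], where B=1])
       (simp add: indicator_def)
  also have "\<dots> = (\<integral>x. ssum_cdf q d t \<partial>circ.P {..<d})"
  proof (rule Bochner_Integration.integral_cong[OF refl])
    fix x assume x: "x \<in> space (circ.P {..<d})"
    have "(\<integral>w. indicator S (x, w) \<partial>circ.P {..<d}) = (\<integral>w. indicator {w \<in> space (circ.P {..<d}). ssum q {..<d} x w \<le> t} w \<partial>circ.P {..<d})"
      by (rule Bochner_Integration.integral_cong[OF refl]) (use x in \<open>auto simp: S_def indicator_def space_pair_measure\<close>)
    also have "\<dots> = measure (circ.P {..<d}) {w \<in> space (circ.P {..<d}). ssum q {..<d} x w \<le> t}"
      using ssum_measurable[of "{..<d}" "{..<d}" q x] by simp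
    also have "\<dots> = ssum_cdf q d t" unfolding ssum_cdf_def by (rule ssum_law_invariant)
    finally show "(\<integral>w. indicator S (x, w) \<partial>circ.P {..<d}) = ssum_cdf q d t" .
  qed
  finally show ?thesis unfolding S_def unif_torus_eq by (simp add: PI.prob_space)
qed

text \<open>\<open>tau_half\<close> is a \<open>SOME\<close> term, so a threshold with probability
  exactly 1/2 has to be exhibited. The intermediate value theorem gives it, provided the law has no
  atoms: at \<open>t > 0\<close> let \<open>\<eta>\<close> tend to 0 in
  \<open>ssum_anticoncentration\<close>, and at 0 a null coordinate would be forced.\<close>

lemma ssum_cdf_half_ex:
  assumes q: "1 \<le> q" and d: "1 \<le> d"
  shows "\<exists>t. ssum_cdf q d t = 1/2"
proof -
  interpret PI: prob_space "circ.P {..<d}" by (rule circ.prob_space_P)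
  define Z where "Z = (\<lambda>_::nat. 0::real)"
  have m: "ssum q {..<d} Z \<in> borel_measurable (circ.P {..<d})" by (rule ssum_measurable) simp
  define D where "D = distr (circ.P {..<d}) borel (ssum q {..<d} Z)"
  interpret D: real_distribution D unfolding D_def by (rule PI.real_distribution_distr) (use m in simp)
  have cdfD: "cdf D t = ssum_cdf q d t" for t
    unfolding cdf_def D_def ssum_cdf_def Z_def[symmetric] using m
    by (subst measure_distr) (auto intro!: arg_cong[where f="measure (circ.P {..<d})"])
  have atom: "measure D {t} = 0" for t
  proof -
    have e: "measure D {t} = measure (circ.P {..<d}) {w \<in> space (circ.P {..<d}). ssum q {..<d} Z w = t}"
      unfolding D_def using m by (subst measure_distr) (auto intro!: arg_cong[where f="measure (circ.P {..<d})"])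
    have mt: "{w \<in> space (circ.P {..<d}). ssum q {..<d} Z w = t} \<in> sets (circ.P {..<d})" using m by measurable
    consider "t < 0" | "t = 0" | "t > 0" by linarith
    then show ?thesis
    proof cases
      case 1
      then have "ssum q {..<d} Z w \<noteq> t" for w using ssum_nonneg[of q "{..<d}" Z w] by linarith
      then have "{w \<in> space (circ.P {..<d}). ssum q {..<d} Z w = t} = {}" by blast
      then show ?thesis unfolding e by (simp only: measure_empty)
    next
      case 2
      have "measure (circ.P {..<d}) {w \<in> space (circ.P {..<d}). ssum q {..<d} Z w = t}
         \<le> measure (circ.P {..<d}) {w \<in> space (circ.P {..<d}). w 0 \<in> {u. nrm (0 - u) \<le> 0}}"
      proof (rule PI.finite_measure_mono)
        show "{w \<in> space (circ.P {..<d}). w 0 \<in> {u. nrm (0 - u) \<le> 0}} \<in> sets (circ.P {..<d})"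
        proof -
          have [measurable]: "(\<lambda>w. w 0) \<in> borel_measurable (circ.P {..<d})"
            by (rule coord_measurable) (use d in auto)
          show ?thesis by measurable
        qed
        show "{w \<in> space (circ.P {..<d}). ssum q {..<d} Z w = t} \<subseteq> {w \<in> space (circ.P {..<d}). w 0 \<in> {u. nrm (0 - u) \<le> 0}}"
        proof clarify
          fix w assume w: "t = ssum q {..<d} Z w"
          have "phi q (Z 0 - w 0) \<le> ssum q {..<d} Z w"
            unfolding ssum_def using d by (intro member_le_sum[of 0]) auto
          then have "phi q (0 - w 0) = 0" using w 2 antisym[OF _ phi_nonneg[of q "0 - w 0"]] by (simp add: Z_def)
          then show "nrm (0 - w 0) \<le> 0" by (simp add: phi_def)
        qed
      qed
      also have "\<dots> = measure (distr (circ.P {..<d}) \<mu> (\<lambda>w. w 0)) {u. nrm (0 - u) \<le> 0}"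
        using d by (subst measure_distr) (auto intro!: arg_cong[where f="measure (circ.P {..<d})"])
      also have "distr (circ.P {..<d}) \<mu> (\<lambda>w. w 0) = \<mu>"
        using distr_PiM_component[of "{..<d}" "\<lambda>_. \<mu>" 0] d prob_space_circle by simp
      also have "measure \<mu> {u. nrm (0 - u) \<le> 0} = 0"
      proof -
        have "{u. nrm (0 - u) \<le> 0} = space \<mu> - {u. 0 < nrm (0 - u)}" by auto
        also have "measure \<mu> \<dots> = 1 - measure \<mu> {u. 0 < nrm (0 - u)}" by (rule circ.prob_compl) measurable
        finally show ?thesis using circle_nrm_greater[of 0 0] by linarith
      qed
      finally show ?thesis unfolding e by (simp add: measure_le_0_iff)
    next
      case 3
      have b: "measure D {t} \<le> 2 * (real d)\<^sup>2 * \<eta>" if "0 < \<eta>" "\<eta> \<le> 1/2" for \<eta>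
      proof -
        have "measure D {t} \<le> measure (circ.P {..<d}) {w \<in> space (circ.P {..<d}). t - \<eta> * t < ssum q {..<d} Z w \<and> ssum q {..<d} Z w \<le> t}"
          unfolding e using m 3 that by (intro PI.finite_measure_mono) auto
        also have "\<dots> \<le> 2 * (real d)\<^sup>2 * \<eta>"
          by (rule ssum_anticoncentration) (use q d 3 that in auto)
        finally show ?thesis .
      qed
      have "measure D {t} \<le> 0 + \<delta>" if "0 < \<delta>" for \<delta>
      proof -
        define \<eta> where "\<eta> = min (1/2) (\<delta> / (2 * (real d)\<^sup>2))"
        have "0 < \<eta>" "\<eta> \<le> 1/2" "\<eta> \<le> \<delta> / (2 * (real d)\<^sup>2)" using that d by (auto simp: \<eta>_def)
        then have "measure D {t} \<le> 2 * (real d)\<^sup>2 * (\<delta> / (2 * (real d)\<^sup>2))"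
          by (intro order_trans[OF b[of \<eta>]] mult_left_mono) auto
        also have "\<dots> = \<delta>" using d by simp
        finally show ?thesis by simp
      qed
      then have "measure D {t} \<le> 0" by (rule field_le_epsilon)
      then show ?thesis by (simp add: measure_le_0_iff)
    qed
  qed
  have cont: "continuous_on UNIV (cdf D)"
    using atom D.isCont_cdf by (auto intro!: continuous_at_imp_continuous_on)
  have "eventually (\<lambda>t. cdf D t < 1/2) at_bot"
    using D.cdf_lim_at_bot by (rule order_tendstoD) simp
  then obtain s where s: "cdf D s < 1/2" using eventually_happens by fastforce
  have "eventually (\<lambda>t. cdf D t > 1/2) at_top"
    using D.cdf_lim_at_top_prob by (rule order_tendstoD) simp
  then obtain r where r: "cdf D r > 1/2" using eventually_happens by fastforce
  have "s \<le> r" using D.cdf_nondecreasing[of r s] s r by (cases "s \<le> r") auto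
  then obtain t where "cdf D t = 1/2"
    using IVT'[of "cdf D" s "1/2" r] s r continuous_on_subset[OF cont] by auto
  then show ?thesis unfolding cdfD by blast
qed

text \<open>For the third claim: a distance at most \<open>\<tau>\<close> forces every coordinate
  distance to be at most \<open>min 1 \<tau>\<close>, so the median property gives
  \<open>1/2 <= (min 1 \<tau>)^d\<close>. This lower bound on \<open>\<tau>\<close> holds uniformly
  in \<open>q\<close>.\<close>

lemma tau_half_properties:
  assumes q: "1 \<le> q" and d: "1 \<le> d"
  defines "\<tau> \<equiv> tau_half q d"
  shows "0 < \<tau>" "ssum_cdf q d (\<tau> powr q) = 1/2" "- ln 2 / d \<le> ln (min 1 \<tau>)"
proof -
  interpret PI: prob_space "circ.P {..<d}" by (rule circ.prob_space_P)
  define S where "S s = {p \<in> space (unif_torus d \<Otimes>\<^sub>M unif_torus d). qdist q d (fst p) (snd p) \<le> s}" for s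
  have S: "measure (unif_torus d \<Otimes>\<^sub>M unif_torus d) (S s) = ssum_cdf q d (s powr q)" if "0 \<le> s" for s
    unfolding S_def qdist_le_iff[OF q that] by (rule pair_ssum_law)
  obtain t where t: "ssum_cdf q d t = 1/2" using ssum_cdf_half_ex[OF q d] by blast
  have "0 \<le> t"
  proof (rule ccontr)
    assume "\<not> 0 \<le> t"
    then have "\<not> ssum q {..<d} (\<lambda>_. 0) w \<le> t" for w using ssum_nonneg[of q "{..<d}" "\<lambda>_. 0" w] by linarith
    then have "{w \<in> space (circ.P {..<d}). ssum q {..<d} (\<lambda>_. 0) w \<le> t} = {}" by blast
    then show False using t unfolding ssum_cdf_def by (simp only: measure_empty)
  qed
  then have "(t powr (1/q)) powr q = t" using q by (simp add: powr_powr)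
  then have "measure (unif_torus d \<Otimes>\<^sub>M unif_torus d) (S (t powr (1/q))) = 1/2"
    using S[of "t powr (1/q)"] t by simp
  then have half: "measure (unif_torus d \<Otimes>\<^sub>M unif_torus d) (S \<tau>) = 1/2"
    unfolding \<tau>_def tau_half_def S_def by (rule someI)
  \<comment> \<open>The choice operator could a priori return a negative number, but then the event
    would be empty. Nonnegativity is required before the threshold can be raised to the power
    \<open>q\<close>.\<close>
  have t0: "0 \<le> \<tau>"
  proof (rule ccontr)
    assume "\<not> 0 \<le> \<tau>"
    moreover have "0 \<le> qdist q d x y" for x y by (simp add: qdist_eq)
    ultimately have "\<not> qdist q d x y \<le> \<tau>" for x y by (meson order_trans)
    then have "S \<tau> = {}" unfolding S_def by blast
    then show False using half by (simp only: measure_empty)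
  qed
  show c: "ssum_cdf q d (\<tau> powr q) = 1/2" using S[OF t0] half by simp
  define r where "r = min 1 \<tau>"
  have r: "0 \<le> r" "r \<le> 1" using t0 by (auto simp: r_def)
  define B where "B = {u. nrm (0 - u) \<le> r}"
  have mB: "B \<in> sets \<mu>" unfolding B_def by simp
  have pB: "emeasure \<mu> B = ennreal r"
  proof -
    have "B = space \<mu> - {u. r < nrm (0 - u)}" by (auto simp: B_def)
    then have "measure \<mu> B = 1 - measure \<mu> {u. r < nrm (0 - u)}" by (simp only:) (rule circ.prob_compl, measurable)
    then show ?thesis using circle_nrm_greater[OF r, of 0] by (simp add: circ.emeasure_eq_measure)
  qed
  have "1/2 \<le> measure (circ.P {..<d}) (Pi\<^sub>E {..<d} (\<lambda>_. B))"
    unfolding c[symmetric] ssum_cdf_def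
  proof (rule PI.finite_measure_mono)
    show "Pi\<^sub>E {..<d} (\<lambda>_. B) \<in> sets (circ.P {..<d})" using mB by (intro sets_PiM_I_finite) auto
    show "{w \<in> space (circ.P {..<d}). ssum q {..<d} (\<lambda>_. 0) w \<le> \<tau> powr q} \<subseteq> Pi\<^sub>E {..<d} (\<lambda>_. B)"
    proof
      fix w assume w: "w \<in> {w \<in> space (circ.P {..<d}). ssum q {..<d} (\<lambda>_. 0) w \<le> \<tau> powr q}"
      have "w j \<in> B" if "j < d" for j
      proof -
        have "phi q (0 - w j) \<le> ssum q {..<d} (\<lambda>_. 0) w"
          unfolding ssum_def using that by (intro member_le_sum[of j "{..<d}" "\<lambda>j. phi q (0 - w j)"]) auto
        then have "nrm (0 - w j) powr q \<le> \<tau> powr q" using w by (simp add: phi_def)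
        then have "nrm (0 - w j) \<le> \<tau>" using q t0 by (metis nrm_nonneg not_le powr_less_mono2 zero_less_one order_less_le_trans)
        then show ?thesis by (simp add: B_def r_def)
      qed
      then show "w \<in> Pi\<^sub>E {..<d} (\<lambda>_. B)" using w by (auto simp: space_PiM PiE_iff)
    qed
  qed
  also have "\<dots> = r ^ d"
  proof -
    have "emeasure (circ.P {..<d}) (Pi\<^sub>E {..<d} (\<lambda>_. B)) = (\<Prod>j<d. emeasure \<mu> B)"
      using mB by (intro circ.prod.emeasure_PiM) auto
    also have "\<dots> = ennreal (r ^ d)" using r by (simp add: pB ennreal_power)
    finally show ?thesis using r by (simp add: measure_def)
  qed
  finally have rd: "1/2 \<le> r ^ d" .
  then have "r \<noteq> 0" using d by (auto simp: power_0_left split: if_splits)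
  then have r0: "0 < r" using r by simp
  then show "0 < \<tau>" by (simp add: r_def split: if_splits)
  have "ln (1/2) \<le> ln (r ^ d)" using rd by (subst ln_le_cancel_iff) (auto simp: r0)
  then have "- ln 2 \<le> d * ln r" using r0 by (simp add: ln_div ln_realpow)
  then show "- ln 2 / d \<le> ln (min 1 \<tau>)" unfolding r_def[symmetric] using d by (simp add: field_simps)
qed

section \<open>Quantitative bounds\<close>

text \<open>
  Coordinates below this threshold are pivotal only with probability \<open>O(d\<^sup>2 / d^5)\<close>, by the
  anticoncentration of the sum at the relative scale \<open>1 / d^5\<close>.
\<close>

lemma threshold_nrm:
  assumes q: "1 \<le> q" and d: "2 \<le> d"
  defines "\<tau> \<equiv> tau_half q d"
  assumes t: "(1 / real d ^ 5) * \<tau> powr q < phi q t"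
  shows "1 - min 1 (5 * ln d / q + ln 2 / d) < nrm t"
proof -
  \<comment> \<open>Passing to \<open>r\<close> only lowers the threshold, and \<open>ln r\<close>
    is the quantity that the median property bounds below. Taking logarithms and dividing by
    \<open>q\<close> then gives the claim, with \<open>ln (nrm t) <= nrm t - 1\<close> at the
    end.\<close>
  define r where "r = min 1 \<tau>"
  have tau: "0 < \<tau>" "- ln 2 / d \<le> ln r"
    using tau_half_properties[OF q, of d] d by (auto simp: \<tau>_def r_def)
  have r: "0 < r" "r \<le> \<tau>" using tau(1) by (auto simp: r_def)
  have pos: "0 < (1 / real d ^ 5) * r powr q" using d r by simp
  have lt: "(1 / real d ^ 5) * r powr q < phi q t"
    using t mult_left_mono[OF powr_mono2[OF _ _ r(2), of q], of "1 / real d ^ 5"] r q by simp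
  have nt: "0 < nrm t"
  proof (rule ccontr)
    assume "\<not> 0 < nrm t"
    then have "nrm t = 0" using nrm_nonneg[of t] by linarith
    then show False using lt pos by (simp add: phi_def)
  qed
  have "ln ((1 / real d ^ 5) * r powr q) < ln (phi q t)" using lt pos by (subst ln_less_cancel_iff) auto
  moreover have "ln ((1 / real d ^ 5) * r powr q) = - (5 * ln d) + q * ln r"
    using d r by (simp add: ln_mult ln_div ln_realpow ln_powr)
  moreover have "ln (phi q t) = q * ln (nrm t)" using nt by (simp add: phi_def ln_powr)
  ultimately have "- (5 * ln d) + q * ln r < q * ln (nrm t)" by simp
  then have "(- (5 * ln d) + q * ln r) / q < ln (nrm t)" using q by (simp add: pos_divide_less_eq mult.commute)
  moreover have "(- (5 * ln d) + q * ln r) / q = - (5 * ln d / q) + ln r" using q by (simp add: add_divide_distrib diff_divide_distrib)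
  ultimately have "- (5 * ln d / q) - ln 2 / d < ln (nrm t)" using tau(2) by (simp add: minus_divide_left[symmetric])
  moreover have "ln (nrm t) \<le> nrm t - 1" using nt by (rule ln_le_minus_one)
  ultimately show ?thesis using nt by (auto simp: min_def)
qed

lemma latent_graph_torus: "latent_graph (circ.P {..<d}) (\<lambda>x z. qdist q d x z \<le> t)"
proof -
  have "Measurable.pred (circ.P {..<d} \<Otimes>\<^sub>M circ.P {..<d}) (\<lambda>z. qdist q d (fst z) (snd z) \<le> t)"
    unfolding qdist_eq using ssum_measurable_pair[of q "{..<d}"] by measurable
  then show ?thesis
    by (simp add: latent_graph_def latent_graph_axioms_def iid_product_def circ.prob_space_P)
qed

text \<open>Combines \<open>total_variation_bound\<close> with \<open>gam_mgf_bound\<close> at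
  \<open>l = 4 * k\<close> for \<open>k < n\<close>. The relative scale \<open>1 / d^5\<close> makes
  \<open>\<xi> = 4 / d^3\<close> negligible against the main terms, at the price of only the
  logarithm \<open>5 * ln d / q\<close> in \<open>\<epsilon>\<close>.\<close>

lemma tv_quantitative:
  fixes n d :: nat and q :: real
  assumes q: "1 \<le> q" and d: "128 \<le> d"
  defines "p \<equiv> min 1 (262208 * q / d)" and "\<epsilon> \<equiv> min 1 (5 * ln d / q + ln 2 / d)"
    and "\<xi> \<equiv> 4 * (real d)\<^sup>2 * (1 / real d ^ 5)"
  assumes small: "4 * real n * (2 * p * \<epsilon> + \<xi>) \<le> 1"
  shows "(tv_rgg_er n d q)\<^sup>2
    \<le> n * (exp (d * ((4 * real n)\<^sup>2 * (8 * p\<^sup>2 * \<epsilon>^3 + 2 * \<xi>\<^sup>2))) + exp n * exp (- real d / 64) - 1)"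
proof -
  define \<tau> where "\<tau> = tau_half q d"
  define T where "T = \<tau> powr q"
  have d1: "1 \<le> d" "2 \<le> d" using d by auto
  have tau: "0 < \<tau>" "ssum_cdf q d T = 1/2" using tau_half_properties[OF q d1(1)] by (auto simp: \<tau>_def T_def)
  have T: "0 < T" using tau by (simp add: T_def)
  interpret PI: prob_space "circ.P {..<d}" by (rule circ.prob_space_P)
  interpret LG: latent_graph "circ.P {..<d}" "\<lambda>x z. qdist q d x z \<le> \<tau>" by (rule latent_graph_torus)
  have half: "(\<integral>y. sg q d T y w \<partial>circ.P {..<d}) = 0" for w
  proof -
    note m = ssum_measurable[of "{..<d}" "{..<d}" q w]
    have i: "integrable (circ.P {..<d}) (\<lambda>y. indicator {..T} (ssum q {..<d} w y) :: real)"
      by (rule PI.integrable_bounded[where B=1]) (use m in \<open>auto simp: indicator_def\<close>)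
    have "(\<integral>y. sg q d T y w \<partial>circ.P {..<d}) = (\<integral>y. indicator {..T} (ssum q {..<d} w y) - 1/2 \<partial>circ.P {..<d})"
      unfolding sg_commute[of q d T _ w] by (simp add: sg_def)
    also have "\<dots> = (\<integral>y. indicator {..T} (ssum q {..<d} w y) \<partial>circ.P {..<d}) - 1/2"
      using i by (simp add: PI.prob_space)
    also have "(\<integral>y. indicator {..T} (ssum q {..<d} w y) \<partial>circ.P {..<d})
       = (\<integral>y. indicator {y \<in> space (circ.P {..<d}). ssum q {..<d} w y \<le> T} y \<partial>circ.P {..<d} :: real)"
      by (rule Bochner_Integration.integral_cong) (auto simp: indicator_def)
    also have "\<dots> = measure (circ.P {..<d}) {y \<in> space (circ.P {..<d}). ssum q {..<d} w y \<le> T}" using m by simp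
    also have "\<dots> = ssum_cdf q d T" unfolding ssum_cdf_def by (rule ssum_law_invariant)
    finally show ?thesis using tau by simp
  qed
  have eps: "0 \<le> \<epsilon>" "\<epsilon> \<le> 1" using q d by (auto simp: \<epsilon>_def)
  have eta: "0 \<le> 1 / real d ^ 5" "1 / real d ^ 5 \<le> 1/2"
  proof -
    have "2 \<le> real d" using d by simp
    also have "real d \<le> real d ^ 5" using d by (intro self_le_power) auto
    finally have "2 \<le> real d ^ 5" .
    then show "1 / real d ^ 5 \<le> 1/2" using d by (intro divide_left_mono) auto
  qed simp
  have th: "1 - \<epsilon> < nrm t" if "1 / real d ^ 5 * T < phi q t" for t
    using threshold_nrm[OF q d1(2)] that unfolding \<epsilon>_def T_def \<tau>_def by blast
  have p: "0 \<le> p" using q by (simp add: p_def)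
  have xi: "0 \<le> \<xi>" by (simp add: \<xi>_def)
  define V where "V = 8 * p\<^sup>2 * \<epsilon>^3 + 2 * \<xi>\<^sup>2"
  have V: "0 \<le> V" using eps by (auto simp: V_def)
  define B where "B = exp (d * ((4 * real n)\<^sup>2 * V)) + exp n * exp (- real d / 64)"
  \<comment> \<open>For signs of size 1/2, agreement is 1/2 plus twice the product.\<close>
  have agree: "2 * LG.agree z z' = 1 + 4 * gam q d T z z'" if z: "z \<in> space (circ.P {..<d})" "z' \<in> space (circ.P {..<d})" for z z'
  proof -
    have e: "of_bool ((qdist q d x z \<le> \<tau>) = (qdist q d x z' \<le> \<tau>)) = 1/2 + 2 * (sg q d T z x * sg q d T z' x)" for x
    proof -
      have "qdist q d x y \<le> \<tau> \<longleftrightarrow> ssum q {..<d} y x \<le> T" for y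
        unfolding qdist_le_iff[OF q less_imp_le[OF tau(1)]] T_def
        by (simp add: ssum_def phi_def nrm_minus_commute)
      then show ?thesis by (simp add: sg_def indicator_def)
    qed
    have "(\<lambda>x. sg q d T z x * sg q d T z' x) \<in> borel_measurable (circ.P {..<d})" by measurable
    then have i: "integrable (circ.P {..<d}) (\<lambda>x. sg q d T z x * sg q d T z' x)"
      by (rule PI.integrable_bounded) (rule sg_prod_bound)
    have "LG.agree z z' = 1/2 + 2 * gam q d T z z'"
      unfolding LG.agree_def e gam_def using i by (simp add: PI.prob_space)
    then show ?thesis by simp
  qed
  have ag: "\<bar>(2 * LG.agree z z') ^ k\<bar> \<le> 2 ^ k" if "z \<in> space (circ.P {..<d})" "z' \<in> space (circ.P {..<d})" for z z' k
    using LG.agree_bounds[OF that] by (simp add: power_mult_distrib abs_mult power_abs power_le_one)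
  have mag: "(\<lambda>(z, z'). (2 * LG.agree z z') ^ k) \<in> borel_measurable (circ.P {..<d} \<Otimes>\<^sub>M circ.P {..<d})" for k
    using LG.agree_measurable by (simp add: split_beta')
  have mag1: "(\<lambda>z'. (2 * LG.agree z z') ^ k) \<in> borel_measurable (circ.P {..<d})" if "z \<in> space (circ.P {..<d})" for z k
    using measurable_compose[OF measurable_Pair1'[OF that] mag] by simp
  have inner: "(\<integral>z'. (2 * LG.agree z z') ^ k \<partial>circ.P {..<d}) \<le> B" if k: "k < n" and z: "z \<in> space (circ.P {..<d})" for k z
  proof -
    define l where "l = 4 * real k"
    have l: "0 \<le> l" "l \<le> 4 * real n" using k by (auto simp: l_def)
    have "(\<integral>z'. (2 * LG.agree z z') ^ k \<partial>circ.P {..<d}) \<le> (\<integral>z'. exp (l * gam q d T z z') \<partial>circ.P {..<d})"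
    proof (rule integral_mono)
      show "integrable (circ.P {..<d}) (\<lambda>z'. (2 * LG.agree z z') ^ k)"
        by (rule PI.integrable_bounded[OF mag1[OF z] ag[OF z]])
      show "integrable (circ.P {..<d}) (\<lambda>z'. exp (l * gam q d T z z'))"
      proof (rule PI.integrable_bounded)
        show "(\<lambda>z'. exp (l * gam q d T z z')) \<in> borel_measurable (circ.P {..<d})"
          using gam_measurable[of q d T z] by measurable
        show "\<bar>exp (l * gam q d T z z')\<bar> \<le> exp (l * (1/4))" for z'
        proof -
          have "gam q d T z z' \<le> 1/4" using gam_bound[of q d T z z'] by linarith
          from mult_left_mono[OF this l(1)] show ?thesis by simp
        qed
      qed
      show "(2 * LG.agree z z') ^ k \<le> exp (l * gam q d T z z')" if z': "z' \<in> space (circ.P {..<d})" for z'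
      proof -
        \<comment> \<open>Nonnegativity of the base allows \<open>1 + t <= exp t\<close> to be
          raised to the power \<open>k\<close>.\<close>
        have "0 \<le> 1 + 4 * gam q d T z z'" using gam_bound[of q d T z z'] by linarith
        then have "(1 + 4 * gam q d T z z') ^ k \<le> exp (4 * gam q d T z z') ^ k"
          by (intro power_mono exp_ge_add_one_self)
        also have "\<dots> = exp (l * gam q d T z z')" by (simp add: exp_of_nat_mult[symmetric] l_def mult.assoc mult.left_commute)
        finally show ?thesis by (simp add: agree[OF z z'])
      qed
    qed
    also have "\<dots> \<le> exp (d * (l\<^sup>2 * V)) + exp (l / 4) * exp (- real d / 64)"
      unfolding V_def p_def \<xi>_def
    proof (rule gam_mgf_bound[OF q d T eta eps th half l(1)])
      have "l * (2 * p * \<epsilon> + \<xi>) \<le> 4 * real n * (2 * p * \<epsilon> + \<xi>)" using l p eps xi by (intro mult_right_mono) auto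
      then show "l * (2 * min 1 (262208 * q / real d) * \<epsilon> + 4 * (real d)\<^sup>2 * (1 / real d ^ 5)) \<le> 1"
        using small unfolding p_def \<xi>_def by linarith
    qed
    also have "\<dots> \<le> B"
      unfolding B_def
    proof (intro add_mono mult_right_mono)
      show "exp (d * (l\<^sup>2 * V)) \<le> exp (d * ((4 * real n)\<^sup>2 * V))"
      proof -
        have "l\<^sup>2 * V \<le> (4 * real n)\<^sup>2 * V" by (intro mult_right_mono power_mono l V)
        then have "d * (l\<^sup>2 * V) \<le> d * ((4 * real n)\<^sup>2 * V)" by (rule mult_left_mono) simp
        then show ?thesis by (simp only: exp_le_cancel_iff)
      qed
      show "exp (l / 4) \<le> exp (real n)" using k by (simp add: l_def)
    qed auto
    finally show ?thesis .
  qed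
  have outer: "(\<integral>z. (\<integral>z'. (2 * LG.agree z z') ^ k \<partial>circ.P {..<d}) \<partial>circ.P {..<d}) \<le> B" if k: "k < n" for k
  proof (rule PI.integral_le_const_real[OF _ inner[OF k]])
    have "(\<lambda>z. \<integral>z'. (2 * LG.agree z z') ^ k \<partial>circ.P {..<d}) \<in> borel_measurable (circ.P {..<d})"
      using mag[of k] by (intro PI.borel_measurable_lebesgue_integral) simp
    then show "integrable (circ.P {..<d}) (\<lambda>z. \<integral>z'. (2 * LG.agree z z') ^ k \<partial>circ.P {..<d})"
      by (rule PI.integrable_bounded) (rule PI.integral_abs_le[OF mag1 ag])
  qed
  have gp: "rgg_prob n d q G = LG.gprob n G" for G
    unfolding rgg_prob_def LG.gprob_def latent_def unif_torus_eq rgg_edges_def LG.edges_def \<tau>_def[symmetric] ..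
  have "(tv_rgg_er n d q)\<^sup>2 \<le> (\<Sum>k<n. (\<integral>z. (\<integral>z'. (2 * LG.agree z z') ^ k \<partial>circ.P {..<d}) \<partial>circ.P {..<d}) - 1)"
    unfolding tv_rgg_er_def gp er_prob_def by (rule LG.total_variation_bound)
  also have "\<dots> \<le> (\<Sum>k<n. B - 1)" using outer by (intro sum_mono) auto
  also have "\<dots> = n * (B - 1)" by simp
  finally show ?thesis unfolding B_def V_def by simp
qed

text \<open>Up to a constant, an upper bound for \<open>d\<close> times the variance proxy of one
  increment, valid for all \<open>q >= 1\<close> at once.\<close>

definition rate :: "nat \<Rightarrow> real \<Rightarrow> real" where
  "rate d q = ln d ^ 3 * (1 / (real d)\<^sup>2 + 1 / (d * q))"

lemma tv_rate_bound:
  obtains K :: real where "1 \<le> K" "\<And>n d q. 1 \<le> n \<Longrightarrow> 1 \<le> q \<Longrightarrow> 128 \<le> d \<Longrightarrow> K * (real n ^ 3 * rate d q) \<le> 1 \<Longrightarrow>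
    (tv_rgg_er n d q)\<^sup>2 \<le> K * (real n ^ 3 * rate d q) + n * (exp n * exp (- real d / 64))"
proof -
  \<comment> \<open>\<open>C1 = 5 * 262208 + 1\<close> bounds \<open>p * e\<close> in units of
    \<open>L/x\<close>. In \<open>C2\<close>, the number 40 is 8 times the 5 of
    \<open>5 * L / q\<close>, and 32 comes from \<open>2 * s^2\<close>. In \<open>K\<close>, the
    first summand controls the exponent and the square enforces the smallness condition of
    \<open>tv_quantitative\<close>.\<close>
  define C1 :: real where "C1 = 1311041"
  define C2 :: real where "C2 = 40 * C1\<^sup>2 + 32"
  define K where "K = 32 * C2 + (8 * C1 + 16)\<^sup>2"
  have "1 \<le> K" by (simp add: K_def C2_def C1_def)
  moreover have "(tv_rgg_er n d q)\<^sup>2 \<le> K * (real n ^ 3 * rate d q) + n * (exp n * exp (- real d / 64))"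
    if n: "1 \<le> n" and q: "1 \<le> q" and d: "128 \<le> d" and sm: "K * (real n ^ 3 * rate d q) \<le> 1" for n d q
  proof -
    define L where "L = ln (real d)"
    define x where "x = real d"
    have x: "128 \<le> x" using d by (simp add: x_def)
    have L: "1 \<le> L"
    proof -
      have "exp 1 \<le> (3::real)" by (rule exp_le)
      then have "exp 1 \<le> real d" using d by simp
      then show ?thesis unfolding L_def using d by (simp add: ln_ge_iff)
    qed
    have ln2: "ln 2 \<le> (1::real)" using ln_le_minus_one[of "2::real"] by simp
    define p where "p = min 1 (262208 * q / x)"
    define e where "e = min 1 (5 * L / q + ln 2 / x)"
    define s where "s = 4 * x\<^sup>2 * (1 / x ^ 5)"
    have s: "s = 4 / x ^ 3" using x by (simp add: s_def field_simps power_numeral_reduce)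
    have p: "0 \<le> p" "p \<le> 1" "p \<le> 262208 * q / x" using q x by (auto simp: p_def)
    have e: "0 \<le> e" "e \<le> 1" "e \<le> 5 * L / q + ln 2 / x" using q x L by (auto simp: e_def)
    \<comment> \<open>The factor \<open>q\<close> of the pivotality bound cancels the
      \<open>1/q\<close> of the arc length, so this product has the same order in all
      regimes.\<close>
    have pe: "p * e \<le> C1 * L / x"
    proof -
      have "p * e \<le> p * (5 * L / q + ln 2 / x)" using p e by (intro mult_left_mono) auto
      also have "\<dots> = p * (5 * L / q) + p * (ln 2 / x)" by (simp add: algebra_simps)
      also have "p * (5 * L / q) \<le> (262208 * q / x) * (5 * L / q)" using p L q by (intro mult_right_mono) auto
      also have "(262208 * q / x) * (5 * L / q) = 1311040 * L / x" using q by simp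
      also have "p * (ln 2 / x) \<le> 1 * (L / x)" using p ln2 L x by (intro mult_mono divide_right_mono) auto
      finally show ?thesis by (simp add: C1_def add_divide_distrib[symmetric])
    qed
    have s_le: "s \<le> 4 * L / x"
    proof -
      have "x \<le> x ^ 3" using x by (intro self_le_power) auto
      then have "4 / x ^ 3 \<le> 4 / x" using x by (intro divide_left_mono) auto
      also have "\<dots> \<le> 4 * L / x" using L x by (intro divide_right_mono) auto
      finally show ?thesis unfolding s .
    qed
    have s0: "0 \<le> s" using x by (simp add: s_def)
    define R where "R = rate d q"
    have R: "R = L ^ 3 * (1 / x\<^sup>2 + 1 / (x * q))" by (simp add: R_def rate_def L_def x_def)
    have R0: "0 \<le> R" unfolding R using L x q by simp
    have K3: "0 \<le> K" using \<open>1 \<le> K\<close> by simp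
    have small: "4 * real n * (2 * p * e + s) \<le> 1"
    proof -
      have "2 * p * e + s \<le> (2 * C1 + 4) * (L / x)" 
      proof -
        have "(2 * C1 + 4) * (L / x) = 2 * (C1 * L / x) + 4 * L / x" by (simp add: algebra_simps)
        moreover have "2 * p * e = 2 * (p * e)" by simp
        ultimately show ?thesis using pe s_le by linarith
      qed
      then have "4 * real n * (2 * p * e + s) \<le> 4 * real n * ((2 * C1 + 4) * (L / x))" by (intro mult_left_mono) auto
      also have "\<dots> = (8 * C1 + 16) * (real n * (L / x))" by (simp add: algebra_simps)
      also have "\<dots> \<le> 1"
      \<comment> \<open>Squared, the quantity is at most a constant times
        \<open>n^2 * L^2 / x^2\<close>, which the assumed smallness of \<open>n^3 * rate\<close>
        dominates.\<close>
      proof (rule power2_le_imp_le)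
        have "((8 * C1 + 16) * (real n * (L / x)))\<^sup>2 = (8 * C1 + 16)\<^sup>2 * ((real n)\<^sup>2 * (L\<^sup>2 * (1 / x\<^sup>2)))"
          by (simp add: power_mult_distrib power_divide)
        also have "\<dots> \<le> K * (real n ^ 3 * R)"
        proof (intro mult_mono)
          show "(8 * C1 + 16)\<^sup>2 \<le> K" unfolding K_def C2_def by simp
          show "(real n)\<^sup>2 \<le> real n ^ 3" using n by (intro power_increasing) auto
          show "L\<^sup>2 * (1 / x\<^sup>2) \<le> R"
            unfolding R using L x q by (intro mult_mono power_increasing) auto
        qed (use L x K3 in auto)
        also have "\<dots> \<le> 1\<^sup>2" using sm by (simp add: R_def)
        finally show "((8 * C1 + 16) * (real n * (L / x)))\<^sup>2 \<le> 1\<^sup>2" .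
      qed simp
      finally show ?thesis .
    qed
    define V where "V = 8 * p\<^sup>2 * e ^ 3 + 2 * s\<^sup>2"
    have xV: "x * V \<le> C2 * R"
    proof -
      have "8 * p\<^sup>2 * e ^ 3 = 8 * ((p * e)\<^sup>2 * e)" by (simp add: power_mult_distrib power2_eq_square power3_eq_cube)
      also have "(p * e)\<^sup>2 * e \<le> (C1 * L / x)\<^sup>2 * (5 * L / q + ln 2 / x)"
        using pe p e by (intro mult_mono power_mono) auto
      also have "\<dots> \<le> (C1 * L / x)\<^sup>2 * (5 * L / q + 5 * L / x)"
      proof (intro mult_left_mono add_left_mono divide_right_mono)
        show "ln 2 \<le> 5 * L" using ln2 L by linarith
      qed (use x in auto)
      also have "\<dots> = 5 * C1\<^sup>2 * (L ^ 3 * (1 / x\<^sup>2 * (1 / q + 1 / x)))"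
        by (simp add: power_mult_distrib power_divide power2_eq_square power3_eq_cube algebra_simps)
      finally have "8 * p\<^sup>2 * e ^ 3 \<le> 40 * C1\<^sup>2 * (L ^ 3 * (1 / x\<^sup>2 * (1 / q + 1 / x)))" by simp
      then have "x * (8 * p\<^sup>2 * e ^ 3) \<le> x * (40 * C1\<^sup>2 * (L ^ 3 * (1 / x\<^sup>2 * (1 / q + 1 / x))))"
        using x by (intro mult_left_mono) auto
      also have "\<dots> = 40 * C1\<^sup>2 * R" unfolding R using x q by (simp add: power2_eq_square field_simps)
      finally have a: "x * (8 * p\<^sup>2 * e ^ 3) \<le> 40 * C1\<^sup>2 * R" .
      have "x * (2 * s\<^sup>2) = 32 / x ^ 5" unfolding s using x by (simp add: power_divide field_simps power_numeral_reduce)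
      also have "\<dots> \<le> 32 / x\<^sup>2" using x by (intro divide_left_mono power_increasing) auto
      also have "\<dots> = 32 * (1 * (1 / x\<^sup>2 + 0))" by simp
      also have "\<dots> \<le> 32 * R"
        unfolding R using L x q by (intro mult_left_mono mult_mono add_left_mono) (auto simp: one_le_power)
      finally have b: "x * (2 * s\<^sup>2) \<le> 32 * R" .
      show ?thesis using a b unfolding V_def C2_def by (simp add: algebra_simps)
    qed
    define y where "y = x * ((4 * real n)\<^sup>2 * V)"
    have V0: "0 \<le> V" using e by (auto simp: V_def)
    have y: "0 \<le> y" "y \<le> 16 * C2 * ((real n)\<^sup>2 * R)"
    proof -
      show "0 \<le> y" using V0 x by (simp add: y_def)
      have "y = 16 * (real n)\<^sup>2 * (x * V)" by (simp add: y_def power_mult_distrib algebra_simps)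
      also have "\<dots> \<le> 16 * (real n)\<^sup>2 * (C2 * R)" using xV by (intro mult_left_mono) auto
      finally show "y \<le> 16 * C2 * ((real n)\<^sup>2 * R)" by (simp add: algebra_simps)
    qed
    have ny: "2 * (real n * y) \<le> K * (real n ^ 3 * R)"
    proof -
      have "2 * (real n * y) \<le> 2 * (real n * (16 * C2 * ((real n)\<^sup>2 * R)))" using y by (intro mult_left_mono) auto
      also have "\<dots> = (32 * C2) * (real n ^ 3 * R)" by (simp add: power2_eq_square power3_eq_cube)
      also have "\<dots> \<le> K * (real n ^ 3 * R)" using R0 by (intro mult_right_mono) (auto simp: K_def)
      finally show ?thesis .
    qed
    \<comment> \<open>The smallness assumption also keeps the exponent \<open>y\<close> below 1,
      where \<open>exp y - 1 <= 2 * y\<close> linearises the bound.\<close>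
    have "y \<le> real n * y" using y n by (simp add: mult_le_cancel_right1)
    then have y1: "y \<le> 1" using ny sm y by (simp add: R_def)
    have ey: "exp y - 1 \<le> 2 * y"
    proof -
      have "exp y \<le> 1 + y + y\<^sup>2" using exp_bound[OF y(1) y1] .
      moreover have "y\<^sup>2 \<le> y" unfolding power2_eq_square using y y1 mult_left_mono[of y 1 y] by simp
      ultimately show ?thesis by linarith
    qed
    have "(tv_rgg_er n d q)\<^sup>2 \<le> n * (exp (d * ((4 * real n)\<^sup>2 * V)) + exp n * exp (- real d / 64) - 1)"
      unfolding V_def p_def e_def s_def x_def L_def
      by (rule tv_quantitative[OF q d]) (use small in \<open>simp only: p_def e_def s_def x_def L_def\<close>)
    also have "exp (d * ((4 * real n)\<^sup>2 * V)) = exp y" by (simp add: y_def x_def)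
    also have "n * (exp y + exp n * exp (- real d / 64) - 1) = n * (exp y - 1) + n * (exp n * exp (- real d / 64))"
      by (simp add: algebra_simps)
    also have "n * (exp y - 1) \<le> n * (2 * y)" using ey by (intro mult_left_mono) auto
    also have "n * (2 * y) \<le> K * (real n ^ 3 * R)" using ny by simp
    finally show ?thesis by (simp add: R_def)
  qed
  ultimately show ?thesis using that by blast
qed

section \<open>Asymptotics\<close>

lemma rate_nonneg: "1 \<le> d \<Longrightarrow> 1 \<le> q \<Longrightarrow> 0 \<le> rate d q"
  by (simp add: rate_def)

text \<open>Besides the main term, \<open>n * exp (n - d/64)\<close> must vanish. This needs
  \<open>d\<close> to be at least linear in \<open>n\<close> with a large constant, and smallness of
  \<open>n^3 * rate\<close> already provides it.\<close>

lemma tv_tendsto_0: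
  fixes d :: "nat \<Rightarrow> nat" and q :: "nat \<Rightarrow> real"
  assumes q: "\<And>n. 1 \<le> q n" and d: "eventually (\<lambda>n. 128 \<le> d n) sequentially"
    and r: "(\<lambda>n. real n ^ 3 * rate (d n) (q n)) \<longlonglongrightarrow> 0"
  shows "(\<lambda>n. tv_rgg_er n (d n) (q n)) \<longlonglongrightarrow> 0"
proof -
  obtain K :: real where K: "1 \<le> K" "\<And>n d q. 1 \<le> n \<Longrightarrow> 1 \<le> q \<Longrightarrow> 128 \<le> d \<Longrightarrow> K * (real n ^ 3 * rate d q) \<le> 1 \<Longrightarrow>
    (tv_rgg_er n d q)\<^sup>2 \<le> K * (real n ^ 3 * rate d q) + n * (exp n * exp (- real d / 64))"
    using tv_rate_bound by blast
  define U where "U n = real n ^ 3 * rate (d n) (q n)" for n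
  have "(\<lambda>n. K * U n) \<longlonglongrightarrow> K * 0" unfolding U_def by (intro tendsto_mult_left r)
  then have KU: "(\<lambda>n. K * U n) \<longlonglongrightarrow> 0" by simp
  have ev1: "eventually (\<lambda>n. K * U n < 1) sequentially" using order_tendstoD(2)[OF KU] by simp
  have U_small: "eventually (\<lambda>n. U n < 1) sequentially"
    using order_tendstoD(2)[OF r] unfolding U_def by simp
  have ev: "eventually (\<lambda>n. (tv_rgg_er n (d n) (q n))\<^sup>2 \<le> K * U n + 2 / real n) sequentially"
    using ev1 U_small d eventually_ge_at_top[of "128\<^sup>2"]
  proof eventually_elim
    case (elim n)
    have n: "1 \<le> n" "128\<^sup>2 \<le> real n" using elim(4) by (simp_all add: real_of_nat_ge_one_iff)
    define x where "x = real (d n)"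
    have x: "128 \<le> x" using elim by (simp add: x_def)
    have "exp 1 \<le> x" using exp_le x by linarith
    then have L: "1 \<le> ln x" using x by (simp add: ln_ge_iff)
    \<comment> \<open>\<open>rate\<close> is at least \<open>1 / x^2\<close>, hence
      \<open>n^3 < x^2\<close>; together with \<open>n >= 128^2\<close> this gives
      \<open>128 * n <= x\<close>.\<close>
    have "real n ^ 3 * (1 * (1 / x\<^sup>2)) \<le> real n ^ 3 * (ln x ^ 3 * (1 / x\<^sup>2 + 1 / (x * q n)))"
      using L x q[of n] by (intro mult_left_mono mult_mono) (auto simp: one_le_power)
    also have "\<dots> < 1" using elim(2) by (simp add: U_def rate_def x_def)
    finally have nx: "real n ^ 3 < x\<^sup>2" using x by (simp add: field_simps)
    have "(128 * real n)\<^sup>2 = 128\<^sup>2 * (real n)\<^sup>2" by (simp add: power_mult_distrib)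
    also have "\<dots> \<le> real n * (real n)\<^sup>2" using n by (intro mult_right_mono) auto
    also have "\<dots> = real n ^ 3" by (simp add: power2_eq_square power3_eq_cube)
    finally have "(128 * real n)\<^sup>2 \<le> x\<^sup>2" using nx by linarith
    then have nd: "128 * real n \<le> x" by (rule power2_le_imp_le) (use x in simp)
    \<comment> \<open>In this unit the exponent is \<open>n - 2 * v <= - v\<close>, and
      \<open>v * exp (- v)\<close> is at most \<open>2 / v\<close>.\<close>
    define v where "v = x / 128"
    have v: "real n \<le> v" "0 < v" "1 \<le> v" using nd n x by (auto simp: v_def)
    have "exp n * exp (- x / 64) = exp (real n - 2 * v)" by (simp add: v_def exp_add[symmetric])
    also have "\<dots> \<le> exp (- v)" using v by simp
    finally have "n * (exp n * exp (- x / 64)) \<le> v * exp (- v)" using v by (intro mult_mono) auto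
    also have "v * exp (- v) \<le> 2 / v"
    proof -
      have "v\<^sup>2 / 2 \<le> exp v" using exp_lower_Taylor_quadratic[of v] v by linarith
      then have "v * v \<le> 2 * exp v" by (simp add: power2_eq_square)
      then show ?thesis using v by (simp add: exp_minus field_simps)
    qed
    also have "2 / v \<le> 2 / real n" using v n by (intro divide_left_mono) auto
    finally have "n * (exp n * exp (- x / 64)) \<le> 2 / real n" .
    moreover have "(tv_rgg_er n (d n) (q n))\<^sup>2 \<le> K * U n + n * (exp n * exp (- x / 64))"
      unfolding U_def x_def using elim n q by (intro K(2)) (auto simp: U_def)
    ultimately show ?case by linarith
  qed
  have "(\<lambda>n. K * U n + 2 / real n) \<longlonglongrightarrow> 0 + 0"
    by (intro tendsto_add KU lim_const_over_n)
  then have "(\<lambda>n. (tv_rgg_er n (d n) (q n))\<^sup>2) \<longlonglongrightarrow> 0"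
    by (intro tendsto_sandwich[OF _ ev tendsto_const]) auto
  then have "(\<lambda>n. sqrt ((tv_rgg_er n (d n) (q n))\<^sup>2)) \<longlonglongrightarrow> sqrt 0" by (rule tendsto_real_sqrt)
  then show ?thesis by (simp add: tendsto_rabs_zero_iff)
qed

text \<open>The rate carries logarithms of \<open>d\<close>, the hypotheses logarithms of
  \<open>n\<close>, and \<open>d\<close> may be superpolynomial in \<open>n\<close>. For
  \<open>d <= n^8\<close> the two logarithms are comparable. Otherwise \<open>n^3 * ln d ^ m\<close>
  is of order at most \<open>d powr (3/8 + 1/8)\<close>, and division by \<open>Y >= d\<close>
  leaves at most a constant over \<open>n\<close>.\<close>

lemma log_factor_bound:
  fixes n d m :: nat and Y :: real
  assumes n: "1 \<le> n" and d: "1 \<le> d" and Y: "real d \<le> Y" and m: "1 \<le> m"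
  shows "real n ^ 3 * ln d ^ m / Y \<le> 8 ^ m * (real n ^ 3 * ln n ^ m / Y) + (8 * m) ^ m / n"
proof (cases "d \<le> n ^ 8")
  case True
  then have "real d \<le> real n ^ 8" by (metis of_nat_le_iff of_nat_power)
  then have "ln (real d) \<le> ln (real n ^ 8)" using d n by (subst ln_le_cancel_iff) auto
  then have "ln (real d) \<le> 8 * ln (real n)" using n by (simp add: ln_realpow)
  then have "ln d ^ m \<le> (8 * ln n) ^ m" using d by (intro power_mono) auto
  then have "real n ^ 3 * ln d ^ m / Y \<le> real n ^ 3 * (8 * ln n) ^ m / Y"
    using Y by (intro divide_right_mono mult_left_mono) auto
  also have "\<dots> = 8 ^ m * (real n ^ 3 * ln n ^ m / Y)" by (simp add: power_mult_distrib)
  also have "\<dots> \<le> 8 ^ m * (real n ^ 3 * ln n ^ m / Y) + (8 * m) ^ m / n" by simp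
  finally show ?thesis by simp
next
  case False
  \<comment> \<open>With \<open>z >= n\<close>, the bound becomes a constant times
    \<open>z^3 * z / z^8 = 1 / z^4\<close>, the second \<open>z\<close> absorbing the
    logarithms.\<close>
  define z where "z = real d powr (1/8)"
  have d0: "0 < real d" using d by simp
  have z: "z ^ 8 = real d" using d0 by (simp add: z_def powr_powr powr_realpow[symmetric])
  have z0: "0 < z" using d0 by (simp add: z_def)
  have nz: "real n \<le> z"
  proof (rule power_le_imp_le_base)
    have "real n ^ 8 \<le> real d" using False by (metis less_imp_le not_le of_nat_le_iff of_nat_power)
    then show "real n ^ Suc 7 \<le> z ^ Suc 7" using z by simp
  qed (use z0 in simp)
  have "ln d ^ m \<le> (8 * m) ^ m * z"
  proof -
    define y where "y = real d powr (1 / (8 * m))"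
    have y0: "0 < y" using d0 by (simp add: y_def)
    have ym: "y ^ m = z" using d0 m by (simp add: y_def z_def powr_powr powr_realpow[symmetric])
    have "ln d = (8 * m) * ln y" using d0 m by (simp add: y_def ln_powr)
    also have "\<dots> \<le> (8 * m) * y" using ln_le_minus_one[OF y0] by (intro mult_left_mono) auto
    finally have "ln d ^ m \<le> ((8 * m) * y) ^ m" using d by (intro power_mono) auto
    then show ?thesis by (simp add: power_mult_distrib ym)
  qed
  then have "real n ^ 3 * ln d ^ m / Y \<le> z ^ 3 * ((8 * m) ^ m * z) / real d"
    using Y d0 nz z0 d by (intro frac_le mult_mono power_mono) auto
  also have "\<dots> = (8 * m) ^ m / z ^ 4"
    unfolding z[symmetric] using z0 by (simp add: field_simps power_numeral_reduce)
  also have "\<dots> \<le> (8 * m) ^ m / n"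
  proof (rule divide_left_mono)
    have "1 \<le> z" using nz n by linarith
    then have "z \<le> z ^ 4" by (intro self_le_power) auto
    then show "real n \<le> z ^ 4" using nz by linarith
  qed (use z0 n in auto)
  also have "\<dots> \<le> 8 ^ m * (real n ^ 3 * ln n ^ m / Y) + (8 * m) ^ m / n" using Y d0 n by simp
  finally show ?thesis .
qed

lemma log_factor_tendsto_0:
  fixes d :: "nat \<Rightarrow> nat" and Y :: "nat \<Rightarrow> real"
  assumes m: "1 \<le> m" and d: "eventually (\<lambda>n. 1 \<le> d n \<and> real (d n) \<le> Y n) sequentially"
    and Y: "Y \<in> \<omega>(\<lambda>n. real n ^ 3 * ln (real n) powr real m)"
  shows "(\<lambda>n. real n ^ 3 * ln (d n) ^ m / Y n) \<longlonglongrightarrow> 0"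
proof -
  have "(\<lambda>n. real n ^ 3 * ln (real n) powr real m / Y n) \<longlonglongrightarrow> 0"
    using Y by (intro smalloD_tendsto) (simp add: smallomega_iff_smallo)
  \<comment> \<open>\<open>powr\<close> and the natural power agree once \<open>ln n\<close> is
    positive, that is, from \<open>n = 2\<close> on.\<close>
  moreover have "eventually (\<lambda>n. real n ^ 3 * ln (real n) powr real m / Y n = real n ^ 3 * ln (real n) ^ m / Y n) sequentially"
    using eventually_ge_at_top[of 2] by eventually_elim (simp add: powr_realpow)
  ultimately have l: "(\<lambda>n. real n ^ 3 * ln (real n) ^ m / Y n) \<longlonglongrightarrow> 0"
    using tendsto_cong by fast
  have "(\<lambda>n. 8 ^ m * (real n ^ 3 * ln n ^ m / Y n) + (8 * m) ^ m / n) \<longlonglongrightarrow> 8 ^ m * 0 + 0"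
    by (intro tendsto_add tendsto_mult_left l lim_const_over_n)
  then have up: "(\<lambda>n. 8 ^ m * (real n ^ 3 * ln n ^ m / Y n) + (8 * m) ^ m / n) \<longlonglongrightarrow> 0" by simp
  have lo: "eventually (\<lambda>n. 0 \<le> real n ^ 3 * ln (d n) ^ m / Y n) sequentially"
    using d by eventually_elim (auto intro!: divide_nonneg_nonneg mult_nonneg_nonneg)
  have le: "eventually (\<lambda>n. real n ^ 3 * ln (d n) ^ m / Y n \<le> 8 ^ m * (real n ^ 3 * ln n ^ m / Y n) + (8 * m) ^ m / n) sequentially"
    using d eventually_ge_at_top[of 1] by eventually_elim (rule log_factor_bound, use m in auto)
  show ?thesis by (rule tendsto_sandwich[OF lo le tendsto_const up])
qed

lemma smallomega_cube_filterlim: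
  assumes "Y \<in> \<omega>(\<lambda>n. real n ^ 3 * ln (real n) powr C)" "0 \<le> C"
  shows "eventually (\<lambda>n. real n \<le> \<bar>Y n\<bar>) sequentially"
proof -
  have "eventually (\<lambda>n. norm (Y n) \<ge> 1 * norm (real n ^ 3 * ln (real n) powr C)) sequentially"
    using assms(1) by (rule landau_omega.smallD) simp
  then show ?thesis using eventually_ge_at_top[of 3]
  proof eventually_elim
    case (elim n)
    have "exp 1 \<le> (3::real)" by (rule exp_le)
    then have "1 \<le> ln (real n)" using elim(2) by (simp add: ln_ge_iff)
    then have "1 \<le> ln (real n) powr C" using assms(2) by (intro ge_one_powr_ge_zero) auto
    then have "real n * 1 \<le> real n ^ 3 * ln (real n) powr C"
      using elim(2) by (intro mult_mono self_le_power) auto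
    then show ?case using elim(1) by simp
  qed
qed

text \<open>Both parts are instances of \<open>tv_tendsto_0\<close>. If \<open>q <= d\<close>, the
  term \<open>1/(d*q)\<close> dominates the rate; if \<open>q\<close> is at least a constant times
  \<open>d / ln d\<close>, both terms are \<open>1/d^2\<close> up to one more logarithm. The hidden
  polylogarithm becomes a fixed exponent \<open>C\<close>, chosen before the sequences
  \<open>d\<close> and \<open>q\<close>.\<close>

theorem theorem1p8:
  shows "(\<exists>C::real. \<forall>(d::nat \<Rightarrow> nat) (q::nat \<Rightarrow> real).
            (\<forall>n. q n \<ge> 1) \<longrightarrow>
            q \<in> o(\<lambda>n. real (d n) / ln (real (d n))) \<longrightarrow>
            (\<lambda>n. real (d n) * q n) \<in> \<omega>(\<lambda>n. real n ^ 3 * ln (real n) powr C) \<longrightarrow>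
            (\<lambda>n. tv_rgg_er n (d n) (q n)) \<longlonglongrightarrow> 0)
       \<and> (\<exists>C::real. \<forall>(d::nat \<Rightarrow> nat) (q::nat \<Rightarrow> real).
            (\<forall>n. q n \<ge> 1) \<longrightarrow>
            q \<in> \<Omega>(\<lambda>n. real (d n) / ln (real (d n))) \<longrightarrow>
            (\<lambda>n. real (d n) ^ 2) \<in> \<omega>(\<lambda>n. real n ^ 3 * ln (real n) powr C) \<longrightarrow>
            (\<lambda>n. tv_rgg_er n (d n) (q n)) \<longlonglongrightarrow> 0)"
proof (intro conjI)
  show "\<exists>C::real. \<forall>(d::nat \<Rightarrow> nat) (q::nat \<Rightarrow> real).
            (\<forall>n. q n \<ge> 1) \<longrightarrow>
            q \<in> o(\<lambda>n. real (d n) / ln (real (d n))) \<longrightarrow>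
            (\<lambda>n. real (d n) * q n) \<in> \<omega>(\<lambda>n. real n ^ 3 * ln (real n) powr C) \<longrightarrow>
            (\<lambda>n. tv_rgg_er n (d n) (q n)) \<longlonglongrightarrow> 0"
  proof (intro exI[of _ "real 3"] allI impI)
    \<comment> \<open>The exponent 3 is that of the logarithm in \<open>rate\<close>.\<close>
    fix d :: "nat \<Rightarrow> nat" and q :: "nat \<Rightarrow> real"
    assume q: "\<forall>n. q n \<ge> 1" and small: "q \<in> o(\<lambda>n. real (d n) / ln (real (d n)))"
      and big: "(\<lambda>n. real (d n) * q n) \<in> \<omega>(\<lambda>n. real n ^ 3 * ln (real n) powr real 3)"
    have "eventually (\<lambda>n. norm (q n) \<le> (1/2) * norm (real (d n) / ln (real (d n)))) sequentially"
      using small by (rule landau_o.smallD) simp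
    then have qd: "eventually (\<lambda>n. 2 \<le> d n \<and> q n \<le> real (d n)) sequentially"
    proof eventually_elim
      case (elim n)
      have "1 \<le> q n" using q by simp
      have d2: "2 \<le> d n"
      proof (rule ccontr)
        assume "\<not> 2 \<le> d n"
        \<comment> \<open>For these values \<open>d / ln d\<close> is 0 by the conventions for
          \<open>ln 0\<close> and division by 0, against \<open>q n >= 1\<close>.\<close>
        then have "d n = 0 \<or> d n = 1" by auto
        then show False using elim \<open>1 \<le> q n\<close> by auto
      qed
      have "ln 2 \<le> ln (real (d n))" using d2 by simp
      moreover have "1/2 \<le> ln (2::real)" using ln_add1_ge[of "1::real"] by simp
      ultimately have l: "1/2 \<le> ln (real (d n))" by linarith
      then have "real (d n) / ln (real (d n)) \<le> real (d n) / (1/2)" by (intro divide_left_mono) auto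
      then have "q n \<le> real (d n)" using elim \<open>1 \<le> q n\<close> l by simp
      then show ?case using d2 by simp
    qed
    have ge: "eventually (\<lambda>n. real n \<le> \<bar>real (d n) * q n\<bar>) sequentially"
      by (rule smallomega_cube_filterlim[OF big]) simp
    \<comment> \<open>Growth of \<open>d\<close> is not assumed but forced:
      \<open>n <= d * q <= d^2\<close>.\<close>
    have d128: "eventually (\<lambda>n. 128 \<le> d n) sequentially"
      using qd ge eventually_ge_at_top[of "128\<^sup>2"]
    proof eventually_elim
      case (elim n)
      have "(128::real)\<^sup>2 \<le> real n" using elim(3) by (metis of_nat_le_iff of_nat_numeral of_nat_power)
      also have "\<dots> \<le> real (d n) * q n" using elim q[rule_format, of n] by simp
      also have "\<dots> \<le> (real (d n))\<^sup>2" unfolding power2_eq_square using elim(1) by (intro mult_left_mono) auto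
      finally have "128 \<le> real (d n)" by (rule power2_le_imp_le) simp
      then show ?case by simp
    qed
    have "(\<lambda>n. real n ^ 3 * ln (d n) ^ 3 / (real (d n) * q n)) \<longlonglongrightarrow> 0"
    proof (rule log_factor_tendsto_0[OF _ _ big])
      show "eventually (\<lambda>n. 1 \<le> d n \<and> real (d n) \<le> real (d n) * q n) sequentially"
        using qd by eventually_elim (use q in \<open>auto simp: mult_le_cancel_left1\<close>)
    qed simp
    from tendsto_mult_left[OF this, of 2]
    have up: "(\<lambda>n. 2 * (real n ^ 3 * ln (d n) ^ 3 / (real (d n) * q n))) \<longlonglongrightarrow> 0" by simp
    show "(\<lambda>n. tv_rgg_er n (d n) (q n)) \<longlonglongrightarrow> 0"
    proof (rule tv_tendsto_0[OF _ d128])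
      show "1 \<le> q n" for n using q by simp
      show "(\<lambda>n. real n ^ 3 * rate (d n) (q n)) \<longlonglongrightarrow> 0"
      proof (rule tendsto_sandwich[OF _ _ tendsto_const up])
        show "eventually (\<lambda>n. 0 \<le> real n ^ 3 * rate (d n) (q n)) sequentially"
          using qd by eventually_elim (use q in \<open>auto intro!: mult_nonneg_nonneg rate_nonneg\<close>)
        show "eventually (\<lambda>n. real n ^ 3 * rate (d n) (q n) \<le> 2 * (real n ^ 3 * ln (d n) ^ 3 / (real (d n) * q n))) sequentially"
          using qd
        proof eventually_elim
          case (elim n)
          have q0: "0 < q n" using q[rule_format, of n] by linarith
          have "1 / (real (d n))\<^sup>2 \<le> 1 / (real (d n) * q n)"
            unfolding power2_eq_square using elim q0 by (intro divide_left_mono mult_left_mono) auto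
          then have "1 / (real (d n))\<^sup>2 + 1 / (real (d n) * q n) \<le> 2 * (1 / (real (d n) * q n))"
            unfolding mult_2 by (rule add_right_mono)
          then have "rate (d n) (q n) \<le> ln (d n) ^ 3 * (2 * (1 / (real (d n) * q n)))"
            unfolding rate_def by (rule mult_left_mono) (use elim in simp)
          then have "real n ^ 3 * rate (d n) (q n) \<le> real n ^ 3 * (ln (d n) ^ 3 * (2 * (1 / (real (d n) * q n))))"
            by (intro mult_left_mono) auto
          then show ?case by (simp add: mult.commute mult.left_commute)
        qed
      qed
    qed
  qed
  show "\<exists>C::real. \<forall>(d::nat \<Rightarrow> nat) (q::nat \<Rightarrow> real).
            (\<forall>n. q n \<ge> 1) \<longrightarrow>
            q \<in> \<Omega>(\<lambda>n. real (d n) / ln (real (d n))) \<longrightarrow>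
            (\<lambda>n. real (d n) ^ 2) \<in> \<omega>(\<lambda>n. real n ^ 3 * ln (real n) powr C) \<longrightarrow>
            (\<lambda>n. tv_rgg_er n (d n) (q n)) \<longlonglongrightarrow> 0"
  proof (intro exI[of _ "real 4"] allI impI)
    \<comment> \<open>One logarithm more than in the first part, since replacing \<open>1/q\<close>
      by a multiple of \<open>ln d / d\<close> costs a factor \<open>ln d\<close>.\<close>
    fix d :: "nat \<Rightarrow> nat" and q :: "nat \<Rightarrow> real"
    assume q: "\<forall>n. q n \<ge> 1" and large: "q \<in> \<Omega>(\<lambda>n. real (d n) / ln (real (d n)))"
      and big: "(\<lambda>n. real (d n) ^ 2) \<in> \<omega>(\<lambda>n. real n ^ 3 * ln (real n) powr real 4)"
    obtain c where c: "0 < c" "eventually (\<lambda>n. norm (q n) \<ge> c * norm (real (d n) / ln (real (d n)))) sequentially"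
      using large by (rule landau_omega.bigE)
    have ge: "eventually (\<lambda>n. real n \<le> \<bar>real (d n) ^ 2\<bar>) sequentially"
      by (rule smallomega_cube_filterlim[OF big]) simp
    have d128: "eventually (\<lambda>n. 128 \<le> d n) sequentially"
      using ge eventually_ge_at_top[of "128\<^sup>2"]
    proof eventually_elim
      case (elim n)
      have "(128::real)\<^sup>2 \<le> real n" using elim(2) by (metis of_nat_le_iff of_nat_numeral of_nat_power)
      also have "\<dots> \<le> (real (d n))\<^sup>2" using elim by simp
      finally have "128 \<le> real (d n)" by (rule power2_le_imp_le) simp
      then show ?case by simp
    qed
    have "(\<lambda>n. real n ^ 3 * ln (d n) ^ 4 / real (d n) ^ 2) \<longlonglongrightarrow> 0"
    proof (rule log_factor_tendsto_0[OF _ _ big])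
      show "eventually (\<lambda>n. 1 \<le> d n \<and> real (d n) \<le> real (d n) ^ 2) sequentially"
        using d128 by eventually_elim (auto intro!: self_le_power)
    qed simp
    from tendsto_mult_left[OF this, of "1 + 1/c"]
    have up: "(\<lambda>n. (1 + 1/c) * (real n ^ 3 * ln (d n) ^ 4 / real (d n) ^ 2)) \<longlonglongrightarrow> 0" by simp
    show "(\<lambda>n. tv_rgg_er n (d n) (q n)) \<longlonglongrightarrow> 0"
    proof (rule tv_tendsto_0[OF _ d128])
      show "1 \<le> q n" for n using q by simp
      show "(\<lambda>n. real n ^ 3 * rate (d n) (q n)) \<longlonglongrightarrow> 0"
      proof (rule tendsto_sandwich[OF _ _ tendsto_const up])
        show "eventually (\<lambda>n. 0 \<le> real n ^ 3 * rate (d n) (q n)) sequentially"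
          using d128 by eventually_elim (use q in \<open>auto intro!: mult_nonneg_nonneg rate_nonneg\<close>)
        show "eventually (\<lambda>n. real n ^ 3 * rate (d n) (q n) \<le> (1 + 1/c) * (real n ^ 3 * ln (d n) ^ 4 / real (d n) ^ 2)) sequentially"
          using d128 c(2)
        proof eventually_elim
          case (elim n)
          define x where "x = real (d n)"
          define L where "L = ln x"
          have x: "128 \<le> x" using elim by (simp add: x_def)
          have "exp 1 \<le> x" using exp_le x by linarith
          then have L: "1 \<le> L" unfolding L_def using x by (simp add: ln_ge_iff)
          have q1: "1 \<le> q n" using q by simp
          have qc: "c * (x / L) \<le> q n" using elim(2) q1 L x by (simp add: x_def L_def)
          have "1 / (x * q n) \<le> 1 / (x * (c * (x / L)))"
            using qc q1 x L c by (intro divide_left_mono mult_left_mono mult_pos_pos) auto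
          also have "\<dots> = (1/c) * L / x\<^sup>2" by (simp add: power2_eq_square)
          finally have "1 / x\<^sup>2 + 1 / (x * q n) \<le> L / x\<^sup>2 + (1/c) * L / x\<^sup>2"
            using L x by (intro add_mono divide_right_mono) auto
          then have "L ^ 3 * (1 / x\<^sup>2 + 1 / (x * q n)) \<le> L ^ 3 * (L / x\<^sup>2 + (1/c) * L / x\<^sup>2)"
            using L by (intro mult_left_mono) auto
          also have "\<dots> = (1 + 1/c) * (L ^ 4 / x\<^sup>2)" by (simp add: algebra_simps power_numeral_reduce add_divide_distrib)
          finally have "real n ^ 3 * (L ^ 3 * (1 / x\<^sup>2 + 1 / (x * q n))) \<le> real n ^ 3 * ((1 + 1/c) * (L ^ 4 / x\<^sup>2))"
            by (intro mult_left_mono) auto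
          then show ?case unfolding rate_def x_def[symmetric] L_def[symmetric] by (simp add: algebra_simps)
        qed
      qed
    qed
  qed
qed

end
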